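(* Let $G$ be a group with a ramification data $\mathfrak{r}=\sum_{C\in\mathcal{C}}\mathfrak{r}_C C$ of finite support and let $K$ be an arbitrary field. Then $L_K(\Gamma_{G,\mathfrak{r}})$ has a nonzero finite dimensional representation if and only if one of the following conditions holds: (1) $\mathfrak{r}=0$; (2) $\sum_{C\in\mathcal{C}}\mathfrak{r}_C|C|=1$ and $S_{G,\mathfrak{r}}$ is a submonoid of $G$. Furthermore, if one of these conditions is satisfied, then there is an equivalence of categories $$\mathcal{M}^{fd}_{L_K(\Gamma_{G,\mathfrak{r}})}\simeq\begin{cases}(\mathcal{M}^{fd}_K)^{(G)} & \text{if } \mathfrak{r}=0,\\ (\mathcal{M}^{fd}_{K[x,x^{-1}]})^{(G/S_{G,\mathfrak{r}})} & \text{otherwise.}\end{cases}$$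
   Context: Leavitt path algebra. A (directed) graph $E=(E^0,E^1,r,s)$ consists of disjoint sets $E^0$ (vertices) and $E^1$ (edges) and maps $r,s:E^1\to E^0$ (range, source). For a field $K$, $L_K(E)$ is the (not necessarily unital) associative $K$-algebra generated by $E^0\cup E^1\cup\{e^*: e\in E^1\}$ subject to, for all $v,w\in E^0$ and $e,f\in E^1$: (i) $vw=\delta_{v,w}w$; (ii) $s(e)e=e=e\,r(e)$ and $r(e)e^*=e^*=e^*s(e)$; (iii) $e^*f=\delta_{e,f}r(e)$; (iv) $v=\sum_{e\in s^{-1}(v)}ee^*$ for every vertex $v$ with $0<|s^{-1}(v)|<\infty$. Hopf graphs. Let $G$ be a group and $\mathcal{C}$ its set of conjugacy classes. A ramification data of $G$ is a function $\mathfrak{r}:\mathcal{C}\to\mathbb{N}=\{0,1,2,\dots\}$, written $\mathfrak{r}=\sum_{C\in\mathcal{C}}\mathfrak{r}_C C$ with $\mathfrak{r}_C=\mathfrak{r}(C)$; $\mathrm{supp}(\mathfrak{r})=\{C:\mathfrak{r}_C>0\}$. It has finite support if $\bigcup_{C\in\mathrm{supp}(\mathfrak{r})}C$ is a finite set. The Hopf graph $\Gamma_{G,\mathfrak{r}}$ has vertex set $G$ and, for each $x\in G$, $C\in\mathcal{C}$ and $c\in C$, exactly $\mathfrak{r}_C$ edges from $x$ to $xc$. $S_{G,\mathfrak{r}}$ is the subsemigroup of $G$ generated by $\bigcup_{C\in\mathrm{supp}(\mathfrak{r})}C$ (empty if $\mathfrak{r}=0$); it is a submonoid of $G$ if it contains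 $1_G$. When condition (2) holds, $S_{G,\mathfrak{r}}$ is a finite normal subgroup of $G$. Modules. A representation of a $K$-algebra $A$ is a (right) $A$-module $M$ that is a $K$-vector space compatibly, and modules are unital in the sense $MA=M$. $\mathcal{M}^{fd}_A$ is the category of finite dimensional (over $K$) $A$-modules. For a category $\mathcal{N}$ and a set $X$, $\mathcal{N}^{(X)}$ is the $X$-indexed direct sum of copies of $\mathcal{N}$ (objects are $X$-indexed families of objects of $\mathcal{N}$ with all but finitely many components zero). *)

theory Defs
  imports "HOL-Algebra.Group_Action" "HOL-Algebra.Generated_Groups" "HOL-Algebra.QuotRing"
    "HOL-Algebra.Module" "Graph_Theory.Digraph"
begin

section \<open>Non-unital algebras and their right modules\<close>

text \<open>
  Algebras and vector spaces over a field are carried by the record type of \<^locale>\<open>module\<close>.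
  In a non-unital algebra the field \<^const>\<open>one\<close>, and in a vector space the fields \<^const>\<open>one\<close>
  and \<^const>\<open>mult\<close>, have no meaning.
\<close>

locale nonunital_algebra = Module.module K A for K (structure) and A (structure) +
  assumes mult_closed: "\<lbrakk>a \<in> carrier A; b \<in> carrier A\<rbrakk> \<Longrightarrow> a \<otimes>\<^bsub>A\<^esub> b \<in> carrier A"
    and mult_assoc: "\<lbrakk>a \<in> carrier A; b \<in> carrier A; c \<in> carrier A\<rbrakk>
      \<Longrightarrow> (a \<otimes>\<^bsub>A\<^esub> b) \<otimes>\<^bsub>A\<^esub> c = a \<otimes>\<^bsub>A\<^esub> (b \<otimes>\<^bsub>A\<^esub> c)"
    and mult_add_left: "\<lbrakk>a \<in> carrier A; b \<in> carrier A; c \<in> carrier A\<rbrakk>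
      \<Longrightarrow> (a \<oplus>\<^bsub>A\<^esub> b) \<otimes>\<^bsub>A\<^esub> c = a \<otimes>\<^bsub>A\<^esub> c \<oplus>\<^bsub>A\<^esub> b \<otimes>\<^bsub>A\<^esub> c"
    and mult_add_right: "\<lbrakk>a \<in> carrier A; b \<in> carrier A; c \<in> carrier A\<rbrakk>
      \<Longrightarrow> a \<otimes>\<^bsub>A\<^esub> (b \<oplus>\<^bsub>A\<^esub> c) = a \<otimes>\<^bsub>A\<^esub> b \<oplus>\<^bsub>A\<^esub> a \<otimes>\<^bsub>A\<^esub> c"
    and mult_smult_left: "\<lbrakk>k \<in> carrier K; a \<in> carrier A; b \<in> carrier A\<rbrakk>
      \<Longrightarrow> (k \<odot>\<^bsub>A\<^esub> a) \<otimes>\<^bsub>A\<^esub> b = k \<odot>\<^bsub>A\<^esub> (a \<otimes>\<^bsub>A\<^esub> b)"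
    and mult_smult_right: "\<lbrakk>k \<in> carrier K; a \<in> carrier A; b \<in> carrier A\<rbrakk>
      \<Longrightarrow> a \<otimes>\<^bsub>A\<^esub> (k \<odot>\<^bsub>A\<^esub> b) = k \<odot>\<^bsub>A\<^esub> (a \<otimes>\<^bsub>A\<^esub> b)"

record ('k, 'a, 'm) rmodule = "('k, 'm) module" +
  act :: "'m \<Rightarrow> 'a \<Rightarrow> 'm"

locale right_module =
  alg: nonunital_algebra K A + vs: Module.module K M
  for K :: "('k, 'x) ring_scheme" (structure) and A :: "('k, 'a, 'y) module_scheme" (structure)
    and M :: "('k, 'a, 'm, 'z) rmodule_scheme" (structure) +
  assumes act_closed: "\<lbrakk>m \<in> carrier M; a \<in> carrier A\<rbrakk> \<Longrightarrow> act M m a \<in> carrier M"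
    and act_add_left: "\<lbrakk>m \<in> carrier M; n \<in> carrier M; a \<in> carrier A\<rbrakk>
      \<Longrightarrow> act M (m \<oplus>\<^bsub>M\<^esub> n) a = act M m a \<oplus>\<^bsub>M\<^esub> act M n a"
    and act_add_right: "\<lbrakk>m \<in> carrier M; a \<in> carrier A; b \<in> carrier A\<rbrakk>
      \<Longrightarrow> act M m (a \<oplus>\<^bsub>A\<^esub> b) = act M m a \<oplus>\<^bsub>M\<^esub> act M m b"
    and act_mult: "\<lbrakk>m \<in> carrier M; a \<in> carrier A; b \<in> carrier A\<rbrakk>
      \<Longrightarrow> act M m (a \<otimes>\<^bsub>A\<^esub> b) = act M (act M m a) b"
    and act_smult_left: "\<lbrakk>k \<in> carrier K; m \<in> carrier M; a \<in> carrier A\<rbrakk>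
      \<Longrightarrow> act M (k \<odot>\<^bsub>M\<^esub> m) a = k \<odot>\<^bsub>M\<^esub> act M m a"
    and act_smult_right: "\<lbrakk>k \<in> carrier K; m \<in> carrier M; a \<in> carrier A\<rbrakk>
      \<Longrightarrow> act M m (k \<odot>\<^bsub>A\<^esub> a) = k \<odot>\<^bsub>M\<^esub> act M m a"

definition unital_module :: "('k, 'x) ring_scheme \<Rightarrow> ('k, 'a) module \<Rightarrow> ('k, 'a, 'm) rmodule \<Rightarrow> bool"
  where \<comment> \<open>\<open>M A = M\<close>: every element is a finite sum of elements \<open>m a\<close>\<close>
  "unital_module K A M \<longleftrightarrow> right_module K A M \<and>
     generate (add_monoid M) {act M m a | m a. m \<in> carrier M \<and> a \<in> carrier A} = carrier M"

definition finite_dim :: "('k, 'x) ring_scheme \<Rightarrow> ('k, 'm, 'y) module_scheme \<Rightarrow> bool" where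
  "finite_dim K M \<longleftrightarrow> (\<exists>B. finite B \<and> B \<subseteq> carrier M \<and>
     (\<forall>m\<in>carrier M. \<exists>c\<in>B \<rightarrow> carrier K. m = finsum M (\<lambda>b. c b \<odot>\<^bsub>M\<^esub> b) B))"

definition module_homs :: "('k, 'x) ring_scheme \<Rightarrow> ('k, 'a) module
    \<Rightarrow> ('k, 'a, 'm) rmodule \<Rightarrow> ('k, 'a, 'm) rmodule \<Rightarrow> ('m \<Rightarrow> 'm) set" where
  "module_homs K A M N = {f \<in> carrier M \<rightarrow>\<^sub>E carrier N.
     (\<forall>m\<in>carrier M. \<forall>n\<in>carrier M. f (m \<oplus>\<^bsub>M\<^esub> n) = f m \<oplus>\<^bsub>N\<^esub> f n) \<and>
     (\<forall>k\<in>carrier K. \<forall>m\<in>carrier M. f (k \<odot>\<^bsub>M\<^esub> m) = k \<odot>\<^bsub>N\<^esub> f m) \<and>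
     (\<forall>m\<in>carrier M. \<forall>a\<in>carrier A. f (act M m a) = act N (f m) a)}"


section \<open>Categories\<close>

text \<open>
  \<open>Cmp C X Y Z g f\<close> is the composite of \<open>f : X \<rightarrow> Y\<close> and \<open>g : Y \<rightarrow> Z\<close>.  A morphism does not
  determine its source and target, so these are passed explicitly to composition and to functors.
\<close>

record ('o, 'm) cat =
  Obj :: "'o set"
  Hom :: "'o \<Rightarrow> 'o \<Rightarrow> 'm set"
  Idn :: "'o \<Rightarrow> 'm"
  Cmp :: "'o \<Rightarrow> 'o \<Rightarrow> 'o \<Rightarrow> 'm \<Rightarrow> 'm \<Rightarrow> 'm"

locale category =
  fixes C :: "('o, 'm) cat"
  assumes Idn_in_Hom: "X \<in> Obj C \<Longrightarrow> Idn C X \<in> Hom C X X"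
    and Cmp_in_Hom: "\<lbrakk>X \<in> Obj C; Y \<in> Obj C; Z \<in> Obj C; f \<in> Hom C X Y; g \<in> Hom C Y Z\<rbrakk>
      \<Longrightarrow> Cmp C X Y Z g f \<in> Hom C X Z"
    and Cmp_Idn_right: "\<lbrakk>X \<in> Obj C; Y \<in> Obj C; f \<in> Hom C X Y\<rbrakk> \<Longrightarrow> Cmp C X X Y f (Idn C X) = f"
    and Cmp_Idn_left: "\<lbrakk>X \<in> Obj C; Y \<in> Obj C; f \<in> Hom C X Y\<rbrakk> \<Longrightarrow> Cmp C X Y Y (Idn C Y) f = f"
    and Cmp_assoc: "\<lbrakk>W \<in> Obj C; X \<in> Obj C; Y \<in> Obj C; Z \<in> Obj C;
        f \<in> Hom C W X; g \<in> Hom C X Y; h \<in> Hom C Y Z\<rbrakk>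
      \<Longrightarrow> Cmp C W Y Z h (Cmp C W X Y g f) = Cmp C W X Z (Cmp C X Y Z h g) f"

locale cat_functor = src: category C + tgt: category D
  for C :: "('o, 'm) cat" and D :: "('p, 'n) cat"
    and Fo :: "'o \<Rightarrow> 'p" and Fm :: "'o \<Rightarrow> 'o \<Rightarrow> 'm \<Rightarrow> 'n" +
  assumes Fo_in_Obj: "X \<in> Obj C \<Longrightarrow> Fo X \<in> Obj D"
    and Fm_in_Hom: "\<lbrakk>X \<in> Obj C; Y \<in> Obj C; f \<in> Hom C X Y\<rbrakk> \<Longrightarrow> Fm X Y f \<in> Hom D (Fo X) (Fo Y)"
    and Fm_Idn: "X \<in> Obj C \<Longrightarrow> Fm X X (Idn C X) = Idn D (Fo X)"
    and Fm_Cmp: "\<lbrakk>X \<in> Obj C; Y \<in> Obj C; Z \<in> Obj C; f \<in> Hom C X Y; g \<in> Hom C Y Z\<rbrakk>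
      \<Longrightarrow> Fm X Z (Cmp C X Y Z g f) = Cmp D (Fo X) (Fo Y) (Fo Z) (Fm Y Z g) (Fm X Y f)"

definition iso_morphism :: "('o, 'm) cat \<Rightarrow> 'o \<Rightarrow> 'o \<Rightarrow> 'm \<Rightarrow> bool" where
  "iso_morphism C X Y f \<longleftrightarrow> f \<in> Hom C X Y \<and>
     (\<exists>g\<in>Hom C Y X. Cmp C X Y X g f = Idn C X \<and> Cmp C Y X Y f g = Idn C Y)"

definition natural_iso :: "('o, 'm) cat \<Rightarrow> ('p, 'n) cat
    \<Rightarrow> ('o \<Rightarrow> 'p) \<Rightarrow> ('o \<Rightarrow> 'o \<Rightarrow> 'm \<Rightarrow> 'n)
    \<Rightarrow> ('o \<Rightarrow> 'p) \<Rightarrow> ('o \<Rightarrow> 'o \<Rightarrow> 'm \<Rightarrow> 'n) \<Rightarrow> ('o \<Rightarrow> 'n) \<Rightarrow> bool" where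
  "natural_iso C D Fo Fm Go Gm \<eta> \<longleftrightarrow>
     (\<forall>X\<in>Obj C. iso_morphism D (Fo X) (Go X) (\<eta> X)) \<and>
     (\<forall>X\<in>Obj C. \<forall>Y\<in>Obj C. \<forall>f\<in>Hom C X Y.
        Cmp D (Fo X) (Fo Y) (Go Y) (\<eta> Y) (Fm X Y f) = Cmp D (Fo X) (Go X) (Go Y) (Gm X Y f) (\<eta> X))"

definition equivalent_cats :: "('o, 'm) cat \<Rightarrow> ('p, 'n) cat \<Rightarrow> bool" where
  "equivalent_cats C D \<longleftrightarrow> (\<exists>Fo Fm Go Gm \<eta> \<epsilon>.
     cat_functor C D Fo Fm \<and> cat_functor D C Go Gm \<and>
     natural_iso C C (\<lambda>X. X) (\<lambda>X Y f. f) (\<lambda>X. Go (Fo X)) (\<lambda>X Y f. Gm (Fo X) (Fo Y) (Fm X Y f)) \<eta> \<and>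
     natural_iso D D (\<lambda>X. Fo (Go X)) (\<lambda>X Y f. Fm (Go X) (Go Y) (Gm X Y f)) (\<lambda>X. X) (\<lambda>X Y f. f) \<epsilon>)"

definition zero_object :: "('o, 'm) cat \<Rightarrow> 'o \<Rightarrow> bool" where
  "zero_object C Z \<longleftrightarrow> Z \<in> Obj C \<and>
     (\<forall>X\<in>Obj C. (\<exists>!f. f \<in> Hom C X Z) \<and> (\<exists>!f. f \<in> Hom C Z X))"

definition direct_sum_cat :: "('o, 'm) cat \<Rightarrow> 'i set \<Rightarrow> ('i \<Rightarrow> 'o, 'i \<Rightarrow> 'm) cat" where
  "direct_sum_cat C I = \<lparr>
     Obj = {F \<in> I \<rightarrow>\<^sub>E Obj C. finite {i \<in> I. \<not> zero_object C (F i)}},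
     Hom = (\<lambda>F G. \<Pi>\<^sub>E i\<in>I. Hom C (F i) (G i)),
     Idn = (\<lambda>F. \<lambda>i\<in>I. Idn C (F i)),
     Cmp = (\<lambda>F G H g f. \<lambda>i\<in>I. Cmp C (F i) (G i) (H i) (g i) (f i))\<rparr>"

text \<open>
  The category of finite dimensional right \<open>A\<close>-modules whose underlying set is contained in the
  type \<open>'u\<close>, which plays the role of the universe of sets.
\<close>

definition fd_modules :: "('k, 'x) ring_scheme \<Rightarrow> ('k, 'a) module
    \<Rightarrow> (('k, 'a, 'u) rmodule, 'u \<Rightarrow> 'u) cat" where
  "fd_modules K A = \<lparr>
     Obj = {M. unital_module K A M \<and> finite_dim K M},
     Hom = module_homs K A,
     Idn = (\<lambda>M. \<lambda>m\<in>carrier M. m),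
     Cmp = (\<lambda>L M N g f. compose (carrier L) g f)\<rparr>"


section \<open>Leavitt path algebras\<close>

text \<open>
  The free non-unital algebra on \<open>X\<close>: finitely supported functions on non-empty words over \<open>X\<close>.
\<close>

definition free_algebra :: "('k, 'x) ring_scheme \<Rightarrow> 'b set \<Rightarrow> ('k, 'b list \<Rightarrow> 'k) module" where
  "free_algebra K X = \<lparr>
     carrier = {f. (\<forall>w. f w \<in> carrier K) \<and> finite {w. f w \<noteq> \<zero>\<^bsub>K\<^esub>} \<and>
                   (\<forall>w. f w \<noteq> \<zero>\<^bsub>K\<^esub> \<longrightarrow> w \<noteq> [] \<and> set w \<subseteq> X)},
     mult = (\<lambda>f g w. finsum K (\<lambda>i. f (take i w) \<otimes>\<^bsub>K\<^esub> g (drop i w)) {..length w}),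
     one = undefined,
     zero = (\<lambda>w. \<zero>\<^bsub>K\<^esub>),
     add = (\<lambda>f g w. f w \<oplus>\<^bsub>K\<^esub> g w),
     smult = (\<lambda>k f w. k \<otimes>\<^bsub>K\<^esub> f w)\<rparr>"

definition word_elem :: "('k, 'x) ring_scheme \<Rightarrow> 'b list \<Rightarrow> 'b list \<Rightarrow> 'k" where
  "word_elem K w = (\<lambda>u. if u = w then \<one>\<^bsub>K\<^esub> else \<zero>\<^bsub>K\<^esub>)"

definition algebra_ideal :: "('k, 'x) ring_scheme \<Rightarrow> ('k, 'a) module \<Rightarrow> 'a set \<Rightarrow> bool" where
  "algebra_ideal K A I \<longleftrightarrow> subgroup I (add_monoid A) \<and>
     (\<forall>k\<in>carrier K. \<forall>x\<in>I. k \<odot>\<^bsub>A\<^esub> x \<in> I) \<and>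
     (\<forall>a\<in>carrier A. \<forall>x\<in>I. a \<otimes>\<^bsub>A\<^esub> x \<in> I \<and> x \<otimes>\<^bsub>A\<^esub> a \<in> I)"

definition ideal_generated :: "('k, 'x) ring_scheme \<Rightarrow> ('k, 'a) module \<Rightarrow> 'a set \<Rightarrow> 'a set" where
  "ideal_generated K A R = \<Inter>{I. algebra_ideal K A I \<and> R \<subseteq> I}"

definition quotient_algebra :: "('k, 'a) module \<Rightarrow> 'a set \<Rightarrow> ('k, 'a set) module" where
  "quotient_algebra A I = \<lparr>
     carrier = carrier (A Quot I), mult = mult (A Quot I), one = undefined,
     zero = zero (A Quot I), add = add (A Quot I),
     smult = (\<lambda>k S. \<Union>a\<in>S. I +>\<^bsub>A\<^esub> (k \<odot>\<^bsub>A\<^esub> a))\<rparr>"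

text \<open>
  In a graph \<^const>\<open>tail\<close> is the source map and \<^const>\<open>head\<close> the range map; \<open>Ghost e\<close> is the
  generator \<open>e\<^sup>*\<close>.
\<close>

datatype ('v, 'e) lpa_gen = Vertex 'v | Edge 'e | Ghost 'e

definition lpa_gens :: "('v, 'e) pre_digraph \<Rightarrow> ('v, 'e) lpa_gen set" where
  "lpa_gens E = Vertex ` verts E \<union> Edge ` arcs E \<union> Ghost ` arcs E"

definition lpa_free :: "('k, 'x) ring_scheme \<Rightarrow> ('v, 'e) pre_digraph
    \<Rightarrow> ('k, ('v, 'e) lpa_gen list \<Rightarrow> 'k) module" where
  "lpa_free K E = free_algebra K (lpa_gens E)"

inductive_set lpa_relations :: "('k, 'x) ring_scheme \<Rightarrow> ('v, 'e) pre_digraph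
    \<Rightarrow> (('v, 'e) lpa_gen list \<Rightarrow> 'k) set" for K E where
  vertices: "\<lbrakk>v \<in> verts E; w \<in> verts E\<rbrakk> \<Longrightarrow>
    word_elem K [Vertex v, Vertex w] \<ominus>\<^bsub>lpa_free K E\<^esub>
      (if v = w then word_elem K [Vertex w] else \<zero>\<^bsub>lpa_free K E\<^esub>) \<in> lpa_relations K E"
| source: "e \<in> arcs E \<Longrightarrow>
    word_elem K [Vertex (tail E e), Edge e] \<ominus>\<^bsub>lpa_free K E\<^esub> word_elem K [Edge e] \<in> lpa_relations K E"
| range: "e \<in> arcs E \<Longrightarrow>
    word_elem K [Edge e, Vertex (head E e)] \<ominus>\<^bsub>lpa_free K E\<^esub> word_elem K [Edge e] \<in> lpa_relations K E"
| ghost_source: "e \<in> arcs E \<Longrightarrow>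
    word_elem K [Vertex (head E e), Ghost e] \<ominus>\<^bsub>lpa_free K E\<^esub> word_elem K [Ghost e] \<in> lpa_relations K E"
| ghost_range: "e \<in> arcs E \<Longrightarrow>
    word_elem K [Ghost e, Vertex (tail E e)] \<ominus>\<^bsub>lpa_free K E\<^esub> word_elem K [Ghost e] \<in> lpa_relations K E"
| CK1: "\<lbrakk>e \<in> arcs E; f \<in> arcs E\<rbrakk> \<Longrightarrow>
    word_elem K [Ghost e, Edge f] \<ominus>\<^bsub>lpa_free K E\<^esub>
      (if e = f then word_elem K [Vertex (head E e)] else \<zero>\<^bsub>lpa_free K E\<^esub>) \<in> lpa_relations K E"
| CK2: "\<lbrakk>v \<in> verts E; out_arcs E v \<noteq> {}; finite (out_arcs E v)\<rbrakk> \<Longrightarrow>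
    word_elem K [Vertex v] \<ominus>\<^bsub>lpa_free K E\<^esub>
      finsum (lpa_free K E) (\<lambda>e. word_elem K [Edge e, Ghost e]) (out_arcs E v) \<in> lpa_relations K E"

definition leavitt_path_algebra :: "('k, 'x) ring_scheme \<Rightarrow> ('v, 'e) pre_digraph
    \<Rightarrow> ('k, (('v, 'e) lpa_gen list \<Rightarrow> 'k) set) module" where
  "leavitt_path_algebra K E = quotient_algebra (lpa_free K E)
     (ideal_generated K (lpa_free K E) (lpa_relations K E))"


section \<open>The algebras \<open>K\<close> and \<open>K[x, x\<inverse>]\<close>\<close>

definition field_algebra :: "('k, 'x) ring_scheme \<Rightarrow> ('k, 'k) module" where
  "field_algebra K = \<lparr>carrier = carrier K, mult = mult K, one = one K, zero = zero K, add = add K,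
     smult = mult K\<rparr>"

text \<open>\<open>f n\<close> is the coefficient of \<open>x\<^sup>n\<close> in the Laurent polynomial \<open>f\<close>.\<close>

definition laurent_algebra :: "('k, 'x) ring_scheme \<Rightarrow> ('k, int \<Rightarrow> 'k) module" where
  "laurent_algebra K = \<lparr>
     carrier = {f. (\<forall>n. f n \<in> carrier K) \<and> finite {n. f n \<noteq> \<zero>\<^bsub>K\<^esub>}},
     mult = (\<lambda>f g n. finsum K (\<lambda>i. f i \<otimes>\<^bsub>K\<^esub> g (n - i)) {i. f i \<noteq> \<zero>\<^bsub>K\<^esub>}),
     one = (\<lambda>n. if n = 0 then \<one>\<^bsub>K\<^esub> else \<zero>\<^bsub>K\<^esub>),
     zero = (\<lambda>n. \<zero>\<^bsub>K\<^esub>),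
     add = (\<lambda>f g n. f n \<oplus>\<^bsub>K\<^esub> g n),
     smult = (\<lambda>k f n. k \<otimes>\<^bsub>K\<^esub> f n)\<rparr>"


section \<open>Hopf graphs\<close>

definition conj_classes :: "('g, 'x) monoid_scheme \<Rightarrow> 'g set set" where
  "conj_classes G = orbits G (carrier G) (\<lambda>g. \<lambda>h\<in>carrier G. g \<otimes>\<^bsub>G\<^esub> h \<otimes>\<^bsub>G\<^esub> inv\<^bsub>G\<^esub> g)"

text \<open>
  A ramification data is a function \<open>\<rr> :: 'g set \<Rightarrow> nat\<close>, of which only the values on
  conjugacy classes are used.
\<close>

definition ram_supp :: "('g, 'x) monoid_scheme \<Rightarrow> ('g set \<Rightarrow> nat) \<Rightarrow> 'g set set" where
  "ram_supp G \<rr> = {C \<in> conj_classes G. \<rr> C > 0}"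

definition ram_zero :: "('g, 'x) monoid_scheme \<Rightarrow> ('g set \<Rightarrow> nat) \<Rightarrow> bool" where
  "ram_zero G \<rr> \<longleftrightarrow> (\<forall>C\<in>conj_classes G. \<rr> C = 0)"

definition finite_support :: "('g, 'x) monoid_scheme \<Rightarrow> ('g set \<Rightarrow> nat) \<Rightarrow> bool" where
  "finite_support G \<rr> \<longleftrightarrow> finite (\<Union>(ram_supp G \<rr>))"

text \<open>
  The edge \<open>(x, C, c, i)\<close> is the \<open>i\<close>-th of the \<open>\<rr> C\<close> edges from \<open>x\<close> to \<open>x c\<close> given by \<open>c \<in> C\<close>.
\<close>

definition hopf_graph :: "('g, 'x) monoid_scheme \<Rightarrow> ('g set \<Rightarrow> nat)
    \<Rightarrow> ('g, 'g \<times> 'g set \<times> 'g \<times> nat) pre_digraph" where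
  "hopf_graph G \<rr> = \<lparr>
     verts = carrier G,
     arcs = {(x, C, c, i). x \<in> carrier G \<and> C \<in> conj_classes G \<and> c \<in> C \<and> i < \<rr> C},
     tail = (\<lambda>(x, C, c, i). x),
     head = (\<lambda>(x, C, c, i). x \<otimes>\<^bsub>G\<^esub> c)\<rparr>"

inductive_set ram_semigroup :: "('g, 'x) monoid_scheme \<Rightarrow> ('g set \<Rightarrow> nat) \<Rightarrow> 'g set" for G \<rr> where
  gen: "c \<in> \<Union>(ram_supp G \<rr>) \<Longrightarrow> c \<in> ram_semigroup G \<rr>"
| mult: "\<lbrakk>a \<in> ram_semigroup G \<rr>; b \<in> ram_semigroup G \<rr>\<rbrakk> \<Longrightarrow> a \<otimes>\<^bsub>G\<^esub> b \<in> ram_semigroup G \<rr>"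

text \<open>
  The sum over all classes is taken over the support, since \<^const>\<open>sum\<close> over an infinite index set
  is \<open>0\<close> by convention.
\<close>

definition ram_degree :: "('g, 'x) monoid_scheme \<Rightarrow> ('g set \<Rightarrow> nat) \<Rightarrow> nat" where
  "ram_degree G \<rr> = (\<Sum>C\<in>ram_supp G \<rr>. \<rr> C * card C)"

end

(*
  Only if.  Label the edges leaving x by pairs j = (c, i), so that edge (x, j) ends at x c.  On a finite
  dimensional module M only finitely many vertices x have M x nonzero, and this finite set S of vertices
  satisfies S c^-1 <= S, because m |-> m e* embeds M (x c) into M x.  Hence S c = S, and the operators
  T_j = sum_{x in S} (x, j) and U_j = sum_{x in S} (x, j)^* on M satisfy U_j T_k = delta_{jk} (acting on
  the right).  If j <> k, then U_j is injective, so surjective, so T_k = 0 and M = 0.  With exactly one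
  label c, S c = S forces c to have finite order.

  If.  In both cases the Leavitt path algebra is a direct sum, indexed by a set I of components, of full
  matrix algebras over B = K or B = K[x, 1/x]; the equivalence sends M to the family of its corners M v_i
  at one chosen vertex v_i of each component.  It is essentially surjective because a family of
  B-modules N_i spreads out to the representation with N_i at every vertex of component i, where every
  edge acts as the identity except for one edge of each cycle, which acts as x.
*)
theory Submission
  imports Defs "HOL-Algebra.Multiplicative_Group" "Jordan_Normal_Form.Missing_VectorSpace"
begin

section \<open>Linear maps\<close>

text \<open>What is used of the matrix decomposition is a spanning property: the algebra is
  additively spanned by the products \<open>W v\<close>, \<open>\<theta> b\<close>,
  \<open>U w\<close>, which lead from v to the chosen vertex, around there, and on to w. It makes
  the corner functor full; the role of linear independence is taken over by the representations
  built for essential surjectivity, which also yield the nonzero module. Two obstacles shape the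
  proof. G may be infinite, so local units and finite supports stand in for a unit. And objects must
  live on the type 'u, while a representation spread over the vertices lives on functions into 'u;
  finite dimension lets coordinate lists over K encode it. On a cycle no edge is singled out in
  advance: vertices get positions \<open>idx\<close>, chosen arbitrarily apart from the chosen
  vertex, and each edge acts as the power of x given by its \<open>winding\<close>. The total over
  one turn is 1, which is all that matters. In condition (2), a single label means that c is alone
  in its class, hence central, so that the right cosets of S are the orbits of right multiplication
  by c, which are the cycles.\<close>

definition linear_maps :: "('k, 'x) ring_scheme \<Rightarrow> ('k, 'm, 'y) module_scheme
    \<Rightarrow> ('k, 'n, 'z) module_scheme \<Rightarrow> ('m \<Rightarrow> 'n) set" where
  "linear_maps K M N = {f \<in> carrier M \<rightarrow> carrier N.
     (\<forall>m\<in>carrier M. \<forall>n\<in>carrier M. f (m \<oplus>\<^bsub>M\<^esub> n) = f m \<oplus>\<^bsub>N\<^esub> f n) \<and>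
     (\<forall>k\<in>carrier K. \<forall>m\<in>carrier M. f (k \<odot>\<^bsub>M\<^esub> m) = k \<odot>\<^bsub>N\<^esub> f m)}"

lemma linear_mapsI:
  assumes "\<And>m. m \<in> carrier M \<Longrightarrow> f m \<in> carrier N"
    and "\<And>m n. \<lbrakk>m \<in> carrier M; n \<in> carrier M\<rbrakk> \<Longrightarrow> f (m \<oplus>\<^bsub>M\<^esub> n) = f m \<oplus>\<^bsub>N\<^esub> f n"
    and "\<And>k m. \<lbrakk>k \<in> carrier K; m \<in> carrier M\<rbrakk> \<Longrightarrow> f (k \<odot>\<^bsub>M\<^esub> m) = k \<odot>\<^bsub>N\<^esub> f m"
  shows "f \<in> linear_maps K M N"
  using assms by (auto simp: linear_maps_def)

lemma linear_maps_closed: "\<lbrakk>f \<in> linear_maps K M N; m \<in> carrier M\<rbrakk> \<Longrightarrow> f m \<in> carrier N"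
  by (auto simp: linear_maps_def)

lemma linear_maps_add:
  "\<lbrakk>f \<in> linear_maps K M N; m \<in> carrier M; n \<in> carrier M\<rbrakk> \<Longrightarrow> f (m \<oplus>\<^bsub>M\<^esub> n) = f m \<oplus>\<^bsub>N\<^esub> f n"
  by (auto simp: linear_maps_def)

lemma linear_maps_smult:
  "\<lbrakk>f \<in> linear_maps K M N; k \<in> carrier K; m \<in> carrier M\<rbrakk> \<Longrightarrow> f (k \<odot>\<^bsub>M\<^esub> m) = k \<odot>\<^bsub>N\<^esub> f m"
  by (auto simp: linear_maps_def)

lemma linear_maps_cong:
  assumes "f \<in> linear_maps K M N" and "\<And>m. m \<in> carrier M \<Longrightarrow> f m = g m" and "Module.module K M"
  shows "g \<in> linear_maps K M N"
proof -
  interpret M: Module.module K M by fact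
  show ?thesis
    using assms(1) by (auto simp: linear_maps_def assms(2)[symmetric] Pi_def)
qed

lemma linear_maps_comp:
  "\<lbrakk>f \<in> linear_maps K M N; g \<in> linear_maps K N Q\<rbrakk> \<Longrightarrow> (\<lambda>m. g (f m)) \<in> linear_maps K M Q"
  by (auto simp: linear_maps_def Pi_def)

lemma linear_maps_zero:
  assumes "f \<in> linear_maps K M N" and "Module.module K M" and "Module.module K N"
  shows "f \<zero>\<^bsub>M\<^esub> = \<zero>\<^bsub>N\<^esub>"
proof -
  interpret M: Module.module K M by fact
  interpret N: Module.module K N by fact
  have "f (\<zero>\<^bsub>K\<^esub> \<odot>\<^bsub>M\<^esub> \<zero>\<^bsub>M\<^esub>) = \<zero>\<^bsub>K\<^esub> \<odot>\<^bsub>N\<^esub> f \<zero>\<^bsub>M\<^esub>"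
    using linear_maps_smult[OF assms(1)] by blast
  then show ?thesis
    using linear_maps_closed[OF assms(1) M.M.zero_closed] by simp
qed

text \<open>An infinite \<open>S\<close> is covered as well: both sums are then zero by the
  convention for \<open>finsum\<close>, and \<open>f\<close> preserves zero.\<close>

lemma linear_maps_finsum:
  assumes f: "f \<in> linear_maps K M N" and M: "Module.module K M" and N: "Module.module K N"
    and c: "\<And>i. i \<in> S \<Longrightarrow> c i \<in> carrier M"
  shows "f (finsum M c S) = finsum N (\<lambda>i. f (c i)) S"
proof -
  interpret M: Module.module K M by fact
  interpret N: Module.module K N by fact
  note f0 = linear_maps_zero[OF f M N]
  have "S' \<subseteq> S \<longrightarrow> f (finsum M c S') = finsum N (\<lambda>i. f (c i)) S'" if "finite S'" for S'
    using that
  proof (induction S' rule: finite_induct)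
    case (insert x F)
    have "f (finsum M c (insert x F)) = f (c x \<oplus>\<^bsub>M\<^esub> finsum M c F)" if "insert x F \<subseteq> S"
      using insert c that by (subst M.finsum_insert) auto
    moreover have "finsum N (\<lambda>i. f (c i)) (insert x F) = f (c x) \<oplus>\<^bsub>N\<^esub> finsum N (\<lambda>i. f (c i)) F"
      if "insert x F \<subseteq> S"
      using insert c that linear_maps_closed[OF f] by (subst N.finsum_insert) auto
    moreover have "finsum M c F \<in> carrier M" if "insert x F \<subseteq> S"
      using c that by (auto intro!: M.finsum_closed)
    ultimately show ?case
      using insert.IH c linear_maps_add[OF f] by auto
  qed (simp add: f0)
  then show ?thesis
    by (cases "finite S") (auto simp: M.finsum_infinite N.finsum_infinite f0)
qed

lemma linear_maps_finsum_map:
  assumes N: "Module.module K N" and h: "\<And>i. i \<in> S \<Longrightarrow> h i \<in> linear_maps K M N"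
  shows "(\<lambda>m. finsum N (\<lambda>i. h i m) S) \<in> linear_maps K M N"
proof (rule linear_mapsI)
  interpret N: Module.module K N by fact
  fix m assume m: "m \<in> carrier M"
  then show "finsum N (\<lambda>i. h i m) S \<in> carrier N"
    using linear_maps_closed[OF h] by (auto intro!: N.finsum_closed)
  fix n assume n: "n \<in> carrier M"
  have "finsum N (\<lambda>i. h i (m \<oplus>\<^bsub>M\<^esub> n)) S = finsum N (\<lambda>i. h i m \<oplus>\<^bsub>N\<^esub> h i n) S"
    using m n linear_maps_closed[OF h] linear_maps_add[OF h] by (intro N.finsum_cong') auto
  also have "\<dots> = finsum N (\<lambda>i. h i m) S \<oplus>\<^bsub>N\<^esub> finsum N (\<lambda>i. h i n) S"
    using m n linear_maps_closed[OF h] by (intro N.finsum_addf) auto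
  finally show "finsum N (\<lambda>i. h i (m \<oplus>\<^bsub>M\<^esub> n)) S = finsum N (\<lambda>i. h i m) S \<oplus>\<^bsub>N\<^esub> finsum N (\<lambda>i. h i n) S" .
next
  interpret N: Module.module K N by fact
  fix k m assume k: "k \<in> carrier K" and m: "m \<in> carrier M"
  have "(\<lambda>x. k \<odot>\<^bsub>N\<^esub> x) \<in> linear_maps K N N"
    using k by (auto intro!: linear_mapsI simp: N.smult_r_distr N.smult_assoc1[symmetric] N.R.m_comm)
  then have "k \<odot>\<^bsub>N\<^esub> finsum N (\<lambda>i. h i m) S = finsum N (\<lambda>i. k \<odot>\<^bsub>N\<^esub> h i m) S"
    using linear_maps_closed[OF h] m by (intro linear_maps_finsum[OF _ N N]) auto
  also have "\<dots> = finsum N (\<lambda>i. h i (k \<odot>\<^bsub>M\<^esub> m)) S"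
    using m k linear_maps_closed[OF h] linear_maps_smult[OF h] by (intro N.finsum_cong') auto
  finally show "finsum N (\<lambda>i. h i (k \<odot>\<^bsub>M\<^esub> m)) S = k \<odot>\<^bsub>N\<^esub> finsum N (\<lambda>i. h i m) S" ..
qed

lemma linear_maps_zero_map:
  assumes "Module.module K N"
  shows "(\<lambda>m. \<zero>\<^bsub>N\<^esub>) \<in> linear_maps K M N"
proof -
  interpret N: Module.module K N by fact
  show ?thesis by (auto intro!: linear_mapsI)
qed

lemma linear_maps_id: "(\<lambda>m. m) \<in> linear_maps K M M"
  by (auto intro!: linear_mapsI)

text \<open>Collapses sums of Kronecker type. The case \<open>j \<notin> S\<close> is included
  because later sums run over supports, outside of which the distinguished vertex may lie.\<close>

lemma (in abelian_group) finsum_one_term: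
  assumes "finite S" and "\<And>i. \<lbrakk>i \<in> S; i \<noteq> j\<rbrakk> \<Longrightarrow> f i = \<zero>" and "x \<in> carrier G"
    and "j \<in> S \<Longrightarrow> f j = x" and "j \<notin> S \<Longrightarrow> x = \<zero>"
  shows "finsum G f S = x"
proof (cases "j \<in> S")
  case True
  have "finsum G f S = finsum G (\<lambda>i. if j = i then x else \<zero>) S"
    using assms True by (intro finsum_cong') auto
  also have "\<dots> = x"
    using finsum_singleton[of j S "\<lambda>_. x"] assms True by auto
  finally show ?thesis .
next
  case False
  then have "finsum G f S = finsum G (\<lambda>i. \<zero>) S"
    using assms by (intro finsum_cong') auto
  then show ?thesis using assms False by simp
qed

lemma (in abelian_group) finsum_mono_neutral:
  assumes "finite T" and "S \<subseteq> T" and "\<And>i. i \<in> T - S \<Longrightarrow> f i = \<zero>" and "\<And>i. i \<in> S \<Longrightarrow> f i \<in> carrier G"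
  shows "finsum G f T = finsum G f S"
proof -
  have T: "T = S \<union> (T - S)" using assms by auto
  have "finsum G f T = finsum G f S \<oplus> finsum G f (T - S)"
    by (subst T, rule finsum_Un_disjoint) (use assms finite_subset in \<open>auto simp: Pi_def\<close>)
  also have "finsum G f (T - S) = finsum G (\<lambda>_. \<zero>) (T - S)"
    by (rule finsum_cong') (use assms in auto)
  finally show ?thesis using assms by (auto simp: Pi_def)
qed

section \<open>Injective endomorphisms of finite dimensional spaces\<close>

text \<open>An injective endomorphism sends a basis to an independent set with \<open>dim\<close>
  elements. Such a set is again a basis, and its span lies in the image.\<close>

lemma finite_dim_injective_surjective:
  assumes K: "field K" and M: "Module.module K M" and fd: "finite_dim K M"
    and T: "T \<in> linear_maps K M M" and inj: "inj_on T (carrier M)"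
  shows "T ` carrier M = carrier M"
proof -
  interpret M: vectorspace K M using K M by (simp add: vectorspace_def)
  have T': "linear_map K M M T"
    using T M.vectorspace_axioms
    by (auto simp: linear_map_def mod_hom_def mod_hom_axioms_def M LinearCombinations.module_hom_def
        linear_maps_def)
  interpret T: linear_map K M M T by (rule T')
  have fin: "M.fin_dim"
  proof -
    obtain B where B: "finite B" "B \<subseteq> carrier M"
      "\<forall>m\<in>carrier M. \<exists>c\<in>B \<rightarrow> carrier K. m = finsum M (\<lambda>b. c b \<odot>\<^bsub>M\<^esub> b) B"
      using fd by (auto simp: finite_dim_def)
    have "M.span B = carrier M"
      using B M.span_is_subset2[OF B(2)] by (auto simp: M.finite_span M.lincomb_def)
    then show ?thesis using B by (auto simp: M.fin_dim_def)
  qed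
  obtain B where B: "finite B" "M.basis B" using M.finite_basis_exists fin by blast
  have BM: "B \<subseteq> carrier M" using B by (simp add: M.basis_def)
  \<comment> \<open>The image of a basis is first seen to be a basis of the image space
    \<open>?W\<close>. Independence and span do not depend on the ambient space, so both pass to
    \<open>M\<close>.\<close>
  let ?W = "M.vs (T ` carrier M)"
  have sub: "subspace K (T ` carrier M) M"
    using T.imT_is_subspace by (simp add: T.im_def)
  then have subm: "submodule K (T ` carrier M) M" by (simp add: subspace_def)
  have W: "vectorspace K ?W" by (rule M.subspace_is_vs[OF sub])
  interpret W: vectorspace K ?W by (rule W)
  have TW: "linear_map K M ?W T"
    using T M.vectorspace_axioms W M W.module_axioms
    by (auto simp: linear_map_def mod_hom_def mod_hom_axioms_def LinearCombinations.module_hom_def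
        linear_maps_def)
  interpret TW: linear_map K M ?W T by (rule TW)
  have "W.basis (T ` B)"
    using TW.linear_inj_image_is_basis[OF inj _ B(2) fin] by simp
  then have "W.lin_indpt (T ` B)" by (simp add: W.basis_def)
  then have li: "M.lin_indpt (T ` B)"
    using M.span_li_not_depend(2)[OF image_mono[OF BM] subm] by simp
  have "M.basis (T ` B)"
  proof (rule M.dim_li_is_basis)
    show "M.dim \<le> card (T ` B)"
      using M.dim_basis[OF B] card_image[of T B] inj BM by (simp add: inj_on_subset)
  qed (use fin B li BM T in \<open>auto simp: linear_maps_def Pi_def\<close>)
  then have "M.span (T ` B) = carrier M" by (simp add: M.basis_def)
  moreover have "M.span (T ` B) = W.span (T ` B)"
    using M.span_li_not_depend(1)[OF image_mono[OF BM] subm] by simp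
  moreover have "W.span (T ` B) \<subseteq> T ` carrier M"
    using W.span_is_subset2[of "T ` B"] BM by auto
  ultimately show ?thesis using T by (auto simp: linear_maps_def Pi_def)
qed

section \<open>Algebras, right modules and their images\<close>

context nonunital_algebra
begin

lemma is_module: "Module.module K A"
  by (rule module_axioms)

lemma mult_linear_left: "b \<in> carrier A \<Longrightarrow> (\<lambda>a. a \<otimes>\<^bsub>A\<^esub> b) \<in> linear_maps K A A"
  by (auto intro!: linear_mapsI simp: mult_closed mult_add_left mult_smult_left)

lemma mult_linear_right: "a \<in> carrier A \<Longrightarrow> (\<lambda>b. a \<otimes>\<^bsub>A\<^esub> b) \<in> linear_maps K A A"
  by (auto intro!: linear_mapsI simp: mult_closed mult_add_right mult_smult_right)

lemma mult_zero_left: "b \<in> carrier A \<Longrightarrow> \<zero>\<^bsub>A\<^esub> \<otimes>\<^bsub>A\<^esub> b = \<zero>\<^bsub>A\<^esub>"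
  using linear_maps_zero[OF mult_linear_left is_module is_module] by simp

lemma mult_zero_right: "a \<in> carrier A \<Longrightarrow> a \<otimes>\<^bsub>A\<^esub> \<zero>\<^bsub>A\<^esub> = \<zero>\<^bsub>A\<^esub>"
  using linear_maps_zero[OF mult_linear_right is_module is_module] by simp

end

lemma (in right_module) act_linear_left: "a \<in> carrier A \<Longrightarrow> (\<lambda>m. act M m a) \<in> linear_maps K M M"
  by (auto intro!: linear_mapsI simp: act_closed act_add_left act_smult_left)

lemma (in right_module) act_linear_right: "m \<in> carrier M \<Longrightarrow> act M m \<in> linear_maps K A M"
  by (auto intro!: linear_mapsI simp: act_closed act_add_right act_smult_right)

lemma (in right_module) modules: "Module.module K A" "Module.module K M"
  by (rule alg.is_module vs.module_axioms)+

lemma (in right_module) act_zero_left: "a \<in> carrier A \<Longrightarrow> act M \<zero>\<^bsub>M\<^esub> a = \<zero>\<^bsub>M\<^esub>"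
  using linear_maps_zero[OF act_linear_left modules(2,2)] by simp

lemma (in right_module) act_zero_right: "m \<in> carrier M \<Longrightarrow> act M m \<zero>\<^bsub>A\<^esub> = \<zero>\<^bsub>M\<^esub>"
  using linear_maps_zero[OF act_linear_right modules] by simp

lemma (in right_module) act_finsum_left:
  "\<lbrakk>a \<in> carrier A; \<And>i. i \<in> S \<Longrightarrow> c i \<in> carrier M\<rbrakk>
    \<Longrightarrow> act M (finsum M c S) a = finsum M (\<lambda>i. act M (c i) a) S"
  by (rule linear_maps_finsum[OF act_linear_left modules(2,2)])

lemma (in right_module) act_finsum_right:
  "\<lbrakk>m \<in> carrier M; \<And>i. i \<in> S \<Longrightarrow> c i \<in> carrier A\<rbrakk>
    \<Longrightarrow> act M m (finsum A c S) = finsum M (\<lambda>i. act M m (c i)) S"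
  by (rule linear_maps_finsum[OF act_linear_right modules])

text \<open>Each axiom in \<open>N\<close> is the image under \<open>h\<close> of the same axiom in
  \<open>M\<close>. The map \<open>h\<close> will be the quotient map, the action of an idempotent,
  a bijection between carriers, and the constant zero.\<close>

lemma module_surjective_image:
  assumes M: "Module.module K M" and N: "carrier N = h ` carrier M"
    and z: "\<zero>\<^bsub>N\<^esub> = h \<zero>\<^bsub>M\<^esub>"
    and add: "\<And>m n. \<lbrakk>m \<in> carrier M; n \<in> carrier M\<rbrakk> \<Longrightarrow> h m \<oplus>\<^bsub>N\<^esub> h n = h (m \<oplus>\<^bsub>M\<^esub> n)"
    and smult: "\<And>k m. \<lbrakk>k \<in> carrier K; m \<in> carrier M\<rbrakk> \<Longrightarrow> k \<odot>\<^bsub>N\<^esub> h m = h (k \<odot>\<^bsub>M\<^esub> m)"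
  shows "Module.module K N"
proof -
  interpret M: Module.module K M by fact
  have "abelian_group N"
  proof (rule abelian_groupI)
    fix x assume "x \<in> carrier N"
    then obtain m where m: "m \<in> carrier M" "x = h m" using N by auto
    then have "h (\<ominus>\<^bsub>M\<^esub> m) \<oplus>\<^bsub>N\<^esub> x = \<zero>\<^bsub>N\<^esub>"
      using add[of "\<ominus>\<^bsub>M\<^esub> m" m] z by (simp add: M.M.l_neg)
    then show "\<exists>y\<in>carrier N. y \<oplus>\<^bsub>N\<^esub> x = \<zero>\<^bsub>N\<^esub>" using m N by auto
  qed (auto simp: N z add M.M.a_assoc intro!: imageI arg_cong[of _ _ h] M.M.a_comm)
  then show ?thesis
    by (intro moduleI)
      (auto simp: N add smult M.R.is_cring M.smult_l_distr M.smult_r_distr M.smult_assoc1)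
qed

lemma algebra_surjective_image:
  assumes A: "nonunital_algebra K A" and B: "carrier B = h ` carrier A"
    and z: "\<zero>\<^bsub>B\<^esub> = h \<zero>\<^bsub>A\<^esub>"
    and add: "\<And>m n. \<lbrakk>m \<in> carrier A; n \<in> carrier A\<rbrakk> \<Longrightarrow> h m \<oplus>\<^bsub>B\<^esub> h n = h (m \<oplus>\<^bsub>A\<^esub> n)"
    and smult: "\<And>k m. \<lbrakk>k \<in> carrier K; m \<in> carrier A\<rbrakk> \<Longrightarrow> k \<odot>\<^bsub>B\<^esub> h m = h (k \<odot>\<^bsub>A\<^esub> m)"
    and mult: "\<And>m n. \<lbrakk>m \<in> carrier A; n \<in> carrier A\<rbrakk> \<Longrightarrow> h m \<otimes>\<^bsub>B\<^esub> h n = h (m \<otimes>\<^bsub>A\<^esub> n)"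
  shows "nonunital_algebra K B"
proof -
  interpret A: nonunital_algebra K A by fact
  have "Module.module K B"
    by (rule module_surjective_image[OF A.is_module B z add smult])
  then show ?thesis
    by (intro nonunital_algebra.intro nonunital_algebra_axioms.intro)
      (auto simp: B add smult mult A.mult_closed A.mult_assoc A.mult_add_left A.mult_add_right
        A.mult_smult_left A.mult_smult_right)
qed

lemma right_module_surjective_image:
  assumes M: "right_module K A M" and N: "carrier N = h ` carrier M"
    and z: "\<zero>\<^bsub>N\<^esub> = h \<zero>\<^bsub>M\<^esub>"
    and add: "\<And>m n. \<lbrakk>m \<in> carrier M; n \<in> carrier M\<rbrakk> \<Longrightarrow> h m \<oplus>\<^bsub>N\<^esub> h n = h (m \<oplus>\<^bsub>M\<^esub> n)"
    and smult: "\<And>k m. \<lbrakk>k \<in> carrier K; m \<in> carrier M\<rbrakk> \<Longrightarrow> k \<odot>\<^bsub>N\<^esub> h m = h (k \<odot>\<^bsub>M\<^esub> m)"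
    and act: "\<And>m a. \<lbrakk>m \<in> carrier M; a \<in> carrier A\<rbrakk> \<Longrightarrow> act N (h m) a = h (act M m a)"
  shows "right_module K A N"
proof -
  interpret M: right_module K A M by fact
  have "Module.module K N"
    by (rule module_surjective_image[OF M.modules(2) N z add smult])
  then show ?thesis
    by (intro right_module.intro right_module_axioms.intro M.alg.nonunital_algebra_axioms)
      (auto simp: N add smult act M.alg.mult_closed M.act_closed M.act_add_left M.act_add_right
        M.act_mult M.act_smult_left M.act_smult_right)
qed

text \<open>When the action of \<open>a\<close> depends on \<open>\<pi> a\<close> alone, the module
  axioms over \<open>B\<close> are those over \<open>A\<close> read through the surjection. The
  vector space stays the same; only the record type changes with the algebra.\<close>

lemma right_module_descend:
  assumes M: "right_module K A M" and B: "nonunital_algebra K B"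
    and \<pi>: "\<pi> \<in> linear_maps K A B" and surj: "carrier B = \<pi> ` carrier A"
    and mult: "\<And>a b. \<lbrakk>a \<in> carrier A; b \<in> carrier A\<rbrakk> \<Longrightarrow> \<pi> (a \<otimes>\<^bsub>A\<^esub> b) = \<pi> a \<otimes>\<^bsub>B\<^esub> \<pi> b"
    and N: "Module.module K N" "carrier N = carrier M" "add N = add M" "smult N = smult M"
    and act: "\<And>m a. \<lbrakk>m \<in> carrier M; a \<in> carrier A\<rbrakk> \<Longrightarrow> act N m (\<pi> a) = act M m a"
  shows "right_module K B N"
proof -
  interpret M: right_module K A M by fact
  note sym = linear_maps_add[OF \<pi>, symmetric] linear_maps_smult[OF \<pi>, symmetric] mult[symmetric]
  show ?thesis
    by (intro right_module.intro right_module_axioms.intro B N(1))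
      (auto simp: surj N(2-) act sym M.alg.mult_closed M.act_closed M.act_add_left M.act_add_right
        M.act_mult M.act_smult_left M.act_smult_right)
qed

section \<open>Quotient algebras\<close>

locale algebra_with_ideal = nonunital_algebra K A
  for K :: "('k, 'x) ring_scheme" (structure) and A :: "('k, 'a) module" (structure) +
  fixes I :: "'a set" assumes ideal: "algebra_ideal K A I"
begin

lemma abelian_subgroup: "abelian_subgroup I A"
  using ideal M.abelian_group_axioms
  by (intro abelian_subgroupI3) (auto simp: algebra_ideal_def additive_subgroup_def)

lemma coset_eq: "\<lbrakk>x \<in> I; a \<in> carrier A\<rbrakk> \<Longrightarrow> I +>\<^bsub>A\<^esub> (x \<oplus>\<^bsub>A\<^esub> a) = I +>\<^bsub>A\<^esub> a"
proof -
  assume x: "x \<in> I" and a: "a \<in> carrier A"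
  interpret abelian_subgroup I A by (rule abelian_subgroup)
  have "x \<oplus>\<^bsub>A\<^esub> a \<in> I +>\<^bsub>A\<^esub> a" using x by (auto simp: a_r_coset_def')
  then show ?thesis using a_repr_independence' a by metis
qed

lemma in_cosetE:
  assumes "y \<in> I +>\<^bsub>A\<^esub> a" obtains x where "x \<in> I" "y = x \<oplus>\<^bsub>A\<^esub> a"
  using assms by (auto simp: a_r_coset_def')

lemma ideal_subset: "x \<in> I \<Longrightarrow> x \<in> carrier A"
  using ideal subgroup.subset by (fastforce simp: algebra_ideal_def)

lemma zero_in_ideal: "\<zero>\<^bsub>A\<^esub> \<in> I"
  using ideal subgroup.one_closed[of I "add_monoid A"] by (simp add: algebra_ideal_def)

lemma add_in_ideal: "\<lbrakk>x \<in> I; y \<in> I\<rbrakk> \<Longrightarrow> x \<oplus>\<^bsub>A\<^esub> y \<in> I"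
  using ideal subgroup.m_closed[of I "add_monoid A"] by (simp add: algebra_ideal_def)

lemma self_in_coset: "a \<in> carrier A \<Longrightarrow> a \<in> I +>\<^bsub>A\<^esub> a"
  using zero_in_ideal by (force simp: a_r_coset_def')

lemma carrier_quotient: "carrier (quotient_algebra A I) = (\<lambda>a. I +>\<^bsub>A\<^esub> a) ` carrier A"
  by (auto simp: quotient_algebra_def FactRing_def A_RCOSETS_def' )

lemma zero_quotient: "\<zero>\<^bsub>quotient_algebra A I\<^esub> = I +>\<^bsub>A\<^esub> \<zero>\<^bsub>A\<^esub>"
  using ideal_subset by (force simp: quotient_algebra_def FactRing_def a_r_coset_def')

lemma add_quotient: "\<lbrakk>a \<in> carrier A; b \<in> carrier A\<rbrakk>
    \<Longrightarrow> (I +>\<^bsub>A\<^esub> a) \<oplus>\<^bsub>quotient_algebra A I\<^esub> (I +>\<^bsub>A\<^esub> b) = I +>\<^bsub>A\<^esub> (a \<oplus>\<^bsub>A\<^esub> b)"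
  using abelian_subgroup.a_rcos_sum[OF abelian_subgroup, of a b]
  by (simp add: quotient_algebra_def FactRing_def)

text \<open>The left side is a union over all representatives of the coset. Two representatives
  differ by an element of \<open>I\<close>, which is closed under scalars, so the cosets in the
  union all coincide.\<close>

lemma smult_quotient:
  assumes k: "k \<in> carrier K" and a: "a \<in> carrier A"
  shows "k \<odot>\<^bsub>quotient_algebra A I\<^esub> (I +>\<^bsub>A\<^esub> a) = I +>\<^bsub>A\<^esub> (k \<odot>\<^bsub>A\<^esub> a)"
proof -
  have "I +>\<^bsub>A\<^esub> (k \<odot>\<^bsub>A\<^esub> b) = I +>\<^bsub>A\<^esub> (k \<odot>\<^bsub>A\<^esub> a)" if b: "b \<in> I +>\<^bsub>A\<^esub> a" for b
  proof -
    from b obtain x where x: "x \<in> I" "b = x \<oplus>\<^bsub>A\<^esub> a" by (rule in_cosetE)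
    then have "k \<odot>\<^bsub>A\<^esub> x \<in> I" using ideal k by (auto simp: algebra_ideal_def)
    then show ?thesis using x a k coset_eq ideal_subset by (simp add: smult_r_distr)
  qed
  moreover have "k \<odot>\<^bsub>quotient_algebra A I\<^esub> (I +>\<^bsub>A\<^esub> a) = (\<Union>b\<in>I +>\<^bsub>A\<^esub> a. I +>\<^bsub>A\<^esub> (k \<odot>\<^bsub>A\<^esub> b))"
    by (simp add: quotient_algebra_def)
  ultimately show ?thesis using self_in_coset[OF a] by blast
qed

text \<open>For \<open>a' = x + a\<close> and \<open>b' = y + b\<close> with \<open>x\<close> and
  \<open>y\<close> in the ideal, \<open>a' b' = (x b' + a y) + a b\<close>. The bracket lies in
  \<open>I\<close> because the ideal is two-sided.\<close>

lemma mult_quotient: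
  assumes a: "a \<in> carrier A" and b: "b \<in> carrier A"
  shows "(I +>\<^bsub>A\<^esub> a) \<otimes>\<^bsub>quotient_algebra A I\<^esub> (I +>\<^bsub>A\<^esub> b) = I +>\<^bsub>A\<^esub> (a \<otimes>\<^bsub>A\<^esub> b)"
proof -
  have eq: "I +>\<^bsub>A\<^esub> (a' \<otimes>\<^bsub>A\<^esub> b') = I +>\<^bsub>A\<^esub> (a \<otimes>\<^bsub>A\<^esub> b)"
    if a': "a' \<in> I +>\<^bsub>A\<^esub> a" and b': "b' \<in> I +>\<^bsub>A\<^esub> b" for a' b'
  proof -
    from a' obtain x where x: "x \<in> I" "a' = x \<oplus>\<^bsub>A\<^esub> a" by (rule in_cosetE)
    from b' obtain y where y: "y \<in> I" "b' = y \<oplus>\<^bsub>A\<^esub> b" by (rule in_cosetE)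
    note xy = ideal_subset[OF x(1)] ideal_subset[OF y(1)]
    have b'A: "b' \<in> carrier A" using y b xy by simp
    have 1: "a' \<otimes>\<^bsub>A\<^esub> b' = x \<otimes>\<^bsub>A\<^esub> b' \<oplus>\<^bsub>A\<^esub> a \<otimes>\<^bsub>A\<^esub> b'"
      unfolding x(2) using a b'A xy by (intro mult_add_left) auto
    have 2: "a \<otimes>\<^bsub>A\<^esub> b' = a \<otimes>\<^bsub>A\<^esub> y \<oplus>\<^bsub>A\<^esub> a \<otimes>\<^bsub>A\<^esub> b"
      unfolding y(2) using a b xy by (intro mult_add_right) auto
    have *: "a' \<otimes>\<^bsub>A\<^esub> b' = (x \<otimes>\<^bsub>A\<^esub> b' \<oplus>\<^bsub>A\<^esub> a \<otimes>\<^bsub>A\<^esub> y) \<oplus>\<^bsub>A\<^esub> a \<otimes>\<^bsub>A\<^esub> b"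
      unfolding 1 2 using a b b'A xy by (intro M.a_assoc[symmetric]) (auto simp: mult_closed)
    have "x \<otimes>\<^bsub>A\<^esub> b' \<in> I" "a \<otimes>\<^bsub>A\<^esub> y \<in> I"
      using ideal x(1) y(1) a b'A by (auto simp: algebra_ideal_def)
    then show ?thesis using coset_eq[OF add_in_ideal] mult_closed a b by (simp add: *)
  qed
  have "(I +>\<^bsub>A\<^esub> a) \<otimes>\<^bsub>quotient_algebra A I\<^esub> (I +>\<^bsub>A\<^esub> b)
      = (\<Union>a'\<in>I +>\<^bsub>A\<^esub> a. \<Union>b'\<in>I +>\<^bsub>A\<^esub> b. I +>\<^bsub>A\<^esub> (a' \<otimes>\<^bsub>A\<^esub> b'))"
    by (simp add: quotient_algebra_def FactRing_def rcoset_mult_def)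
  also have "\<dots> = I +>\<^bsub>A\<^esub> (a \<otimes>\<^bsub>A\<^esub> b)"
    using eq self_in_coset[OF a] self_in_coset[OF b] by blast
  finally show ?thesis .
qed

lemma quotient_nonunital_algebra: "nonunital_algebra K (quotient_algebra A I)"
  by (rule algebra_surjective_image[OF nonunital_algebra_axioms carrier_quotient zero_quotient])
    (auto simp: add_quotient smult_quotient mult_quotient)

lemma coset_linear: "(\<lambda>a. I +>\<^bsub>A\<^esub> a) \<in> linear_maps K A (quotient_algebra A I)"
  by (auto intro!: linear_mapsI simp: carrier_quotient add_quotient smult_quotient)

lemma coset_diff: "\<lbrakk>x \<ominus>\<^bsub>A\<^esub> y \<in> I; x \<in> carrier A; y \<in> carrier A\<rbrakk> \<Longrightarrow> I +>\<^bsub>A\<^esub> x = I +>\<^bsub>A\<^esub> y"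
  using coset_eq[of "x \<ominus>\<^bsub>A\<^esub> y" y] by (simp add: a_minus_def M.a_assoc M.l_neg)

lemma coset_eq_imp_diff:
  assumes "I +>\<^bsub>A\<^esub> x = I +>\<^bsub>A\<^esub> y" and "x \<in> carrier A" and "y \<in> carrier A"
  obtains z where "z \<in> I" "x = z \<oplus>\<^bsub>A\<^esub> y"
  using self_in_coset[OF assms(2)] assms(1) in_cosetE by metis

text \<open>The coset acts through a representative picked by choice. The result is independent of
  the pick, since representatives differ by elements of \<open>I\<close>, which annihilate
  \<open>M\<close>.\<close>

lemma right_module_quotient:
  fixes M :: "('k, 'a, 'm, 'z) rmodule_scheme"
  assumes M: "right_module K A M"
    and ann: "\<And>m x. \<lbrakk>m \<in> carrier M; x \<in> I\<rbrakk> \<Longrightarrow> act M m x = \<zero>\<^bsub>M\<^esub>"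
  obtains N :: "('k, 'a set, 'm) rmodule"
    where "right_module K (quotient_algebra A I) N" "carrier N = carrier M"
    "add N = add M" "smult N = smult M" "\<zero>\<^bsub>N\<^esub> = \<zero>\<^bsub>M\<^esub>"
    "\<And>m a. \<lbrakk>m \<in> carrier M; a \<in> carrier A\<rbrakk> \<Longrightarrow> act N m (I +>\<^bsub>A\<^esub> a) = act M m a"
proof -
  interpret M: right_module K A M by fact
  define N :: "('k, 'a set, 'm) rmodule" where
    "N = \<lparr>carrier = carrier M, mult = undefined, one = undefined, zero = \<zero>\<^bsub>M\<^esub>, add = add M,
      smult = smult M, act = (\<lambda>m X. act M m (SOME a. a \<in> carrier A \<and> I +>\<^bsub>A\<^esub> a = X))\<rparr>"
  have act: "act N m (I +>\<^bsub>A\<^esub> a) = act M m a" if m: "m \<in> carrier M" and a: "a \<in> carrier A" for m a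
  proof -
    define b where "b = (SOME b. b \<in> carrier A \<and> I +>\<^bsub>A\<^esub> b = I +>\<^bsub>A\<^esub> a)"
    have b: "b \<in> carrier A \<and> I +>\<^bsub>A\<^esub> b = I +>\<^bsub>A\<^esub> a"
      unfolding b_def by (rule someI[of _ a]) (simp add: a)
    then obtain z where z: "z \<in> I" "b = z \<oplus>\<^bsub>A\<^esub> a" using coset_eq_imp_diff a by blast
    then have "act M m b = act M m a"
      using ann m a ideal_subset by (simp add: M.act_add_right M.act_closed)
    then show ?thesis by (simp add: N_def b_def)
  qed
  have N: "Module.module K N"
    by (rule module_surjective_image[OF M.modules(2), of _ "\<lambda>m. m"]) (auto simp: N_def)
  have "right_module K (quotient_algebra A I) N"
    by (rule right_module_descend[OF M quotient_nonunital_algebra coset_linear carrier_quotient _ N])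
      (simp_all add: mult_quotient act, simp_all add: N_def)
  then show ?thesis by (rule that) (simp_all add: act, simp_all add: N_def)
qed

end

section \<open>Algebras of finitely supported functions\<close>

definition delta :: "('k, 'x) ring_scheme \<Rightarrow> 's \<Rightarrow> 's \<Rightarrow> 'k" where
  "delta K s = (\<lambda>u. if u = s then \<one>\<^bsub>K\<^esub> else \<zero>\<^bsub>K\<^esub>)"

definition lin_ext :: "('k, 'x) ring_scheme \<Rightarrow> ('k, 'n, 'z) module_scheme
    \<Rightarrow> ('s \<Rightarrow> 'n) \<Rightarrow> ('s \<Rightarrow> 'k) \<Rightarrow> 'n" where
  "lin_ext K N \<phi> f = finsum N (\<lambda>s. f s \<odot>\<^bsub>N\<^esub> \<phi> s) {s. f s \<noteq> \<zero>\<^bsub>K\<^esub>}"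

text \<open>The free K-module on \<open>S\<close>, as a common frame for two algebras: the free
  algebra, where \<open>S\<close> consists of the nonempty words in the generators, and the Laurent
  polynomials, where \<open>S\<close> is the set of all integers.\<close>

locale fs_module = field K for K :: "('k, 'x) ring_scheme" (structure) +
  fixes S :: "'s set" and A :: "('k, 's \<Rightarrow> 'k) module"
  assumes carrier_A: "carrier A = {f. (\<forall>s. f s \<in> carrier K) \<and> finite {s. f s \<noteq> \<zero>} \<and>
      (\<forall>s. f s \<noteq> \<zero> \<longrightarrow> s \<in> S)}"
    and zero_A: "\<zero>\<^bsub>A\<^esub> = (\<lambda>s. \<zero>)"
    and add_A: "f \<oplus>\<^bsub>A\<^esub> g = (\<lambda>s. f s \<oplus> g s)"
    and smult_A: "k \<odot>\<^bsub>A\<^esub> f = (\<lambda>s. k \<otimes> f s)"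
begin

lemma fs_values: "f \<in> carrier A \<Longrightarrow> f s \<in> carrier K"
  and fs_finite: "f \<in> carrier A \<Longrightarrow> finite {s. f s \<noteq> \<zero>}"
  and fs_support: "\<lbrakk>f \<in> carrier A; f s \<noteq> \<zero>\<rbrakk> \<Longrightarrow> s \<in> S"
  by (auto simp: carrier_A)

lemma fs_add_closed: "\<lbrakk>f \<in> carrier A; g \<in> carrier A\<rbrakk> \<Longrightarrow> f \<oplus>\<^bsub>A\<^esub> g \<in> carrier A"
proof -
  assume f: "f \<in> carrier A" and g: "g \<in> carrier A"
  have "{s. f s \<oplus> g s \<noteq> \<zero>} \<subseteq> {s. f s \<noteq> \<zero>} \<union> {s. g s \<noteq> \<zero>}" by auto
  then have "finite {s. f s \<oplus> g s \<noteq> \<zero>}"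
    by (rule finite_subset) (simp add: fs_finite f g)
  moreover have "s \<in> S" if "f s \<oplus> g s \<noteq> \<zero>" for s
    using that fs_support[OF f] fs_support[OF g] fs_values[OF g] by (cases "f s = \<zero>") auto
  ultimately show ?thesis
    using fs_values[OF f] fs_values[OF g] by (auto simp: add_A carrier_A)
qed

lemma fs_smult_closed: "\<lbrakk>k \<in> carrier K; f \<in> carrier A\<rbrakk> \<Longrightarrow> k \<odot>\<^bsub>A\<^esub> f \<in> carrier A"
proof -
  assume k: "k \<in> carrier K" and f: "f \<in> carrier A"
  have "{s. k \<otimes> f s \<noteq> \<zero>} \<subseteq> {s. f s \<noteq> \<zero>}" using k by auto
  then have "finite {s. k \<otimes> f s \<noteq> \<zero>}"
    by (rule finite_subset) (simp add: fs_finite f)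
  moreover have "s \<in> S" if "k \<otimes> f s \<noteq> \<zero>" for s
    using that fs_support[OF f] k by (cases "f s = \<zero>") auto
  ultimately show ?thesis
    using fs_values[OF f] k by (auto simp: smult_A carrier_A)
qed

lemma fs_is_module: "Module.module K A"
proof (rule moduleI)
  show "abelian_group A"
  proof (rule abelian_groupI)
    fix f assume f: "f \<in> carrier A"
    have "(\<ominus> \<one>) \<odot>\<^bsub>A\<^esub> f \<oplus>\<^bsub>A\<^esub> f = \<zero>\<^bsub>A\<^esub>"
      using fs_values[OF f] by (auto simp: add_A smult_A zero_A l_minus l_neg)
    then show "\<exists>y\<in>carrier A. y \<oplus>\<^bsub>A\<^esub> f = \<zero>\<^bsub>A\<^esub>" using fs_smult_closed[OF _ f] by blast
  next
    show "\<zero>\<^bsub>A\<^esub> \<in> carrier A" by (simp add: carrier_A zero_A)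
  next
    fix f g assume fg: "f \<in> carrier A" "g \<in> carrier A"
    show "f \<oplus>\<^bsub>A\<^esub> g \<in> carrier A" by (rule fs_add_closed[OF fg])
    show "f \<oplus>\<^bsub>A\<^esub> g = g \<oplus>\<^bsub>A\<^esub> f"
      unfolding add_A by (rule ext) (intro a_comm fs_values fg)
    fix h assume h: "h \<in> carrier A"
    show "f \<oplus>\<^bsub>A\<^esub> g \<oplus>\<^bsub>A\<^esub> h = f \<oplus>\<^bsub>A\<^esub> (g \<oplus>\<^bsub>A\<^esub> h)"
      unfolding add_A by (rule ext) (intro a_assoc fs_values fg h)
  next
    fix f assume "f \<in> carrier A"
    then show "\<zero>\<^bsub>A\<^esub> \<oplus>\<^bsub>A\<^esub> f = f" by (simp add: add_A zero_A fs_values)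
  qed
qed (simp_all add: is_cring fs_smult_closed,
    simp_all add: add_A smult_A l_distr r_distr m_assoc fs_values)

lemma delta_closed: "s \<in> S \<Longrightarrow> delta K s \<in> carrier A"
  by (auto simp: carrier_A delta_def)

text \<open>Induction on a finite set that contains the support: the function is split into its
  value at one point and its restriction to the rest.\<close>

lemma fs_induct [consumes 1, case_names zero add]:
  assumes f: "f \<in> carrier A" and zero: "P \<zero>\<^bsub>A\<^esub>"
    and add: "\<And>f k s. \<lbrakk>f \<in> carrier A; P f; k \<in> carrier K; s \<in> S\<rbrakk>
      \<Longrightarrow> P (f \<oplus>\<^bsub>A\<^esub> k \<odot>\<^bsub>A\<^esub> delta K s)"
  shows "P f"
proof -
  have "\<forall>f. f \<in> carrier A \<and> {s. f s \<noteq> \<zero>} \<subseteq> F \<longrightarrow> P f" if "finite F" for F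
    using that
  proof (induction F)
    case empty
    have "f = \<zero>\<^bsub>A\<^esub>" if "{s. f s \<noteq> \<zero>} \<subseteq> {}" for f using that by (auto simp: zero_A)
    then show ?case using zero by auto
  next
    case (insert t F)
    show ?case
    proof (intro allI impI)
      fix f assume f: "f \<in> carrier A \<and> {s. f s \<noteq> \<zero>} \<subseteq> insert t F"
      then have fA: "f \<in> carrier A" by blast
      let ?g = "f(t := \<zero>)"
      have g: "?g \<in> carrier A"
      proof -
        have "finite {s. ?g s \<noteq> \<zero>}"
          by (rule finite_subset[OF _ fs_finite[of f]]) (use f in auto)
        moreover have "?g s \<in> carrier K" for s using fs_values[OF fA] by simp
        moreover have "s \<in> S" if "?g s \<noteq> \<zero>" for s
          using fs_support[OF fA, of s] that by (cases "s = t") auto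
        ultimately show ?thesis unfolding carrier_A by blast
      qed
      have "{s. ?g s \<noteq> \<zero>} \<subseteq> F" using f by auto
      then have Pg: "P ?g" using insert.IH g by blast
      show "P f"
      proof (cases "f t = \<zero>")
        case True
        then show ?thesis using Pg by (metis fun_upd_triv)
      next
        case False
        have "f = ?g \<oplus>\<^bsub>A\<^esub> f t \<odot>\<^bsub>A\<^esub> delta K t"
          using fs_values[OF fA] by (auto simp: add_A smult_A delta_def)
        then show ?thesis
          using add[OF g Pg fs_values[OF fA] fs_support[OF fA False]] by metis
      qed
    qed
  qed
  then show ?thesis using f fs_finite[OF f] by blast
qed

lemma fs_linear_eq:
  assumes f: "f \<in> carrier A" and F: "F \<in> linear_maps K A N" and G: "G \<in> linear_maps K A N"
    and N: "Module.module K N" and eq: "\<And>s. s \<in> S \<Longrightarrow> F (delta K s) = G (delta K s)"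
  shows "F f = G f"
  using f
proof (induction rule: fs_induct)
  case zero
  then show ?case using linear_maps_zero[OF F fs_is_module N] linear_maps_zero[OF G fs_is_module N] by simp
next
  case (add f k s)
  then show ?case
    using linear_maps_add[OF F] linear_maps_add[OF G] linear_maps_smult[OF F] linear_maps_smult[OF G]
    by (simp add: delta_closed fs_smult_closed eq)
qed

lemma lin_ext_superset:
  assumes N: "Module.module K N" and f: "f \<in> carrier A" and \<phi>: "\<And>s. s \<in> S \<Longrightarrow> \<phi> s \<in> carrier N"
    and F: "finite F" "{s. f s \<noteq> \<zero>} \<subseteq> F" "F \<subseteq> S"
  shows "lin_ext K N \<phi> f = finsum N (\<lambda>s. f s \<odot>\<^bsub>N\<^esub> \<phi> s) F"
proof -
  interpret N: Module.module K N by fact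
  show ?thesis unfolding lin_ext_def
    by (rule N.M.finsum_mono_neutral[symmetric]) (use F \<phi> fs_values[OF f] in auto)
qed

lemma lin_ext_linear:
  assumes N: "Module.module K N" and \<phi>: "\<And>s. s \<in> S \<Longrightarrow> \<phi> s \<in> carrier N"
  shows "lin_ext K N \<phi> \<in> linear_maps K A N"
proof (rule linear_mapsI)
  interpret N: Module.module K N by fact
  note ext = lin_ext_superset[OF N _ \<phi>]
  fix f assume f: "f \<in> carrier A"
  show "lin_ext K N \<phi> f \<in> carrier N"
    unfolding lin_ext_def using \<phi> fs_support[OF f] fs_values[OF f] by (intro N.M.finsum_closed) auto
  {
    fix g assume g: "g \<in> carrier A"
    \<comment> \<open>Cancellation may make the support of the sum smaller than the union of the
      supports, so all three expressions are computed over the union.\<close>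
    let ?F = "{s. f s \<noteq> \<zero>} \<union> {s. g s \<noteq> \<zero>}"
    have F: "finite ?F" "?F \<subseteq> S" using fs_finite fs_support f g by auto
    have sup: "{s. (f \<oplus>\<^bsub>A\<^esub> g) s \<noteq> \<zero>} \<subseteq> ?F" by (auto simp: add_A)
    have "lin_ext K N \<phi> (f \<oplus>\<^bsub>A\<^esub> g) = finsum N (\<lambda>s. (f \<oplus>\<^bsub>A\<^esub> g) s \<odot>\<^bsub>N\<^esub> \<phi> s) ?F"
      using ext[OF fs_add_closed[OF f g] _ F(1) sup F(2)] .
    also have "\<dots> = finsum N (\<lambda>s. f s \<odot>\<^bsub>N\<^esub> \<phi> s \<oplus>\<^bsub>N\<^esub> g s \<odot>\<^bsub>N\<^esub> \<phi> s) ?F"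
      by (rule N.M.finsum_cong')
        (use \<phi> F(2) fs_values f g in \<open>auto simp: add_A N.smult_l_distr subset_iff\<close>)
    also have "\<dots> = finsum N (\<lambda>s. f s \<odot>\<^bsub>N\<^esub> \<phi> s) ?F \<oplus>\<^bsub>N\<^esub> finsum N (\<lambda>s. g s \<odot>\<^bsub>N\<^esub> \<phi> s) ?F"
      by (rule N.M.finsum_addf) (use \<phi> F(2) fs_values f g in \<open>auto simp: subset_iff\<close>)
    also have "\<dots> = lin_ext K N \<phi> f \<oplus>\<^bsub>N\<^esub> lin_ext K N \<phi> g"
      using ext[OF f _ F(1) _ F(2)] ext[OF g _ F(1) _ F(2)] by simp
    finally show "lin_ext K N \<phi> (f \<oplus>\<^bsub>A\<^esub> g) = lin_ext K N \<phi> f \<oplus>\<^bsub>N\<^esub> lin_ext K N \<phi> g" .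
  next
    fix k assume k: "k \<in> carrier K"
    let ?F = "{s. f s \<noteq> \<zero>}"
    have F: "finite ?F" "?F \<subseteq> S" using fs_finite fs_support f by auto
    have sup: "{s. (k \<odot>\<^bsub>A\<^esub> f) s \<noteq> \<zero>} \<subseteq> ?F" using k by (auto simp: smult_A)
    have "(\<lambda>x. k \<odot>\<^bsub>N\<^esub> x) \<in> linear_maps K N N"
      using k by (auto intro!: linear_mapsI simp: N.smult_r_distr N.smult_assoc1[symmetric] m_comm)
    then have "k \<odot>\<^bsub>N\<^esub> lin_ext K N \<phi> f = finsum N (\<lambda>s. k \<odot>\<^bsub>N\<^esub> (f s \<odot>\<^bsub>N\<^esub> \<phi> s)) ?F"
      unfolding lin_ext_def using F(2) \<phi> fs_values[OF f]
      by (intro linear_maps_finsum[OF _ N N]) (auto simp: subset_iff)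
    also have "\<dots> = finsum N (\<lambda>s. (k \<odot>\<^bsub>A\<^esub> f) s \<odot>\<^bsub>N\<^esub> \<phi> s) ?F"
      by (rule N.M.finsum_cong')
        (use \<phi> F(2) fs_values f k in \<open>auto simp: smult_A N.smult_assoc1 subset_iff\<close>)
    also have "\<dots> = lin_ext K N \<phi> (k \<odot>\<^bsub>A\<^esub> f)"
      using ext[OF fs_smult_closed[OF k f] _ F(1) sup F(2)] by simp
    finally show "lin_ext K N \<phi> (k \<odot>\<^bsub>A\<^esub> f) = k \<odot>\<^bsub>N\<^esub> lin_ext K N \<phi> f" ..
  }
qed

lemma lin_ext_delta:
  assumes N: "Module.module K N" and \<phi>: "\<phi> s \<in> carrier N"
  shows "lin_ext K N \<phi> (delta K s) = \<phi> s"
proof -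
  interpret N: Module.module K N by fact
  have "{t. delta K s t \<noteq> \<zero>} = {s}" by (auto simp: delta_def)
  then show ?thesis using \<phi> by (simp add: lin_ext_def delta_def)
qed

end

text \<open>The semigroup algebra of \<open>S\<close> under \<open>op\<close>. Multiplication is
  specified by bilinearity and by its values on basis elements, so that identities are checked on
  the basis and each convolution formula is unfolded only when its instance is set up.\<close>

locale fs_algebra = fs_module +
  fixes op :: "'s \<Rightarrow> 's \<Rightarrow> 's"
  assumes mult_left: "g \<in> carrier A \<Longrightarrow> (\<lambda>f. f \<otimes>\<^bsub>A\<^esub> g) \<in> linear_maps K A A"
    and mult_right: "f \<in> carrier A \<Longrightarrow> (\<lambda>g. f \<otimes>\<^bsub>A\<^esub> g) \<in> linear_maps K A A"
    and op_closed: "\<lbrakk>s \<in> S; t \<in> S\<rbrakk> \<Longrightarrow> op s t \<in> S"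
    and op_assoc: "\<lbrakk>s \<in> S; t \<in> S; u \<in> S\<rbrakk> \<Longrightarrow> op (op s t) u = op s (op t u)"
    and delta_mult: "\<lbrakk>s \<in> S; t \<in> S\<rbrakk> \<Longrightarrow> delta K s \<otimes>\<^bsub>A\<^esub> delta K t = delta K (op s t)"
begin

lemma fs_mult_closed: "\<lbrakk>f \<in> carrier A; g \<in> carrier A\<rbrakk> \<Longrightarrow> f \<otimes>\<^bsub>A\<^esub> g \<in> carrier A"
  by (rule linear_maps_closed[OF mult_left])

lemma fs_bilinear_eq:
  assumes f: "f \<in> carrier A" and g: "g \<in> carrier A" and N: "Module.module K N"
    and F: "\<And>g. g \<in> carrier A \<Longrightarrow> (\<lambda>f. F f g) \<in> linear_maps K A N"
      "\<And>f. f \<in> carrier A \<Longrightarrow> (\<lambda>g. F f g) \<in> linear_maps K A N"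
    and G: "\<And>g. g \<in> carrier A \<Longrightarrow> (\<lambda>f. G f g) \<in> linear_maps K A N"
      "\<And>f. f \<in> carrier A \<Longrightarrow> (\<lambda>g. G f g) \<in> linear_maps K A N"
    and eq: "\<And>s t. \<lbrakk>s \<in> S; t \<in> S\<rbrakk> \<Longrightarrow> F (delta K s) (delta K t) = G (delta K s) (delta K t)"
  shows "F f g = G f g"
proof (rule fs_linear_eq[OF f F(1) G(1) N])
  fix s assume s: "s \<in> S"
  show "F (delta K s) g = G (delta K s) g"
    by (rule fs_linear_eq[OF g F(2) G(2) N]) (use s eq delta_closed in auto)
qed (use g in auto)

text \<open>Both sides are linear in each of the three factors, which reduces the claim to basis
  elements, that is, to \<open>op_assoc\<close>.\<close>

lemma fs_assoc:
  assumes f: "f \<in> carrier A" and g: "g \<in> carrier A" and h: "h \<in> carrier A"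
  shows "f \<otimes>\<^bsub>A\<^esub> g \<otimes>\<^bsub>A\<^esub> h = f \<otimes>\<^bsub>A\<^esub> (g \<otimes>\<^bsub>A\<^esub> h)"
proof (rule fs_bilinear_eq[OF f g fs_is_module])
  fix s t assume s: "s \<in> S" and t: "t \<in> S"
  show "delta K s \<otimes>\<^bsub>A\<^esub> delta K t \<otimes>\<^bsub>A\<^esub> h = delta K s \<otimes>\<^bsub>A\<^esub> (delta K t \<otimes>\<^bsub>A\<^esub> h)"
    by (rule fs_linear_eq[OF h mult_right linear_maps_comp[OF mult_right mult_right] fs_is_module])
      (use s t in \<open>auto simp: delta_mult op_closed op_assoc fs_mult_closed delta_closed\<close>)
qed (use h in \<open>auto intro!: linear_maps_comp[OF mult_left mult_left] linear_maps_comp[OF mult_right mult_left]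
      linear_maps_comp[OF mult_left mult_right] mult_left mult_right fs_mult_closed\<close>)

lemma fs_is_algebra: "nonunital_algebra K A"
  by (intro nonunital_algebra.intro nonunital_algebra_axioms.intro fs_is_module)
    (simp_all add: fs_mult_closed fs_assoc linear_maps_add[OF mult_left] linear_maps_add[OF mult_right]
      linear_maps_smult[OF mult_left] linear_maps_smult[OF mult_right])

lemma lin_ext_mult:
  assumes B: "nonunital_algebra K B" and \<phi>: "\<And>s. s \<in> S \<Longrightarrow> \<phi> s \<in> carrier B"
    and mult: "\<And>s t. \<lbrakk>s \<in> S; t \<in> S\<rbrakk> \<Longrightarrow> \<phi> (op s t) = \<phi> s \<otimes>\<^bsub>B\<^esub> \<phi> t"
    and f: "f \<in> carrier A" and g: "g \<in> carrier A"
  shows "lin_ext K B \<phi> (f \<otimes>\<^bsub>A\<^esub> g) = lin_ext K B \<phi> f \<otimes>\<^bsub>B\<^esub> lin_ext K B \<phi> g"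
proof (rule fs_bilinear_eq[OF f g])
  interpret B: nonunital_algebra K B by fact
  show "Module.module K B" by (rule B.is_module)
  note ext = lin_ext_linear[OF B.is_module \<phi>]
  note cl = linear_maps_closed[OF ext]
  fix h assume h: "h \<in> carrier A"
  show "(\<lambda>f. lin_ext K B \<phi> (f \<otimes>\<^bsub>A\<^esub> h)) \<in> linear_maps K A B"
    "(\<lambda>f. lin_ext K B \<phi> (h \<otimes>\<^bsub>A\<^esub> f)) \<in> linear_maps K A B"
    by (rule linear_maps_comp[OF mult_left ext] linear_maps_comp[OF mult_right ext]; simp add: h)+
  show "(\<lambda>f. lin_ext K B \<phi> f \<otimes>\<^bsub>B\<^esub> lin_ext K B \<phi> h) \<in> linear_maps K A B"
    "(\<lambda>f. lin_ext K B \<phi> h \<otimes>\<^bsub>B\<^esub> lin_ext K B \<phi> f) \<in> linear_maps K A B"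
    by (rule linear_maps_comp[OF ext B.mult_linear_left] linear_maps_comp[OF ext B.mult_linear_right];
        simp add: cl h)+
next
  interpret B: nonunital_algebra K B by fact
  fix s t assume "s \<in> S" "t \<in> S"
  then show "lin_ext K B \<phi> (delta K s \<otimes>\<^bsub>A\<^esub> delta K t)
      = lin_ext K B \<phi> (delta K s) \<otimes>\<^bsub>B\<^esub> lin_ext K B \<phi> (delta K t)"
    by (simp add: delta_mult lin_ext_delta[OF B.is_module] \<phi> op_closed mult B.mult_closed)
qed

text \<open>A representation of the semigroup extends linearly to its algebra. Modules are right
  modules, so \<open>op s t\<close> has to act by \<open>\<rho> s\<close> first and by
  \<open>\<rho> t\<close> second.\<close>

lemma lin_ext_right_module:
  assumes M: "Module.module K M" and \<rho>: "\<And>s. s \<in> S \<Longrightarrow> \<rho> s \<in> linear_maps K M M"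
    and mult: "\<And>s t m. \<lbrakk>s \<in> S; t \<in> S; m \<in> carrier M\<rbrakk> \<Longrightarrow> \<rho> (op s t) m = \<rho> t (\<rho> s m)"
    and act: "\<And>m f. \<lbrakk>m \<in> carrier M; f \<in> carrier A\<rbrakk> \<Longrightarrow> act M m f = lin_ext K M (\<lambda>s. \<rho> s m) f"
  shows "right_module K A M"
proof -
  interpret M: Module.module K M by fact
  interpret A: nonunital_algebra K A by (rule fs_is_algebra)
  note \<rho>_closed = linear_maps_closed[OF \<rho>]
  have lin_right: "act M m \<in> linear_maps K A M" if "m \<in> carrier M" for m
    by (rule linear_maps_cong[OF lin_ext_linear[OF M, of "\<lambda>s. \<rho> s m"] act[symmetric] A.is_module])
      (use that \<rho>_closed in auto)
  have lin_left: "(\<lambda>m. act M m f) \<in> linear_maps K M M" if f: "f \<in> carrier A" for f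
  proof (rule linear_maps_cong[OF _ _ M])
    show "(\<lambda>m. finsum M (\<lambda>s. f s \<odot>\<^bsub>M\<^esub> \<rho> s m) {s. f s \<noteq> \<zero>}) \<in> linear_maps K M M"
    proof (rule linear_maps_finsum_map[OF M])
      fix s assume "s \<in> {s. f s \<noteq> \<zero>}"
      then have s: "\<rho> s \<in> linear_maps K M M" using fs_support[OF f] \<rho> by auto
      have "(\<lambda>x. f s \<odot>\<^bsub>M\<^esub> x) \<in> linear_maps K M M" using fs_values[OF f]
        by (auto intro!: linear_mapsI simp: M.smult_r_distr M.smult_assoc1[symmetric] m_comm)
      then show "(\<lambda>m. f s \<odot>\<^bsub>M\<^esub> \<rho> s m) \<in> linear_maps K M M" by (rule linear_maps_comp[OF s])
    qed
  qed (simp add: act f lin_ext_def)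
  note cl = linear_maps_closed[OF lin_right]
  have act_delta: "act M m (delta K s) = \<rho> s m" if "s \<in> S" "m \<in> carrier M" for m s
    using that by (simp add: act delta_closed lin_ext_delta[OF M, of "\<lambda>s. \<rho> s m"] \<rho>_closed)
  have assoc: "act M m (f \<otimes>\<^bsub>A\<^esub> g) = act M (act M m f) g"
    if m: "m \<in> carrier M" and f: "f \<in> carrier A" and g: "g \<in> carrier A" for m f g
  proof (rule fs_bilinear_eq[OF f g M])
    fix s t assume "s \<in> S" "t \<in> S"
    then show "act M m (delta K s \<otimes>\<^bsub>A\<^esub> delta K t) = act M (act M m (delta K s)) (delta K t)"
      using m by (simp add: delta_mult act_delta op_closed mult \<rho>_closed)
  next
    fix h assume h: "h \<in> carrier A"
    show "(\<lambda>f. act M m (f \<otimes>\<^bsub>A\<^esub> h)) \<in> linear_maps K A M"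
      "(\<lambda>f. act M m (h \<otimes>\<^bsub>A\<^esub> f)) \<in> linear_maps K A M"
      "(\<lambda>f. act M (act M m f) h) \<in> linear_maps K A M"
      by (rule linear_maps_comp[OF mult_left lin_right] linear_maps_comp[OF mult_right lin_right]
          linear_maps_comp[OF lin_right lin_left]; use h m in simp)+
    show "(\<lambda>f. act M (act M m h) f) \<in> linear_maps K A M"
      using lin_right[of "act M m h"] cl[OF m h] by simp
  qed
  show ?thesis
    by (intro right_module.intro right_module_axioms.intro M A.nonunital_algebra_axioms)
      (simp_all add: cl assoc linear_maps_add[OF lin_right] linear_maps_add[OF lin_left]
        linear_maps_smult[OF lin_right] linear_maps_smult[OF lin_left])
qed

end

section \<open>The two instances: words and integer exponents\<close>

lemma word_elem_eq_delta: "word_elem K = delta K"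
  by (simp add: word_elem_def delta_def fun_eq_iff)

lemma fs_algebra_free:
  assumes "field K"
  shows "fs_algebra K {w. w \<noteq> [] \<and> set w \<subseteq> X} (free_algebra K X) (@)"
proof -
  interpret K: field K by fact
  let ?A = "free_algebra K X"
  interpret fs_module K "{w. w \<noteq> [] \<and> set w \<subseteq> X}" ?A
    by unfold_locales (auto simp: free_algebra_def)
  have mult: "f \<otimes>\<^bsub>?A\<^esub> g = (\<lambda>w. finsum K (\<lambda>i. f (take i w) \<otimes>\<^bsub>K\<^esub> g (drop i w)) {..length w})" for f g
    by (simp add: free_algebra_def)
  have closed: "f \<otimes>\<^bsub>?A\<^esub> g \<in> carrier ?A" if f: "f \<in> carrier ?A" and g: "g \<in> carrier ?A" for f g
  proof -
    \<comment> \<open>A word in the support of the product is a concatenation of words in the two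
      supports. This bounds the support by a finite set and keeps the empty word out of it.\<close>
    have nz: "\<exists>u v. w = u @ v \<and> f u \<noteq> \<zero>\<^bsub>K\<^esub> \<and> g v \<noteq> \<zero>\<^bsub>K\<^esub>" if "(f \<otimes>\<^bsub>?A\<^esub> g) w \<noteq> \<zero>\<^bsub>K\<^esub>" for w
    proof (rule ccontr)
      assume n: "\<not> ?thesis"
      have "f (take i w) \<otimes>\<^bsub>K\<^esub> g (drop i w) = \<zero>\<^bsub>K\<^esub>" for i
      proof -
        have "f (take i w) = \<zero>\<^bsub>K\<^esub> \<or> g (drop i w) = \<zero>\<^bsub>K\<^esub>" using n append_take_drop_id by metis
        then show ?thesis using fs_values[OF f] fs_values[OF g] by auto
      qed
      then show False using that by (simp add: mult)
    qed
    have "{w. (f \<otimes>\<^bsub>?A\<^esub> g) w \<noteq> \<zero>\<^bsub>K\<^esub>} \<subseteq> (\<lambda>(u, v). u @ v) ` ({s. f s \<noteq> \<zero>\<^bsub>K\<^esub>} \<times> {s. g s \<noteq> \<zero>\<^bsub>K\<^esub>})"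
      using nz by force
    then have "finite {w. (f \<otimes>\<^bsub>?A\<^esub> g) w \<noteq> \<zero>\<^bsub>K\<^esub>}"
      by (rule finite_subset) (simp add: fs_finite f g)
    moreover have "w \<in> {w. w \<noteq> [] \<and> set w \<subseteq> X}" if "(f \<otimes>\<^bsub>?A\<^esub> g) w \<noteq> \<zero>\<^bsub>K\<^esub>" for w
      using nz[OF that] fs_support[OF f] fs_support[OF g] by fastforce
    moreover have "(f \<otimes>\<^bsub>?A\<^esub> g) w \<in> carrier K" for w
      unfolding mult using fs_values f g by (intro K.finsum_closed) auto
    ultimately show ?thesis unfolding carrier_A by blast
  qed
  show ?thesis
  proof unfold_locales
    fix g assume g: "g \<in> carrier ?A"
    show "(\<lambda>f. f \<otimes>\<^bsub>?A\<^esub> g) \<in> linear_maps K ?A ?A"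
    proof (rule linear_mapsI)
      fix f h assume f: "f \<in> carrier ?A" and h: "h \<in> carrier ?A"
      show "(f \<oplus>\<^bsub>?A\<^esub> h) \<otimes>\<^bsub>?A\<^esub> g = f \<otimes>\<^bsub>?A\<^esub> g \<oplus>\<^bsub>?A\<^esub> h \<otimes>\<^bsub>?A\<^esub> g"
        unfolding mult add_A by (rule ext, subst K.finsum_addf[symmetric])
          (use fs_values f g h in \<open>auto intro!: K.finsum_cong' simp: K.l_distr\<close>)
    next
      fix k f assume k: "k \<in> carrier K" and f: "f \<in> carrier ?A"
      show "(k \<odot>\<^bsub>?A\<^esub> f) \<otimes>\<^bsub>?A\<^esub> g = k \<odot>\<^bsub>?A\<^esub> (f \<otimes>\<^bsub>?A\<^esub> g)"
        unfolding mult smult_A by (rule ext, subst K.finsum_rdistr)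
          (use fs_values f g k in \<open>auto intro!: K.finsum_cong' simp: K.m_assoc\<close>)
    qed (rule closed[OF _ g])
  next
    fix f assume f: "f \<in> carrier ?A"
    show "(\<lambda>g. f \<otimes>\<^bsub>?A\<^esub> g) \<in> linear_maps K ?A ?A"
    proof (rule linear_mapsI)
      fix g h assume g: "g \<in> carrier ?A" and h: "h \<in> carrier ?A"
      show "f \<otimes>\<^bsub>?A\<^esub> (g \<oplus>\<^bsub>?A\<^esub> h) = f \<otimes>\<^bsub>?A\<^esub> g \<oplus>\<^bsub>?A\<^esub> f \<otimes>\<^bsub>?A\<^esub> h"
        unfolding mult add_A by (rule ext, subst K.finsum_addf[symmetric])
          (use fs_values f g h in \<open>auto intro!: K.finsum_cong' simp: K.r_distr\<close>)
    next
      fix k g assume k: "k \<in> carrier K" and g: "g \<in> carrier ?A"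
      show "f \<otimes>\<^bsub>?A\<^esub> (k \<odot>\<^bsub>?A\<^esub> g) = k \<odot>\<^bsub>?A\<^esub> (f \<otimes>\<^bsub>?A\<^esub> g)"
        unfolding mult smult_A by (rule ext, subst K.finsum_rdistr)
          (use fs_values f g k in \<open>auto intro!: K.finsum_cong' simp: K.m_lcomm\<close>)
    qed (rule closed[OF f])
  next
    fix s t assume "s \<in> {w. w \<noteq> [] \<and> set w \<subseteq> X}" "t \<in> {w. w \<noteq> [] \<and> set w \<subseteq> X}"
    show "delta K s \<otimes>\<^bsub>?A\<^esub> delta K t = delta K (s @ t)"
    proof
      fix w
      show "(delta K s \<otimes>\<^bsub>?A\<^esub> delta K t) w = delta K (s @ t) w"
        unfolding mult
      \<comment> \<open>Only the cut after \<open>length s\<close> letters can reproduce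
        \<open>s\<close> as the left part. If \<open>w\<close> is too short for this cut, then
        \<open>w\<close> differs from \<open>s @ t\<close> and both sides are zero.\<close>
      proof (rule K.finsum_one_term[where j = "length s"])
        fix i assume "i \<in> {..length w}" "i \<noteq> length s"
        then have "take i w \<noteq> s" by auto
        then show "delta K s (take i w) \<otimes>\<^bsub>K\<^esub> delta K t (drop i w) = \<zero>\<^bsub>K\<^esub>"
          by (simp add: delta_def)
      next
        show "delta K s (take (length s) w) \<otimes>\<^bsub>K\<^esub> delta K t (drop (length s) w) = delta K (s @ t) w"
        proof (cases "take (length s) w = s \<and> drop (length s) w = t")
          case True
          then have "w = s @ t" by (metis append_take_drop_id)
          then show ?thesis by (simp add: delta_def)
        qed (auto simp: delta_def)
      qed (auto simp: delta_def)
    qed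
  qed auto
qed

lemma fs_algebra_laurent:
  assumes "field K"
  shows "fs_algebra K UNIV (laurent_algebra K) (+)"
proof -
  interpret K: field K by fact
  let ?A = "laurent_algebra K"
  interpret fs_module K UNIV ?A
    by unfold_locales (auto simp: laurent_algebra_def)
  have mult: "f \<otimes>\<^bsub>?A\<^esub> g = (\<lambda>n. finsum K (\<lambda>i. f i \<otimes>\<^bsub>K\<^esub> g (n - i)) {i. f i \<noteq> \<zero>\<^bsub>K\<^esub>})" for f g
    by (simp add: laurent_algebra_def)
  \<comment> \<open>The convolution is summed over the support of its left factor, which changes
    when left factors are added or scaled. Linearity in that argument is therefore compared over a
    fixed finite superset.\<close>
  have mult_superset: "(f \<otimes>\<^bsub>?A\<^esub> g) n = finsum K (\<lambda>i. f i \<otimes>\<^bsub>K\<^esub> g (n - i)) F"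
    if "f \<in> carrier ?A" "g \<in> carrier ?A" "finite F" "{i. f i \<noteq> \<zero>\<^bsub>K\<^esub>} \<subseteq> F" for f g n F
    unfolding mult
    by (rule K.finsum_mono_neutral[symmetric]) (use that fs_values in auto)
  have closed: "f \<otimes>\<^bsub>?A\<^esub> g \<in> carrier ?A" if f: "f \<in> carrier ?A" and g: "g \<in> carrier ?A" for f g
  proof -
    have nz: "\<exists>i j. n = i + j \<and> f i \<noteq> \<zero>\<^bsub>K\<^esub> \<and> g j \<noteq> \<zero>\<^bsub>K\<^esub>" if "(f \<otimes>\<^bsub>?A\<^esub> g) n \<noteq> \<zero>\<^bsub>K\<^esub>" for n
    proof (rule ccontr)
      assume n: "\<not> ?thesis"
      have "f i \<otimes>\<^bsub>K\<^esub> g (n - i) = \<zero>\<^bsub>K\<^esub>" for i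
      proof -
        have "f i = \<zero>\<^bsub>K\<^esub> \<or> g (n - i) = \<zero>\<^bsub>K\<^esub>" using n by (metis add.commute diff_add_cancel)
        then show ?thesis using fs_values[OF f] fs_values[OF g] by auto
      qed
      then show False using that by (simp add: mult)
    qed
    have "{n. (f \<otimes>\<^bsub>?A\<^esub> g) n \<noteq> \<zero>\<^bsub>K\<^esub>} \<subseteq> (\<lambda>(u, v). u + v) ` ({s. f s \<noteq> \<zero>\<^bsub>K\<^esub>} \<times> {s. g s \<noteq> \<zero>\<^bsub>K\<^esub>})"
      using nz by force
    then have "finite {n. (f \<otimes>\<^bsub>?A\<^esub> g) n \<noteq> \<zero>\<^bsub>K\<^esub>}"
      by (rule finite_subset) (simp add: fs_finite f g)
    moreover have "(f \<otimes>\<^bsub>?A\<^esub> g) n \<in> carrier K" for n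
      unfolding mult using fs_values f g by (intro K.finsum_closed) auto
    ultimately show ?thesis unfolding carrier_A by blast
  qed
  show ?thesis
  proof unfold_locales
    fix g assume g: "g \<in> carrier ?A"
    show "(\<lambda>f. f \<otimes>\<^bsub>?A\<^esub> g) \<in> linear_maps K ?A ?A"
    proof (rule linear_mapsI)
      fix f h assume f: "f \<in> carrier ?A" and h: "h \<in> carrier ?A"
      let ?F = "{i. f i \<noteq> \<zero>\<^bsub>K\<^esub>} \<union> {i. h i \<noteq> \<zero>\<^bsub>K\<^esub>}"
      have F: "finite ?F" using fs_finite f h by auto
      have sup: "{i. (f \<oplus>\<^bsub>?A\<^esub> h) i \<noteq> \<zero>\<^bsub>K\<^esub>} \<subseteq> ?F" by (auto simp: add_A)
      show "(f \<oplus>\<^bsub>?A\<^esub> h) \<otimes>\<^bsub>?A\<^esub> g = f \<otimes>\<^bsub>?A\<^esub> g \<oplus>\<^bsub>?A\<^esub> h \<otimes>\<^bsub>?A\<^esub> g"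
      proof
        fix n
        have "((f \<oplus>\<^bsub>?A\<^esub> h) \<otimes>\<^bsub>?A\<^esub> g) n
            = finsum K (\<lambda>i. f i \<otimes>\<^bsub>K\<^esub> g (n - i) \<oplus>\<^bsub>K\<^esub> h i \<otimes>\<^bsub>K\<^esub> g (n - i)) ?F"
          unfolding mult_superset[OF fs_add_closed[OF f h] g F sup]
          by (rule K.finsum_cong') (use fs_values f g h in \<open>auto simp: add_A K.l_distr\<close>)
        also have "\<dots> = (f \<otimes>\<^bsub>?A\<^esub> g) n \<oplus>\<^bsub>K\<^esub> (h \<otimes>\<^bsub>?A\<^esub> g) n"
          using mult_superset[OF f g F] mult_superset[OF h g F] fs_values f g h
          by (subst K.finsum_addf) auto
        finally show "((f \<oplus>\<^bsub>?A\<^esub> h) \<otimes>\<^bsub>?A\<^esub> g) n = (f \<otimes>\<^bsub>?A\<^esub> g \<oplus>\<^bsub>?A\<^esub> h \<otimes>\<^bsub>?A\<^esub> g) n"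
          by (simp add: add_A)
      qed
    next
      fix k f assume k: "k \<in> carrier K" and f: "f \<in> carrier ?A"
      have sup: "{i. (k \<odot>\<^bsub>?A\<^esub> f) i \<noteq> \<zero>\<^bsub>K\<^esub>} \<subseteq> {i. f i \<noteq> \<zero>\<^bsub>K\<^esub>}" using k by (auto simp: smult_A)
      show "(k \<odot>\<^bsub>?A\<^esub> f) \<otimes>\<^bsub>?A\<^esub> g = k \<odot>\<^bsub>?A\<^esub> (f \<otimes>\<^bsub>?A\<^esub> g)"
      proof
        fix n
        have "((k \<odot>\<^bsub>?A\<^esub> f) \<otimes>\<^bsub>?A\<^esub> g) n
            = finsum K (\<lambda>i. k \<otimes>\<^bsub>K\<^esub> (f i \<otimes>\<^bsub>K\<^esub> g (n - i))) {i. f i \<noteq> \<zero>\<^bsub>K\<^esub>}"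
          unfolding mult_superset[OF fs_smult_closed[OF k f] g fs_finite[OF f] sup]
          by (rule K.finsum_cong') (use fs_values f g k in \<open>auto simp: smult_A K.m_assoc\<close>)
        also have "\<dots> = (k \<odot>\<^bsub>?A\<^esub> (f \<otimes>\<^bsub>?A\<^esub> g)) n"
          unfolding mult smult_A
          by (rule K.finsum_rdistr[OF fs_finite[OF f] k, symmetric]) (use fs_values f g in auto)
        finally show "((k \<odot>\<^bsub>?A\<^esub> f) \<otimes>\<^bsub>?A\<^esub> g) n = (k \<odot>\<^bsub>?A\<^esub> (f \<otimes>\<^bsub>?A\<^esub> g)) n" .
      qed
    qed (rule closed[OF _ g])
  next
    fix f assume f: "f \<in> carrier ?A"
    show "(\<lambda>g. f \<otimes>\<^bsub>?A\<^esub> g) \<in> linear_maps K ?A ?A"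
    proof (rule linear_mapsI)
      fix g h assume g: "g \<in> carrier ?A" and h: "h \<in> carrier ?A"
      show "f \<otimes>\<^bsub>?A\<^esub> (g \<oplus>\<^bsub>?A\<^esub> h) = f \<otimes>\<^bsub>?A\<^esub> g \<oplus>\<^bsub>?A\<^esub> f \<otimes>\<^bsub>?A\<^esub> h"
        unfolding mult add_A by (rule ext, subst K.finsum_addf[symmetric])
          (use fs_values f g h in \<open>auto intro!: K.finsum_cong' simp: K.r_distr\<close>)
    next
      fix k g assume k: "k \<in> carrier K" and g: "g \<in> carrier ?A"
      show "f \<otimes>\<^bsub>?A\<^esub> (k \<odot>\<^bsub>?A\<^esub> g) = k \<odot>\<^bsub>?A\<^esub> (f \<otimes>\<^bsub>?A\<^esub> g)"
        unfolding mult smult_A by (rule ext, subst K.finsum_rdistr[OF fs_finite[OF f]])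
          (use fs_values f g k in \<open>auto intro!: K.finsum_cong' simp: K.m_lcomm\<close>)
    qed (rule closed[OF f])
  next
    fix s t :: int
    show "delta K s \<otimes>\<^bsub>?A\<^esub> delta K t = delta K (s + t)"
    proof
      fix n
      have "{i. delta K s i \<noteq> \<zero>\<^bsub>K\<^esub>} = {s}" by (auto simp: delta_def)
      then show "(delta K s \<otimes>\<^bsub>?A\<^esub> delta K t) n = delta K (s + t) n"
        by (auto simp: mult delta_def)
    qed
  qed auto
qed

section \<open>Leavitt path algebras by generators and relations\<close>

context nonunital_algebra
begin

lemma subgroup_of_subspace:
  assumes J: "J \<subseteq> carrier A" "\<zero>\<^bsub>A\<^esub> \<in> J"
    and add: "\<And>x y. \<lbrakk>x \<in> J; y \<in> J\<rbrakk> \<Longrightarrow> x \<oplus>\<^bsub>A\<^esub> y \<in> J"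
    and smult: "\<And>k x. \<lbrakk>k \<in> carrier K; x \<in> J\<rbrakk> \<Longrightarrow> k \<odot>\<^bsub>A\<^esub> x \<in> J"
  shows "subgroup J (add_monoid A)"
proof (rule group.subgroupI[OF M.a_group])
  fix x assume x: "x \<in> J"
  then have "\<ominus>\<^bsub>A\<^esub> x = (\<ominus>\<^bsub>K\<^esub> \<one>\<^bsub>K\<^esub>) \<odot>\<^bsub>A\<^esub> x"
    using J by (auto simp: smult_l_minus)
  then show "inv\<^bsub>add_monoid A\<^esub> x \<in> J" using smult x by (simp add: a_inv_def)
qed (use J add in auto)

end

lemma algebra_idealI:
  fixes A :: "('k, 'a) module"
  assumes A: "nonunital_algebra K A" and J: "J \<subseteq> carrier A" "\<zero>\<^bsub>A\<^esub> \<in> J"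
    and add: "\<And>x y. \<lbrakk>x \<in> J; y \<in> J\<rbrakk> \<Longrightarrow> x \<oplus>\<^bsub>A\<^esub> y \<in> J"
    and smult: "\<And>k x. \<lbrakk>k \<in> carrier K; x \<in> J\<rbrakk> \<Longrightarrow> k \<odot>\<^bsub>A\<^esub> x \<in> J"
    and mult: "\<And>a x. \<lbrakk>a \<in> carrier A; x \<in> J\<rbrakk> \<Longrightarrow> a \<otimes>\<^bsub>A\<^esub> x \<in> J"
      "\<And>a x. \<lbrakk>a \<in> carrier A; x \<in> J\<rbrakk> \<Longrightarrow> x \<otimes>\<^bsub>A\<^esub> a \<in> J"
  shows "algebra_ideal K A J"
  using nonunital_algebra.subgroup_of_subspace[OF A J add smult] smult mult
  by (auto simp: algebra_ideal_def)

text \<open>The carrier is itself an ideal containing \<open>R\<close>, so the intersection is taken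
  over a nonempty family and stays inside the algebra.\<close>

lemma algebra_ideal_ideal_generated:
  fixes A :: "('k, 'a) module"
  assumes A: "nonunital_algebra K A" and R: "R \<subseteq> carrier A"
  shows "algebra_ideal K A (ideal_generated K A R)"
proof -
  interpret A: nonunital_algebra K A by fact
  have top: "algebra_ideal K A (carrier A)"
    by (rule algebra_idealI[OF A]) (auto simp: A.mult_closed)
  define \<J> where "\<J> = {I. algebra_ideal K A I \<and> R \<subseteq> I}"
  have sub: "subgroup J (add_monoid A)" if "J \<in> \<J>" for J
    using that by (auto simp: \<J>_def algebra_ideal_def)
  have "algebra_ideal K A (\<Inter>\<J>)"
  proof (rule algebra_idealI[OF A])
    show "\<Inter>\<J> \<subseteq> carrier A" using top R by (auto simp: \<J>_def)
    show "\<zero>\<^bsub>A\<^esub> \<in> \<Inter>\<J>" using subgroup.one_closed[OF sub] by auto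
    show "x \<oplus>\<^bsub>A\<^esub> y \<in> \<Inter>\<J>" if "x \<in> \<Inter>\<J>" "y \<in> \<Inter>\<J>" for x y
      using subgroup.m_closed[OF sub] that by auto
  qed (auto simp: \<J>_def algebra_ideal_def)
  then show ?thesis by (simp add: ideal_generated_def \<J>_def)
qed

locale lpa = field K + wf_digraph E
  for K :: "('k, 'x) ring_scheme" (structure) and E :: "('v, 'e) pre_digraph"
begin

abbreviation free where "free \<equiv> lpa_free K E"
abbreviation relations_ideal where "relations_ideal \<equiv> ideal_generated K free (lpa_relations K E)"
abbreviation L where "L \<equiv> leavitt_path_algebra K E"

definition gen :: "('v, 'e) lpa_gen \<Rightarrow> (('v, 'e) lpa_gen list \<Rightarrow> 'k) set" where
  "gen g = relations_ideal +>\<^bsub>free\<^esub> word_elem K [g]"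

sublocale free: fs_algebra K "{w. w \<noteq> [] \<and> set w \<subseteq> lpa_gens E}" free "(@)"
  unfolding lpa_free_def by (rule fs_algebra_free) (rule field_axioms)

lemma word_closed: "\<lbrakk>w \<noteq> []; set w \<subseteq> lpa_gens E\<rbrakk> \<Longrightarrow> word_elem K w \<in> carrier free"
  using free.delta_closed by (simp add: word_elem_eq_delta)

lemma gens_intros [simp]:
  "v \<in> verts E \<Longrightarrow> Vertex v \<in> lpa_gens E"
  "e \<in> arcs E \<Longrightarrow> Edge e \<in> lpa_gens E"
  "e \<in> arcs E \<Longrightarrow> Ghost e \<in> lpa_gens E"
  by (auto simp: lpa_gens_def)

lemma relations_closed: "lpa_relations K E \<subseteq> carrier free"
proof
  interpret F: nonunital_algebra K free by (rule free.fs_is_algebra)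
  fix x assume "x \<in> lpa_relations K E"
  then show "x \<in> carrier free"
    by cases (auto intro!: F.M.minus_closed F.M.finsum_closed word_closed)
qed

sublocale quot: algebra_with_ideal K free relations_ideal
  by (intro algebra_with_ideal.intro algebra_with_ideal_axioms.intro free.fs_is_algebra
      algebra_ideal_ideal_generated relations_closed)

lemma L_eq: "L = quotient_algebra free relations_ideal"
  by (simp add: leavitt_path_algebra_def)

sublocale L: nonunital_algebra K L
  unfolding L_eq by (rule quot.quotient_nonunital_algebra)

lemma relation_in_ideal: "x \<in> lpa_relations K E \<Longrightarrow> x \<in> relations_ideal"
  by (auto simp: ideal_generated_def)

lemma gen_closed: "g \<in> lpa_gens E \<Longrightarrow> gen g \<in> carrier L"
  by (auto simp: gen_def L_eq quot.carrier_quotient word_closed)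

lemma coset_word2: "\<lbrakk>g \<in> lpa_gens E; h \<in> lpa_gens E\<rbrakk>
    \<Longrightarrow> relations_ideal +>\<^bsub>free\<^esub> word_elem K [g, h] = gen g \<otimes>\<^bsub>L\<^esub> gen h"
  using free.delta_mult[of "[g]" "[h]"]
  by (simp add: gen_def L_eq quot.mult_quotient word_closed word_elem_eq_delta free.delta_closed)

lemma coset_zero_L: "relations_ideal +>\<^bsub>free\<^esub> \<zero>\<^bsub>free\<^esub> = \<zero>\<^bsub>L\<^esub>"
  by (simp add: L_eq quot.zero_quotient)

lemma vertex_mult: "\<lbrakk>v \<in> verts E; w \<in> verts E\<rbrakk>
    \<Longrightarrow> gen (Vertex v) \<otimes>\<^bsub>L\<^esub> gen (Vertex w) = (if v = w then gen (Vertex w) else \<zero>\<^bsub>L\<^esub>)"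
  using quot.coset_diff[OF relation_in_ideal[OF lpa_relations.vertices], of v w]
  by (cases "v = w") (simp_all add: coset_word2 word_closed gen_def[symmetric] coset_zero_L)

lemma source_mult: "e \<in> arcs E \<Longrightarrow> gen (Vertex (tail E e)) \<otimes>\<^bsub>L\<^esub> gen (Edge e) = gen (Edge e)"
  using quot.coset_diff[OF relation_in_ideal[OF lpa_relations.source], of e]
  by (simp add: coset_word2 word_closed gen_def[symmetric])

lemma range_mult: "e \<in> arcs E \<Longrightarrow> gen (Edge e) \<otimes>\<^bsub>L\<^esub> gen (Vertex (head E e)) = gen (Edge e)"
  using quot.coset_diff[OF relation_in_ideal[OF lpa_relations.range], of e]
  by (simp add: coset_word2 word_closed gen_def[symmetric])

lemma ghost_source_mult: "e \<in> arcs E \<Longrightarrow> gen (Vertex (head E e)) \<otimes>\<^bsub>L\<^esub> gen (Ghost e) = gen (Ghost e)"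
  using quot.coset_diff[OF relation_in_ideal[OF lpa_relations.ghost_source], of e]
  by (simp add: coset_word2 word_closed gen_def[symmetric])

lemma ghost_range_mult: "e \<in> arcs E \<Longrightarrow> gen (Ghost e) \<otimes>\<^bsub>L\<^esub> gen (Vertex (tail E e)) = gen (Ghost e)"
  using quot.coset_diff[OF relation_in_ideal[OF lpa_relations.ghost_range], of e]
  by (simp add: coset_word2 word_closed gen_def[symmetric])

lemma CK1_mult: "\<lbrakk>e \<in> arcs E; f \<in> arcs E\<rbrakk>
    \<Longrightarrow> gen (Ghost e) \<otimes>\<^bsub>L\<^esub> gen (Edge f) = (if e = f then gen (Vertex (head E e)) else \<zero>\<^bsub>L\<^esub>)"
  using quot.coset_diff[OF relation_in_ideal[OF lpa_relations.CK1], of e f]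
  by (cases "e = f") (simp_all add: coset_word2 word_closed gen_def[symmetric] coset_zero_L)

lemma CK2_sum:
  assumes v: "v \<in> verts E" "out_arcs E v \<noteq> {}" "finite (out_arcs E v)"
  shows "gen (Vertex v) = finsum L (\<lambda>e. gen (Edge e) \<otimes>\<^bsub>L\<^esub> gen (Ghost e)) (out_arcs E v)"
proof -
  let ?s = "finsum free (\<lambda>e. word_elem K [Edge e, Ghost e]) (out_arcs E v)"
  have "?s \<in> carrier free" by (auto intro!: quot.M.finsum_closed word_closed)
  then have "gen (Vertex v) = relations_ideal +>\<^bsub>free\<^esub> ?s"
    using quot.coset_diff[OF relation_in_ideal[OF lpa_relations.CK2[OF v]]] v
    by (simp add: word_closed gen_def)
  also have "\<dots> = finsum L (\<lambda>e. relations_ideal +>\<^bsub>free\<^esub> word_elem K [Edge e, Ghost e]) (out_arcs E v)"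
    unfolding L_eq
    by (rule linear_maps_finsum[OF quot.coset_linear quot.is_module])
      (auto intro!: word_closed nonunital_algebra.is_module quot.quotient_nonunital_algebra)
  also have "\<dots> = finsum L (\<lambda>e. gen (Edge e) \<otimes>\<^bsub>L\<^esub> gen (Ghost e)) (out_arcs E v)"
    by (rule L.M.finsum_cong') (auto simp: coset_word2 L.mult_closed gen_closed)
  finally show ?thesis .
qed

text \<open>The coset of a word is the product of the cosets of its letters, and every element of
  the free algebra is a linear combination of words.\<close>

lemma L_induct [consumes 1, case_names gen mult add smult zero]:
  assumes x: "x \<in> carrier L"
    and gen: "\<And>g. g \<in> lpa_gens E \<Longrightarrow> P (gen g)"
    and mult: "\<And>x y. \<lbrakk>x \<in> carrier L; y \<in> carrier L; P x; P y\<rbrakk> \<Longrightarrow> P (x \<otimes>\<^bsub>L\<^esub> y)"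
    and add: "\<And>x y. \<lbrakk>x \<in> carrier L; y \<in> carrier L; P x; P y\<rbrakk> \<Longrightarrow> P (x \<oplus>\<^bsub>L\<^esub> y)"
    and smult: "\<And>k x. \<lbrakk>k \<in> carrier K; x \<in> carrier L; P x\<rbrakk> \<Longrightarrow> P (k \<odot>\<^bsub>L\<^esub> x)"
    and zero: "P \<zero>\<^bsub>L\<^esub>"
  shows "P x"
proof -
  let ?\<pi> = "\<lambda>a. relations_ideal +>\<^bsub>free\<^esub> a"
  have cl: "?\<pi> a \<in> carrier L" if "a \<in> carrier free" for a
    using that by (auto simp: L_eq quot.carrier_quotient)
  have word: "P (?\<pi> (word_elem K w))" if "w \<noteq> []" "set w \<subseteq> lpa_gens E" for w
    using that
  proof (induction w rule: list_nonempty_induct)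
    case (single g)
    then show ?case using gen by (simp add: gen_def)
  next
    case (cons g w)
    then have "?\<pi> (word_elem K (g # w)) = gen g \<otimes>\<^bsub>L\<^esub> ?\<pi> (word_elem K w)"
      using free.delta_mult[of "[g]" w]
      by (simp add: gen_def L_eq quot.mult_quotient word_closed word_elem_eq_delta free.delta_closed)
    then show ?case using cons mult gen gen_closed cl word_closed by simp
  qed
  obtain a where a: "a \<in> carrier free" "x = ?\<pi> a"
    using x by (auto simp: L_eq quot.carrier_quotient)
  have "P (?\<pi> a)" using a(1)
  proof (induction rule: free.fs_induct)
    case zero
    then show ?case using assms(6) by (simp add: L_eq quot.zero_quotient)
  next
    case (add f k s)
    then have ks: "k \<odot>\<^bsub>free\<^esub> word_elem K s \<in> carrier free" "word_elem K s \<in> carrier free"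
      by (auto intro!: free.fs_smult_closed word_closed)
    have "?\<pi> (f \<oplus>\<^bsub>free\<^esub> k \<odot>\<^bsub>free\<^esub> word_elem K s) = ?\<pi> f \<oplus>\<^bsub>L\<^esub> k \<odot>\<^bsub>L\<^esub> ?\<pi> (word_elem K s)"
      using add ks by (simp add: L_eq quot.add_quotient quot.smult_quotient)
    moreover have "P (?\<pi> (word_elem K s))" using word add by auto
    ultimately show ?case
      using add ks cl smult assms(4) by (simp add: word_elem_eq_delta)
  qed
  then show ?thesis using a by simp
qed

text \<open>The universal property of the presentation, for operators on a vector space. As the
  operators act from the right, the relation for a word g h is a condition on
  \<open>\<rho> h (\<rho> g m)\<close>.\<close>

lemma right_module_exists:
  fixes M :: "('k, 'm, 'y) module_scheme" and \<rho> :: "('v, 'e) lpa_gen \<Rightarrow> 'm \<Rightarrow> 'm"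
  assumes M: "Module.module K M" and \<rho>: "\<And>g. g \<in> lpa_gens E \<Longrightarrow> \<rho> g \<in> linear_maps K M M"
    and vertices: "\<And>m v w. \<lbrakk>m \<in> carrier M; v \<in> verts E; w \<in> verts E\<rbrakk>
      \<Longrightarrow> \<rho> (Vertex w) (\<rho> (Vertex v) m) = (if v = w then \<rho> (Vertex w) m else \<zero>\<^bsub>M\<^esub>)"
    and source: "\<And>m e. \<lbrakk>m \<in> carrier M; e \<in> arcs E\<rbrakk>
      \<Longrightarrow> \<rho> (Edge e) (\<rho> (Vertex (tail E e)) m) = \<rho> (Edge e) m"
    and range: "\<And>m e. \<lbrakk>m \<in> carrier M; e \<in> arcs E\<rbrakk>
      \<Longrightarrow> \<rho> (Vertex (head E e)) (\<rho> (Edge e) m) = \<rho> (Edge e) m"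
    and ghost_source: "\<And>m e. \<lbrakk>m \<in> carrier M; e \<in> arcs E\<rbrakk>
      \<Longrightarrow> \<rho> (Ghost e) (\<rho> (Vertex (head E e)) m) = \<rho> (Ghost e) m"
    and ghost_range: "\<And>m e. \<lbrakk>m \<in> carrier M; e \<in> arcs E\<rbrakk>
      \<Longrightarrow> \<rho> (Vertex (tail E e)) (\<rho> (Ghost e) m) = \<rho> (Ghost e) m"
    and CK1: "\<And>m e f. \<lbrakk>m \<in> carrier M; e \<in> arcs E; f \<in> arcs E\<rbrakk>
      \<Longrightarrow> \<rho> (Edge f) (\<rho> (Ghost e) m) = (if e = f then \<rho> (Vertex (head E e)) m else \<zero>\<^bsub>M\<^esub>)"
    and CK2: "\<And>m v. \<lbrakk>m \<in> carrier M; v \<in> verts E; out_arcs E v \<noteq> {}; finite (out_arcs E v)\<rbrakk>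
      \<Longrightarrow> \<rho> (Vertex v) m = finsum M (\<lambda>e. \<rho> (Ghost e) (\<rho> (Edge e) m)) (out_arcs E v)"
  obtains N :: "('k, (('v, 'e) lpa_gen list \<Rightarrow> 'k) set, 'm) rmodule"
  where "right_module K L N" "carrier N = carrier M" "add N = add M" "smult N = smult M"
    "\<zero>\<^bsub>N\<^esub> = \<zero>\<^bsub>M\<^esub>" "\<And>m g. \<lbrakk>m \<in> carrier M; g \<in> lpa_gens E\<rbrakk> \<Longrightarrow> act N m (gen g) = \<rho> g m"
proof -
  \<comment> \<open>\<open>fold \<rho> w\<close> applies the operator of the first letter first,
    which is the order of a right action.\<close>
  define M' :: "('k, ('v, 'e) lpa_gen list \<Rightarrow> 'k, 'm) rmodule" where
    "M' = \<lparr>carrier = carrier M, mult = undefined, one = undefined, zero = \<zero>\<^bsub>M\<^esub>, add = add M,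
      smult = smult M, act = (\<lambda>m f. lin_ext K M (\<lambda>w. fold \<rho> w m) f)\<rparr>"
  have M'_eq: "carrier M' = carrier M" "add M' = add M" "smult M' = smult M" "\<zero>\<^bsub>M'\<^esub> = \<zero>\<^bsub>M\<^esub>"
    by (simp_all add: M'_def)
  have M': "Module.module K M'"
    by (rule module_surjective_image[OF M, of _ "\<lambda>m. m"]) (auto simp: M'_eq)
  have lin_eq: "linear_maps K M' M' = linear_maps K M M"
    by (simp add: linear_maps_def M'_eq)
  have ops: "fold \<rho> w \<in> linear_maps K M M" if "set w \<subseteq> lpa_gens E" for w
    using that
  proof (induction w)
    case Nil
    then show ?case by (simp add: linear_maps_def)
  next
    case (Cons g w)
    then show ?case using linear_maps_comp[OF \<rho>[of g], of "fold \<rho> w"] by (simp add: comp_def)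
  qed
  have "right_module K free M'"
  proof (rule free.lin_ext_right_module[OF M', where \<rho> = "fold \<rho>"])
    fix m f
    have *: "lin_ext K M' = lin_ext K M"
      by (simp add: lin_ext_def M'_eq finsum_def finprod_def fun_eq_iff)
    show "act M' m f = lin_ext K M' (\<lambda>s. fold \<rho> s m) f" unfolding * by (simp add: M'_def)
  qed (auto simp: lin_eq ops)
  then interpret M': right_module K free M' .
  have act_word: "act M' m (word_elem K w) = fold \<rho> w m"
    if "m \<in> carrier M" "w \<noteq> []" "set w \<subseteq> lpa_gens E" for m w
    using that free.lin_ext_delta[OF M, of "\<lambda>w. fold \<rho> w m" w] linear_maps_closed[OF ops]
    by (simp add: M'_def word_elem_eq_delta)
  \<comment> \<open>The annihilator of the representation of the free algebra. It is a two-sided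
    ideal, so once it contains the relations it contains the ideal that they generate.\<close>
  define J where "J = {x \<in> carrier free. \<forall>m\<in>carrier M. act M' m x = \<zero>\<^bsub>M\<^esub>}"
  have J: "algebra_ideal K free J"
  proof (rule algebra_idealI[OF free.fs_is_algebra])
    show "\<zero>\<^bsub>free\<^esub> \<in> J" using M'.act_zero_right by (simp add: J_def M'_eq)
    show "x \<oplus>\<^bsub>free\<^esub> y \<in> J" if "x \<in> J" "y \<in> J" for x y
      using that M'.act_add_right M'.vs.M.zero_closed M'.vs.M.r_zero by (auto simp: J_def M'_eq free.fs_add_closed)
    show "k \<odot>\<^bsub>free\<^esub> x \<in> J" if "k \<in> carrier K" "x \<in> J" for k x
      using that M'.act_smult_right M'.vs.smult_r_null
      by (auto simp: J_def M'_eq free.fs_smult_closed)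
    fix a x assume a: "a \<in> carrier free" and x: "x \<in> J"
    show "a \<otimes>\<^bsub>free\<^esub> x \<in> J"
      using a x M'.act_mult M'.act_closed by (auto simp: J_def M'_eq free.fs_mult_closed)
    show "x \<otimes>\<^bsub>free\<^esub> a \<in> J"
      using a x M'.act_mult M'.act_zero_left by (auto simp: J_def M'_eq free.fs_mult_closed)
  qed (auto simp: J_def)
  have diff: "x \<ominus>\<^bsub>free\<^esub> y \<in> J"
    if xy: "x \<in> carrier free" "y \<in> carrier free"
      and eq: "\<And>m. m \<in> carrier M \<Longrightarrow> act M' m x = act M' m y" for x y
  proof -
    have "act M' m (x \<ominus>\<^bsub>free\<^esub> y) = \<zero>\<^bsub>M\<^esub>" if m: "m \<in> carrier M" for m
    proof -
      have "act M' m x = act M' m ((x \<ominus>\<^bsub>free\<^esub> y) \<oplus>\<^bsub>free\<^esub> y)"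
        using xy by (simp add: a_minus_def quot.M.a_assoc quot.M.l_neg)
      also have "\<dots> = act M' m (x \<ominus>\<^bsub>free\<^esub> y) \<oplus>\<^bsub>M'\<^esub> act M' m y"
        using m xy by (intro M'.act_add_right) (auto simp: M'_eq)
      finally have *: "act M' m y = act M' m (x \<ominus>\<^bsub>free\<^esub> y) \<oplus>\<^bsub>M'\<^esub> act M' m y"
        unfolding eq[OF m] .
      have cl: "act M' m y \<in> carrier M'" "act M' m (x \<ominus>\<^bsub>free\<^esub> y) \<in> carrier M'"
        using m xy M'.act_closed by (simp_all add: M'_eq)
      have "act M' m (x \<ominus>\<^bsub>free\<^esub> y) = \<zero>\<^bsub>M'\<^esub>"
        by (rule iffD1[OF M'.vs.M.add.r_cancel_one'[OF cl] *])
      then show ?thesis by (simp only: M'_eq)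
    qed
    then show ?thesis using xy by (simp add: J_def)
  qed
  have zero_act: "act M' m \<zero>\<^bsub>free\<^esub> = \<zero>\<^bsub>M\<^esub>" if "m \<in> carrier M" for m
    using M'.act_zero_right that by (simp add: M'_eq)
  have "lpa_relations K E \<subseteq> J"
  proof
    fix x assume "x \<in> lpa_relations K E"
    then show "x \<in> J"
    proof cases
      case (vertices v w)
      then show ?thesis
        by (auto intro!: diff word_closed simp: act_word zero_act assms(3))
    next
      case (CK1 e f)
      then show ?thesis
        by (auto intro!: diff word_closed simp: act_word zero_act assms(8))
    next
      case (CK2 v)
      have "act M' m (finsum free (\<lambda>e. word_elem K [Edge e, Ghost e]) (out_arcs E v))
          = finsum M' (\<lambda>e. act M' m (word_elem K [Edge e, Ghost e])) (out_arcs E v)"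
        if "m \<in> carrier M" for m
        using that by (intro M'.act_finsum_right) (auto simp: M'_eq intro!: word_closed)
      moreover have "finsum M' (\<lambda>e. act M' m (word_elem K [Edge e, Ghost e])) (out_arcs E v)
          = finsum M (\<lambda>e. \<rho> (Ghost e) (\<rho> (Edge e) m)) (out_arcs E v)" if m: "m \<in> carrier M" for m
      proof -
        have "finsum M' (\<lambda>e. act M' m (word_elem K [Edge e, Ghost e])) (out_arcs E v)
            = finsum M' (\<lambda>e. \<rho> (Ghost e) (\<rho> (Edge e) m)) (out_arcs E v)"
          by (rule M'.vs.M.finsum_cong')
            (use m linear_maps_closed[OF \<rho>] in \<open>auto simp: act_word M'_eq\<close>)
        then show ?thesis by (simp add: finsum_def finprod_def M'_eq)
      qed
      ultimately show ?thesis unfolding CK2(1)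
        using CK2 assms(9)
        by (intro diff) (auto intro!: word_closed quot.M.finsum_closed simp: act_word)
    qed (auto intro!: diff word_closed simp: act_word assms)
  qed
  then have ann: "relations_ideal \<subseteq> J" using J by (auto simp: ideal_generated_def)
  obtain N :: "('k, (('v, 'e) lpa_gen list \<Rightarrow> 'k) set, 'm) rmodule"
    where N: "right_module K (quotient_algebra free relations_ideal) N" "carrier N = carrier M'"
      "add N = add M'" "smult N = smult M'" "\<zero>\<^bsub>N\<^esub> = \<zero>\<^bsub>M'\<^esub>"
      and act: "\<And>m a. \<lbrakk>m \<in> carrier M'; a \<in> carrier free\<rbrakk>
        \<Longrightarrow> act N m (relations_ideal +>\<^bsub>free\<^esub> a) = act M' m a"
    using quot.right_module_quotient[OF M'.right_module_axioms] ann by (auto simp: J_def M'_eq)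
  show ?thesis
  proof (rule that[of N])
    show "act N m (gen g) = \<rho> g m" if "m \<in> carrier M" "g \<in> lpa_gens E" for m g
      using that act by (simp add: gen_def M'_eq word_closed act_word)
  qed (use N in \<open>simp_all add: L_eq M'_eq\<close>)
qed

end

section \<open>Equivalences from fully faithful and essentially surjective functors\<close>

locale ff_es_functor = cat_functor C D Fo Fm
  for C :: "('o, 'm) cat" and D :: "('p, 'n) cat"
    and Fo :: "'o \<Rightarrow> 'p" and Fm :: "'o \<Rightarrow> 'o \<Rightarrow> 'm \<Rightarrow> 'n" +
  assumes fully_faithful: "\<lbrakk>X \<in> Obj C; Y \<in> Obj C\<rbrakk>
      \<Longrightarrow> bij_betw (Fm X Y) (Hom C X Y) (Hom D (Fo X) (Fo Y))"
    and ess_surj: "Z \<in> Obj D \<Longrightarrow> \<exists>X\<in>Obj C. \<exists>f. iso_morphism D (Fo X) Z f"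
begin

definition G :: "'p \<Rightarrow> 'o" where
  "G Y = (SOME X. X \<in> Obj C \<and> (\<exists>f. iso_morphism D (Fo X) Y f))"

definition counit :: "'p \<Rightarrow> 'n" where
  "counit Y = (SOME f. iso_morphism D (Fo (G Y)) Y f)"

definition counit_inv :: "'p \<Rightarrow> 'n" where
  "counit_inv Y = (SOME g. g \<in> Hom D Y (Fo (G Y)) \<and>
     Cmp D (Fo (G Y)) Y (Fo (G Y)) g (counit Y) = Idn D (Fo (G Y)) \<and>
     Cmp D Y (Fo (G Y)) Y (counit Y) g = Idn D Y)"

definition lift :: "'o \<Rightarrow> 'o \<Rightarrow> 'n \<Rightarrow> 'm" where
  "lift X Y k = inv_into (Hom C X Y) (Fm X Y) k"

text \<open>Naturality of the counit leaves exactly this candidate for the image under F of the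
  morphism that the quasi-inverse assigns to \<open>g\<close>. \<open>Gm\<close> is then its unique
  preimage under \<open>Fm\<close>.\<close>

definition conj :: "'p \<Rightarrow> 'p \<Rightarrow> 'n \<Rightarrow> 'n" where
  "conj Y Z g = Cmp D (Fo (G Y)) Z (Fo (G Z)) (counit_inv Z) (Cmp D (Fo (G Y)) Y Z g (counit Y))"

definition Gm :: "'p \<Rightarrow> 'p \<Rightarrow> 'n \<Rightarrow> 'm" where
  "Gm Y Z g = lift (G Y) (G Z) (conj Y Z g)"

lemma G_counit:
  assumes "Y \<in> Obj D"
  shows G_in_Obj: "G Y \<in> Obj C" and counit_iso: "iso_morphism D (Fo (G Y)) Y (counit Y)"
proof -
  have "G Y \<in> Obj C \<and> (\<exists>f. iso_morphism D (Fo (G Y)) Y f)"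
    unfolding G_def by (rule someI_ex) (use ess_surj[OF assms] in blast)
  then show "G Y \<in> Obj C" "iso_morphism D (Fo (G Y)) Y (counit Y)"
    unfolding counit_def by (auto intro: someI_ex)
qed

lemma counit_facts:
  assumes "Y \<in> Obj D"
  shows "counit Y \<in> Hom D (Fo (G Y)) Y" "counit_inv Y \<in> Hom D Y (Fo (G Y))"
    "Cmp D (Fo (G Y)) Y (Fo (G Y)) (counit_inv Y) (counit Y) = Idn D (Fo (G Y))"
    "Cmp D Y (Fo (G Y)) Y (counit Y) (counit_inv Y) = Idn D Y"
proof -
  have "counit_inv Y \<in> Hom D Y (Fo (G Y)) \<and>
     Cmp D (Fo (G Y)) Y (Fo (G Y)) (counit_inv Y) (counit Y) = Idn D (Fo (G Y)) \<and>
     Cmp D Y (Fo (G Y)) Y (counit Y) (counit_inv Y) = Idn D Y"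
    unfolding counit_inv_def by (rule someI_ex) (use counit_iso[OF assms] in \<open>auto simp: iso_morphism_def\<close>)
  then show "counit Y \<in> Hom D (Fo (G Y)) Y" "counit_inv Y \<in> Hom D Y (Fo (G Y))"
    "Cmp D (Fo (G Y)) Y (Fo (G Y)) (counit_inv Y) (counit Y) = Idn D (Fo (G Y))"
    "Cmp D Y (Fo (G Y)) Y (counit Y) (counit_inv Y) = Idn D Y"
    using counit_iso[OF assms] by (auto simp: iso_morphism_def)
qed

lemma lift_in_Hom: "\<lbrakk>X \<in> Obj C; Y \<in> Obj C; k \<in> Hom D (Fo X) (Fo Y)\<rbrakk> \<Longrightarrow> lift X Y k \<in> Hom C X Y"
  unfolding lift_def using fully_faithful[of X Y] by (metis bij_betw_imp_surj_on inv_into_into)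

lemma Fm_lift: "\<lbrakk>X \<in> Obj C; Y \<in> Obj C; k \<in> Hom D (Fo X) (Fo Y)\<rbrakk> \<Longrightarrow> Fm X Y (lift X Y k) = k"
  unfolding lift_def using fully_faithful[of X Y] by (metis bij_betw_inv_into_right)

lemma Fm_inject: "\<lbrakk>X \<in> Obj C; Y \<in> Obj C; f \<in> Hom C X Y; g \<in> Hom C X Y; Fm X Y f = Fm X Y g\<rbrakk> \<Longrightarrow> f = g"
  using fully_faithful[of X Y] by (metis bij_betw_inv_into_left)

lemma FG_in_Obj: "Y \<in> Obj D \<Longrightarrow> Fo (G Y) \<in> Obj D"
  by (simp add: Fo_in_Obj G_in_Obj)

lemma conj_in_Hom: "\<lbrakk>Y \<in> Obj D; Z \<in> Obj D; g \<in> Hom D Y Z\<rbrakk>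
    \<Longrightarrow> conj Y Z g \<in> Hom D (Fo (G Y)) (Fo (G Z))"
  unfolding conj_def using counit_facts FG_in_Obj by (meson tgt.Cmp_in_Hom)

lemma counit_conj:
  assumes Y: "Y \<in> Obj D" and Z: "Z \<in> Obj D" and g: "g \<in> Hom D Y Z"
  shows "Cmp D (Fo (G Y)) (Fo (G Z)) Z (counit Z) (conj Y Z g) = Cmp D (Fo (G Y)) Y Z g (counit Y)"
proof -
  note o = Y Z FG_in_Obj[OF Y] FG_in_Obj[OF Z]
  have ge: "Cmp D (Fo (G Y)) Y Z g (counit Y) \<in> Hom D (Fo (G Y)) Z"
    using counit_facts[OF Y] o g by (meson tgt.Cmp_in_Hom)
  then show ?thesis unfolding conj_def
    using tgt.Cmp_assoc[OF o(3) Z o(4) Z ge counit_facts(2,1)[OF Z]] counit_facts(4)[OF Z]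
      tgt.Cmp_Idn_left[OF o(3) Z ge] by simp
qed

lemma conj_counit_inv:
  assumes Y: "Y \<in> Obj D" and Z: "Z \<in> Obj D" and g: "g \<in> Hom D Y Z"
  shows "Cmp D Y (Fo (G Y)) (Fo (G Z)) (conj Y Z g) (counit_inv Y) = Cmp D Y Z (Fo (G Z)) (counit_inv Z) g"
proof -
  note o = Y Z FG_in_Obj[OF Y] FG_in_Obj[OF Z]
  have ge: "Cmp D (Fo (G Y)) Y Z g (counit Y) \<in> Hom D (Fo (G Y)) Z"
    using counit_facts[OF Y] o g by (meson tgt.Cmp_in_Hom)
  have "Cmp D Y (Fo (G Y)) Z (Cmp D (Fo (G Y)) Y Z g (counit Y)) (counit_inv Y) = g"
    using tgt.Cmp_assoc[OF Y o(3) Y Z counit_facts(2,1)[OF Y] g] counit_facts(4)[OF Y]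
      tgt.Cmp_Idn_right[OF Y Z g] by simp
  then show ?thesis unfolding conj_def
    using tgt.Cmp_assoc[OF Y o(3) Z o(4) counit_facts(2)[OF Y] ge counit_facts(2)[OF Z]] by simp
qed

lemma conj_Idn: "Y \<in> Obj D \<Longrightarrow> conj Y Y (Idn D Y) = Idn D (Fo (G Y))"
  unfolding conj_def using counit_facts[of Y] tgt.Cmp_Idn_left FG_in_Obj by simp

lemma conj_Cmp:
  assumes Y: "Y \<in> Obj D" and Z: "Z \<in> Obj D" and W: "W \<in> Obj D"
    and g: "g \<in> Hom D Y Z" and h: "h \<in> Hom D Z W"
  shows "conj Y W (Cmp D Y Z W h g)
    = Cmp D (Fo (G Y)) (Fo (G Z)) (Fo (G W)) (conj Z W h) (conj Y Z g)"
proof -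
  let ?Y = "Fo (G Y)" and ?Z = "Fo (G Z)" and ?W = "Fo (G W)"
  note o = FG_in_Obj[OF Y] FG_in_Obj[OF Z] FG_in_Obj[OF W]
  have he: "Cmp D ?Z Z W h (counit Z) \<in> Hom D ?Z W"
    using counit_facts[OF Z] o Z W h by (meson tgt.Cmp_in_Hom)
  note cg = conj_in_Hom[OF Y Z g]
  have "Cmp D ?Y ?Z ?W (conj Z W h) (conj Y Z g)
      = Cmp D ?Y W ?W (counit_inv W) (Cmp D ?Y ?Z W (Cmp D ?Z Z W h (counit Z)) (conj Y Z g))"
    unfolding conj_def[of Z W]
    using tgt.Cmp_assoc[OF o(1,2) W o(3) cg he counit_facts(2)[OF W]] by simp
  also have "Cmp D ?Y ?Z W (Cmp D ?Z Z W h (counit Z)) (conj Y Z g)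
      = Cmp D ?Y Z W h (Cmp D ?Y ?Z Z (counit Z) (conj Y Z g))"
    using tgt.Cmp_assoc[OF o(1,2) Z W cg counit_facts(1)[OF Z] h] by simp
  also have "\<dots> = Cmp D ?Y Y W (Cmp D Y Z W h g) (counit Y)"
    unfolding counit_conj[OF Y Z g]
    using tgt.Cmp_assoc[OF o(1) Y Z W counit_facts(1)[OF Y] g h] by simp
  finally show ?thesis by (simp add: conj_def)
qed

text \<open>\<open>Fm\<close> is injective on Hom sets, so each equation between morphisms of
  \<open>C\<close> is tested after applying it, where it becomes an identity for
  \<open>conj\<close>.\<close>

lemma G_functor: "cat_functor D C G Gm"
proof (intro cat_functor.intro cat_functor_axioms.intro)
  show "category D" "category C" by unfold_locales
  fix Y Z assume Y: "Y \<in> Obj D"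
  show "G Y \<in> Obj C" by (rule G_in_Obj[OF Y])
  show "Gm Y Y (Idn D Y) = Idn C (G Y)"
    by (rule Fm_inject[OF G_in_Obj[OF Y] G_in_Obj[OF Y]])
      (use Y in \<open>simp_all add: Gm_def lift_in_Hom Fm_lift G_in_Obj conj_Idn Fm_Idn
        src.Idn_in_Hom tgt.Idn_in_Hom FG_in_Obj\<close>)
  assume Z: "Z \<in> Obj D"
  {
    fix g assume g: "g \<in> Hom D Y Z"
    show "Gm Y Z g \<in> Hom C (G Y) (G Z)"
      using Y Z g by (simp add: Gm_def lift_in_Hom G_in_Obj conj_in_Hom)
    fix W h assume W: "W \<in> Obj D" and h: "h \<in> Hom D Z W"
    note o = G_in_Obj[OF Y] G_in_Obj[OF Z] G_in_Obj[OF W]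
    have hg: "Cmp D Y Z W h g \<in> Hom D Y W" using Y Z W g h by (rule tgt.Cmp_in_Hom)
    have l: "lift (G Y) (G Z) (conj Y Z g) \<in> Hom C (G Y) (G Z)"
      "lift (G Z) (G W) (conj Z W h) \<in> Hom C (G Z) (G W)"
      "lift (G Y) (G W) (conj Y W (Cmp D Y Z W h g)) \<in> Hom C (G Y) (G W)"
      using o conj_in_Hom[OF Y Z g] conj_in_Hom[OF Z W h] conj_in_Hom[OF Y W hg]
      by (simp_all add: lift_in_Hom)
    show "Gm Y W (Cmp D Y Z W h g) = Cmp C (G Y) (G Z) (G W) (Gm Z W h) (Gm Y Z g)"
      unfolding Gm_def
    proof (rule Fm_inject[OF o(1,3) l(3)])
      show "Cmp C (G Y) (G Z) (G W) (lift (G Z) (G W) (conj Z W h)) (lift (G Y) (G Z) (conj Y Z g))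
          \<in> Hom C (G Y) (G W)"
        using o l by (meson src.Cmp_in_Hom)
      show "Fm (G Y) (G W) (lift (G Y) (G W) (conj Y W (Cmp D Y Z W h g))) = Fm (G Y) (G W)
          (Cmp C (G Y) (G Z) (G W) (lift (G Z) (G W) (conj Z W h)) (lift (G Y) (G Z) (conj Y Z g)))"
        using Fm_Cmp[OF o l(1,2)] o conj_in_Hom[OF Y Z g] conj_in_Hom[OF Z W h] conj_in_Hom[OF Y W hg]
        by (simp add: Fm_lift conj_Cmp[OF Y Z W g h])
    qed
  }
qed

lemma equivalent: "equivalent_cats C D"
proof -
  \<comment> \<open>The unit at \<open>X\<close> is the preimage of the inverse counit at
    \<open>Fo X\<close>. Invertibility and naturality are again verified after applying
    \<open>Fm\<close>.\<close>
  define \<eta> where "\<eta> X = lift X (G (Fo X)) (counit_inv (Fo X))" for X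
  have unit: "natural_iso C C (\<lambda>X. X) (\<lambda>X Y f. f) (\<lambda>X. G (Fo X)) (\<lambda>X Y f. Gm (Fo X) (Fo Y) (Fm X Y f)) \<eta>"
    unfolding natural_iso_def
  proof (intro conjI ballI)
    fix X assume X: "X \<in> Obj C"
    note F = Fo_in_Obj[OF X]
    note o = X G_in_Obj[OF F] F FG_in_Obj[OF F]
    note c = counit_facts[OF F]
    define \<eta>' where "\<eta>' = lift (G (Fo X)) X (counit (Fo X))"
    have h: "\<eta> X \<in> Hom C X (G (Fo X))" "\<eta>' \<in> Hom C (G (Fo X)) X"
      unfolding \<eta>_def \<eta>'_def using o c by (simp_all add: lift_in_Hom)
    have Fh: "Fm X (G (Fo X)) (\<eta> X) = counit_inv (Fo X)" "Fm (G (Fo X)) X \<eta>' = counit (Fo X)"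
      unfolding \<eta>_def \<eta>'_def using o c by (simp_all add: Fm_lift)
    have "Cmp C X (G (Fo X)) X \<eta>' (\<eta> X) = Idn C X"
      by (rule Fm_inject[OF X X]) (use o c h Fh Fm_Cmp[OF o(1,2,1) h] in
        \<open>simp_all add: src.Cmp_in_Hom[OF o(1,2,1) h] src.Idn_in_Hom Fm_Idn\<close>)
    moreover have "Cmp C (G (Fo X)) X (G (Fo X)) (\<eta> X) \<eta>' = Idn C (G (Fo X))"
      by (rule Fm_inject[OF o(2,2)]) (use o c h Fh Fm_Cmp[OF o(2,1,2) h(2,1)] in
        \<open>simp_all add: src.Cmp_in_Hom[OF o(2,1,2) h(2,1)] src.Idn_in_Hom Fm_Idn\<close>)
    ultimately show "iso_morphism C X (G (Fo X)) (\<eta> X)" using h by (auto simp: iso_morphism_def)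
    fix Y f assume Y: "Y \<in> Obj C" and f: "f \<in> Hom C X Y"
    note F' = Fo_in_Obj[OF Y]
    note o' = Y G_in_Obj[OF F'] F' FG_in_Obj[OF F']
    note Ff = Fm_in_Hom[OF X Y f]
    have h': "\<eta> Y \<in> Hom C Y (G (Fo Y))" "Fm Y (G (Fo Y)) (\<eta> Y) = counit_inv (Fo Y)"
      unfolding \<eta>_def using o' counit_facts[OF F'] by (simp_all add: lift_in_Hom Fm_lift)
    have g: "Gm (Fo X) (Fo Y) (Fm X Y f) \<in> Hom C (G (Fo X)) (G (Fo Y))"
      "Fm (G (Fo X)) (G (Fo Y)) (Gm (Fo X) (Fo Y) (Fm X Y f)) = conj (Fo X) (Fo Y) (Fm X Y f)"
      unfolding Gm_def using o o' conj_in_Hom[OF F F' Ff] by (simp_all add: lift_in_Hom Fm_lift)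
    show "Cmp C X Y (G (Fo Y)) (\<eta> Y) f
        = Cmp C X (G (Fo X)) (G (Fo Y)) (Gm (Fo X) (Fo Y) (Fm X Y f)) (\<eta> X)"
    proof (rule Fm_inject[OF X o'(2)])
      show "Cmp C X Y (G (Fo Y)) (\<eta> Y) f \<in> Hom C X (G (Fo Y))"
        by (rule src.Cmp_in_Hom[OF X Y o'(2) f h'(1)])
      show "Cmp C X (G (Fo X)) (G (Fo Y)) (Gm (Fo X) (Fo Y) (Fm X Y f)) (\<eta> X) \<in> Hom C X (G (Fo Y))"
        by (rule src.Cmp_in_Hom[OF X o(2) o'(2) h(1) g(1)])
    qed (simp add: Fm_Cmp[OF X Y o'(2) f h'(1)] Fm_Cmp[OF X o(2) o'(2) h(1) g(1)] Fh h' g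
        conj_counit_inv[OF F F' Ff])
  qed
  have counit: "natural_iso D D (\<lambda>X. Fo (G X)) (\<lambda>X Y f. Fm (G X) (G Y) (Gm X Y f)) (\<lambda>X. X) (\<lambda>X Y f. f) counit"
    unfolding natural_iso_def
  proof (intro conjI ballI)
    fix Y Z g assume Y: "Y \<in> Obj D" and Z: "Z \<in> Obj D" and g: "g \<in> Hom D Y Z"
    have "Fm (G Y) (G Z) (Gm Y Z g) = conj Y Z g"
      unfolding Gm_def by (rule Fm_lift[OF G_in_Obj[OF Y] G_in_Obj[OF Z] conj_in_Hom[OF Y Z g]])
    then show "Cmp D (Fo (G Y)) (Fo (G Z)) Z (counit Z) (Fm (G Y) (G Z) (Gm Y Z g))
        = Cmp D (Fo (G Y)) Y Z g (counit Y)"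
      by (simp add: counit_conj[OF Y Z g])
  qed (rule counit_iso)
  show ?thesis
    unfolding equivalent_cats_def
    using cat_functor_axioms G_functor unit counit by blast
qed

end

section \<open>Direct sums of categories and categories of modules\<close>

lemma category_direct_sum_cat:
  assumes "category C"
  shows "category (direct_sum_cat C I)"
proof -
  interpret category C by fact
  show ?thesis
  proof (unfold_locales, goal_cases)
    case (3 X Y f)
    then show ?case by (auto simp: direct_sum_cat_def PiE_iff extensional_def fun_eq_iff Cmp_Idn_right)
  next
    case (4 X Y f)
    then show ?case by (auto simp: direct_sum_cat_def PiE_iff extensional_def fun_eq_iff Cmp_Idn_left)
  next
    case (5 W X Y Z f g h)
    then show ?case by (auto simp: direct_sum_cat_def PiE_iff fun_eq_iff Cmp_assoc)
  qed (auto simp: direct_sum_cat_def PiE_iff Idn_in_Hom Cmp_in_Hom)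
qed

lemma iso_morphism_direct_sum_cat:
  assumes "\<And>i. i \<in> I \<Longrightarrow> iso_morphism C (F i) (G i) (\<phi> i)"
  shows "iso_morphism (direct_sum_cat C I) F G (\<lambda>i\<in>I. \<phi> i)"
proof -
  have "\<exists>\<psi>. \<forall>i\<in>I. \<psi> i \<in> Hom C (G i) (F i) \<and> Cmp C (F i) (G i) (F i) (\<psi> i) (\<phi> i) = Idn C (F i) \<and>
      Cmp C (G i) (F i) (G i) (\<phi> i) (\<psi> i) = Idn C (G i)"
    by (rule bchoice) (use assms in \<open>auto simp: iso_morphism_def\<close>)
  then obtain \<psi> where \<psi>: "\<And>i. i \<in> I \<Longrightarrow> \<psi> i \<in> Hom C (G i) (F i)"
    "\<And>i. i \<in> I \<Longrightarrow> Cmp C (F i) (G i) (F i) (\<psi> i) (\<phi> i) = Idn C (F i)"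
    "\<And>i. i \<in> I \<Longrightarrow> Cmp C (G i) (F i) (G i) (\<phi> i) (\<psi> i) = Idn C (G i)"
    by blast
  show ?thesis
    unfolding iso_morphism_def
  proof (intro conjI bexI[of _ "\<lambda>i\<in>I. \<psi> i"])
    show "(\<lambda>i\<in>I. \<phi> i) \<in> Hom (direct_sum_cat C I) F G"
      using assms by (auto simp: direct_sum_cat_def iso_morphism_def)
  qed (auto simp: direct_sum_cat_def \<psi> fun_eq_iff)
qed

lemma module_homsD:
  assumes "f \<in> module_homs K A M N"
  shows "f \<in> linear_maps K M N" "f \<in> extensional (carrier M)"
    "\<And>m. m \<in> carrier M \<Longrightarrow> f m \<in> carrier N"
    "\<And>m a. \<lbrakk>m \<in> carrier M; a \<in> carrier A\<rbrakk> \<Longrightarrow> f (act M m a) = act N (f m) a"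
  using assms by (auto simp: module_homs_def linear_maps_def PiE_iff)

lemma module_homsI:
  assumes "f \<in> linear_maps K M N" and "f \<in> extensional (carrier M)"
    and "\<And>m a. \<lbrakk>m \<in> carrier M; a \<in> carrier A\<rbrakk> \<Longrightarrow> f (act M m a) = act N (f m) a"
  shows "f \<in> module_homs K A M N"
  using assms by (auto simp: module_homs_def linear_maps_def PiE_iff)

text \<open>Elements of \<open>linear_maps\<close> are unconstrained outside the carrier, so plain
  lambda terms and their composites qualify. Morphisms of \<open>fd_modules\<close> must be
  extensional for their equality to be meaningful; restriction mediates between the two.\<close>

lemma restrict_module_homs:
  assumes M: "right_module K A M" and f: "f \<in> linear_maps K M N"
    and act: "\<And>m a. \<lbrakk>m \<in> carrier M; a \<in> carrier A\<rbrakk> \<Longrightarrow> f (act M m a) = act N (f m) a"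
  shows "restrict f (carrier M) \<in> module_homs K A M N"
proof (rule module_homsI)
  interpret M: right_module K A M by fact
  show "restrict f (carrier M) \<in> linear_maps K M N"
    by (rule linear_maps_cong[OF f _ M.modules(2)]) simp
  show "restrict f (carrier M) (act M m a) = act N (restrict f (carrier M) m) a"
    if "m \<in> carrier M" "a \<in> carrier A" for m a
    using that act M.act_closed by simp
qed simp

lemma fd_modules_Obj:
  assumes "M \<in> Obj (fd_modules K A)"
  shows "right_module K A M" "unital_module K A M" "finite_dim K M"
  using assms by (auto simp: fd_modules_def unital_module_def)

lemma category_fd_modules:
  fixes K :: "('k, 'x) ring_scheme" and A :: "('k, 'a) module"
  shows "category (fd_modules K A :: (('k, 'a, 'u) rmodule, 'u \<Rightarrow> 'u) cat)"
proof
  fix X :: "('k, 'a, 'u) rmodule"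
  assume X: "X \<in> Obj (fd_modules K A)"
  show "Idn (fd_modules K A) X \<in> Hom (fd_modules K A) X X"
    using restrict_module_homs[OF fd_modules_Obj(1)[OF X] linear_maps_id] by (simp add: fd_modules_def)
  fix Y :: "('k, 'a, 'u) rmodule"
  assume Y: "Y \<in> Obj (fd_modules K A)"
  {
    fix Z :: "('k, 'a, 'u) rmodule" and f g
    assume fg: "f \<in> Hom (fd_modules K A) X Y" "g \<in> Hom (fd_modules K A) Y Z"
    then have f: "f \<in> module_homs K A X Y" and g: "g \<in> module_homs K A Y Z"
      by (simp_all add: fd_modules_def)
    have "restrict (\<lambda>m. g (f m)) (carrier X) \<in> module_homs K A X Z"
      by (rule restrict_module_homs[OF fd_modules_Obj(1)[OF X]
            linear_maps_comp[OF module_homsD(1)[OF f] module_homsD(1)[OF g]]])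
        (simp add: module_homsD[OF f] module_homsD[OF g])
    then show "Cmp (fd_modules K A) X Y Z g f \<in> Hom (fd_modules K A) X Z"
      by (simp add: fd_modules_def compose_def)
  }
  fix f assume "f \<in> Hom (fd_modules K A) X Y"
  then have f: "f \<in> module_homs K A X Y" by (simp add: fd_modules_def)
  show "Cmp (fd_modules K A) X X Y f (Idn (fd_modules K A) X) = f"
    using module_homsD(2)[OF f] by (auto simp: fd_modules_def compose_def fun_eq_iff extensional_def)
  show "Cmp (fd_modules K A) X Y Y (Idn (fd_modules K A) Y) f = f"
    using module_homsD(2,3)[OF f] by (auto simp: fd_modules_def compose_def fun_eq_iff extensional_def)
next
  fix W X Y Z :: "('k, 'a, 'u) rmodule" and f g h
  assume "f \<in> Hom (fd_modules K A) W X"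
  then have f: "f \<in> module_homs K A W X" by (simp add: fd_modules_def)
  show "Cmp (fd_modules K A) W Y Z h (Cmp (fd_modules K A) W X Y g f)
      = Cmp (fd_modules K A) W X Z (Cmp (fd_modules K A) X Y Z h g) f"
    using module_homsD(3)[OF f] by (auto simp: fd_modules_def compose_def fun_eq_iff)
qed

lemma fd_modules_iso:
  assumes M: "M \<in> Obj (fd_modules K A)" and N: "N \<in> Obj (fd_modules K A)"
    and f: "f \<in> module_homs K A M N" and bij: "bij_betw f (carrier M) (carrier N)"
  shows "iso_morphism (fd_modules K A) M N f"
proof -
  interpret M: right_module K A M by (rule fd_modules_Obj(1)[OF M])
  interpret N: right_module K A N by (rule fd_modules_Obj(1)[OF N])
  define g where "g = inv_into (carrier M) f"
  have g: "g n \<in> carrier M" "f (g n) = n" if "n \<in> carrier N" for n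
    using bij that unfolding g_def
    by (metis bij_betw_imp_surj_on inv_into_into, metis bij_betw_inv_into_right)
  have gf: "g (f m) = m" if "m \<in> carrier M" for m
    using bij that unfolding g_def by (metis bij_betw_inv_into_left)
  note lin = module_homsD(1)[OF f]
  have "restrict g (carrier N) \<in> module_homs K A N M"
  proof (rule restrict_module_homs[OF N.right_module_axioms])
    show "g \<in> linear_maps K N M"
    proof (rule linear_mapsI)
      fix m n assume "m \<in> carrier N" "n \<in> carrier N"
      then show "g (m \<oplus>\<^bsub>N\<^esub> n) = g m \<oplus>\<^bsub>M\<^esub> g n"
        using gf[of "g m \<oplus>\<^bsub>M\<^esub> g n"] g linear_maps_add[OF lin] by simp
    next
      fix k n assume "k \<in> carrier K" "n \<in> carrier N"
      then show "g (k \<odot>\<^bsub>N\<^esub> n) = k \<odot>\<^bsub>M\<^esub> g n"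
        using gf[of "k \<odot>\<^bsub>M\<^esub> g n"] g linear_maps_smult[OF lin] by simp
    qed (rule g)
    fix n a assume "n \<in> carrier N" "a \<in> carrier A"
    then show "g (act N n a) = act M (g n) a"
      using gf[of "act M (g n) a"] g module_homsD(4)[OF f] M.act_closed by simp
  qed
  moreover have "compose (carrier M) (restrict g (carrier N)) f = (\<lambda>m\<in>carrier M. m)"
    using gf module_homsD(3)[OF f] by (auto simp: compose_def fun_eq_iff)
  moreover have "compose (carrier N) f (restrict g (carrier N)) = (\<lambda>m\<in>carrier N. m)"
    using g by (auto simp: compose_def fun_eq_iff)
  ultimately show ?thesis using f by (auto simp: iso_morphism_def fd_modules_def)
qed

lemma zero_map_module_homs:
  assumes "right_module K A M" and "right_module K A N"
  shows "(\<lambda>m\<in>carrier M. \<zero>\<^bsub>N\<^esub>) \<in> module_homs K A M N"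
proof -
  interpret N: right_module K A N by fact
  show ?thesis
    by (rule restrict_module_homs[OF assms(1) linear_maps_zero_map[OF N.modules(2)]])
      (simp add: N.act_zero_left)
qed

text \<open>A zero object has a single endomorphism, so its identity is the zero map. This turns the
  finiteness condition on objects of \<open>direct_sum_cat\<close> into a statement about
  carriers.\<close>

lemma zero_object_fd_modules:
  assumes M: "M \<in> Obj (fd_modules K A)"
  shows "zero_object (fd_modules K A) M \<longleftrightarrow> carrier M = {\<zero>\<^bsub>M\<^esub>}"
proof
  interpret M: right_module K A M by (rule fd_modules_Obj(1)[OF M])
  assume "zero_object (fd_modules K A) M"
  then have "\<exists>!f. f \<in> module_homs K A M M" using M by (auto simp: zero_object_def fd_modules_def)
  moreover have "(\<lambda>m\<in>carrier M. \<zero>\<^bsub>M\<^esub>) \<in> module_homs K A M M"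
    by (rule zero_map_module_homs) (rule M.right_module_axioms)+
  moreover have "(\<lambda>m\<in>carrier M. m) \<in> module_homs K A M M"
    using restrict_module_homs[OF M.right_module_axioms linear_maps_id] by simp
  ultimately have "(\<lambda>m\<in>carrier M. \<zero>\<^bsub>M\<^esub>) = (\<lambda>m\<in>carrier M. m)" by blast
  then have "m = \<zero>\<^bsub>M\<^esub>" if "m \<in> carrier M" for m using that by (metis restrict_apply')
  then show "carrier M = {\<zero>\<^bsub>M\<^esub>}" by auto
next
  interpret M: right_module K A M by (rule fd_modules_Obj(1)[OF M])
  assume z: "carrier M = {\<zero>\<^bsub>M\<^esub>}"
  have "(\<exists>!f. f \<in> module_homs K A X M) \<and> (\<exists>!f. f \<in> module_homs K A M X)"
    if X: "X \<in> Obj (fd_modules K A)" for X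
  proof (intro conjI ex1I)
    interpret X: right_module K A X by (rule fd_modules_Obj(1)[OF X])
    show "(\<lambda>m\<in>carrier X. \<zero>\<^bsub>M\<^esub>) \<in> module_homs K A X M" "(\<lambda>m\<in>carrier M. \<zero>\<^bsub>X\<^esub>) \<in> module_homs K A M X"
      by (rule zero_map_module_homs X.right_module_axioms M.right_module_axioms)+
    fix f assume f: "f \<in> module_homs K A X M"
    show "f = (\<lambda>m\<in>carrier X. \<zero>\<^bsub>M\<^esub>)"
      using module_homsD(2,3)[OF f] z by (auto simp: fun_eq_iff extensional_def)
  next
    interpret X: right_module K A X by (rule fd_modules_Obj(1)[OF X])
    fix f assume f: "f \<in> module_homs K A M X"
    have "f \<zero>\<^bsub>M\<^esub> = \<zero>\<^bsub>X\<^esub>" by (rule linear_maps_zero[OF module_homsD(1)[OF f] M.modules(2) X.modules(2)])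
    then show "f = (\<lambda>m\<in>carrier M. \<zero>\<^bsub>X\<^esub>)"
      using module_homsD(2)[OF f] z by (auto simp: fun_eq_iff extensional_def)
  qed
  then show "zero_object (fd_modules K A) M"
    using M by (auto simp: zero_object_def fd_modules_def)
qed

section \<open>Finite dimensional spaces\<close>

lemma finsum_in_submodule:
  assumes S: "submodule K S M" and x: "\<And>i. i \<in> T \<Longrightarrow> x i \<in> S"
  shows "finsum M x T \<in> S"
proof -
  interpret M: Module.module K M using S by (rule submodule.module)
  have "T' \<subseteq> T \<longrightarrow> finsum M x T' \<in> S" if "finite T'" for T'
    using that
  proof (induction T' rule: finite_induct)
    case empty
    then show ?case using submodule.zero_closed[OF S] by simp
  next
    case (insert i T')
    show ?case
    proof
      assume "insert i T' \<subseteq> T"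
      then show "finsum M x (insert i T') \<in> S"
        using insert x submodule.m_closed[OF S] submodule.subset[OF S]
        by (subst M.M.finsum_insert) (auto simp: Pi_def subset_iff)
    qed
  qed
  then show ?thesis using submodule.zero_closed[OF S] by (cases "finite T") (auto simp: M.M.finsum_infinite)
qed

text \<open>The images of finite spanning sets together span. With the one-element index set
  \<open>{()}\<close> it says that a linear image of a finite dimensional space is finite
  dimensional.\<close>

lemma finite_dim_sum_images:
  assumes M: "Module.module K M" and F: "finite F"
    and N: "\<And>v. v \<in> F \<Longrightarrow> Module.module K (N v)" "\<And>v. v \<in> F \<Longrightarrow> finite_dim K (N v)"
    and \<iota>: "\<And>v. v \<in> F \<Longrightarrow> \<iota> v \<in> linear_maps K (N v) M"
    and sum: "\<And>m. m \<in> carrier M \<Longrightarrow> \<exists>n. (\<forall>v\<in>F. n v \<in> carrier (N v)) \<and> m = finsum M (\<lambda>v. \<iota> v (n v)) F"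
  shows "finite_dim K M"
proof -
  interpret M: Module.module K M by fact
  define Q where "Q v B \<longleftrightarrow> finite B \<and> B \<subseteq> carrier (N v) \<and> (\<forall>m\<in>carrier (N v).
      \<exists>c\<in>B \<rightarrow> carrier K. m = finsum (N v) (\<lambda>b. smult (N v) (c b) b) B)" for v B
  have "\<forall>v\<in>F. \<exists>B. Q v B" using N(2) unfolding finite_dim_def Q_def by blast
  then obtain B where Q: "\<forall>v\<in>F. Q v (B v)" by (rule bchoice[THEN exE])
  have B: "finite (B v)" "B v \<subseteq> carrier (N v)" if "v \<in> F" for v
    using Q that by (simp_all add: Q_def)
  let ?S = "\<Union>v\<in>F. \<iota> v ` B v"
  have S: "finite ?S" "?S \<subseteq> carrier M"
    using F B(1) by auto (use B(2) linear_maps_closed[OF \<iota>] in blast)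
  have sub: "submodule K (M.span ?S) M" by (rule M.span_is_submodule[OF S(2)])
  have img: "\<iota> v n \<in> M.span ?S" if v: "v \<in> F" and n: "n \<in> carrier (N v)" for v n
  proof -
    interpret N: Module.module K "N v" by (rule N(1)[OF v])
    obtain c where c: "c \<in> B v \<rightarrow> carrier K" "n = finsum (N v) (\<lambda>b. c b \<odot>\<^bsub>N v\<^esub> b) (B v)"
      using Q v n unfolding Q_def by blast
    have "\<iota> v n = finsum M (\<lambda>b. \<iota> v (c b \<odot>\<^bsub>N v\<^esub> b)) (B v)"
      unfolding c(2) using c(1) B(2)[OF v] by (intro linear_maps_finsum[OF \<iota>[OF v] N(1)[OF v] M]) auto
    also have "\<dots> \<in> M.span ?S"
    proof (rule finsum_in_submodule[OF sub])
      fix b assume b: "b \<in> B v"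
      have "\<iota> v b \<in> M.span ?S" using b v S M.in_own_span[of ?S] by auto
      then show "\<iota> v (c b \<odot>\<^bsub>N v\<^esub> b) \<in> M.span ?S"
        using b c(1) B(2)[OF v] linear_maps_smult[OF \<iota>[OF v]] submodule.smult_closed[OF sub]
        by (auto simp: Pi_def subset_iff)
    qed
    finally show ?thesis .
  qed
  have "m \<in> M.span ?S" if m: "m \<in> carrier M" for m
  proof -
    obtain n where n: "\<forall>v\<in>F. n v \<in> carrier (N v)" "m = finsum M (\<lambda>v. \<iota> v (n v)) F"
      using sum[OF m] by blast
    show ?thesis unfolding n(2) by (rule finsum_in_submodule[OF sub]) (use n(1) img in auto)
  qed
  then show ?thesis
    unfolding finite_dim_def using S by (auto simp: M.finite_span M.lincomb_def)
qed

lemma (in right_module) generate_in_carrier: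
  assumes "S \<subseteq> carrier M"
  shows "generate (add_monoid M) S \<subseteq> carrier M"
  using group.generate_in_carrier[OF vs.M.a_group, of S] assms by auto

lemma (in right_module) finsum_in_generate:
  assumes S: "S \<subseteq> carrier M" and x: "\<And>i. i \<in> F \<Longrightarrow> x i \<in> S"
  shows "finsum M x F \<in> generate (add_monoid M) S"
proof -
  have one: "\<zero>\<^bsub>M\<^esub> \<in> generate (add_monoid M) S"
    using generate.one[of "add_monoid M" S] by simp
  have "F' \<subseteq> F \<longrightarrow> finsum M x F' \<in> generate (add_monoid M) S" if "finite F'" for F'
    using that
  proof (induction F' rule: finite_induct)
    case (insert i F')
    show ?case
    proof
      assume "insert i F' \<subseteq> F"
      then have "finsum M x (insert i F') = x i \<oplus>\<^bsub>M\<^esub> finsum M x F'"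
        using insert x S by (subst vs.M.finsum_insert) (auto simp: Pi_def subset_iff)
      then show "finsum M x (insert i F') \<in> generate (add_monoid M) S"
        using insert generate.eng[of "x i" "add_monoid M" S] generate.incl[of "x i" S "add_monoid M"] x
          \<open>insert i F' \<subseteq> F\<close> by simp
    qed
  qed (simp add: one)
  then show ?thesis by (cases "finite F") (auto simp: one)
qed

section \<open>Algebras with a system of orthogonal local units\<close>

text \<open>The vertices of a graph in abstract form. \<open>local_units\<close> replaces a unit
  element: each element is fixed from the right by a finite sum of the \<open>P v\<close>. Only
  right multiplication is controlled, because modules are right modules.\<close>

locale idempotent_algebra = nonunital_algebra K A
  for K :: "('k, 'x) ring_scheme" (structure) and A :: "('k, 'a) module" (structure) +
  fixes V :: "'v set" and P :: "'v \<Rightarrow> 'a"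
  assumes P_closed: "v \<in> V \<Longrightarrow> P v \<in> carrier A"
    and P_mult: "\<lbrakk>v \<in> V; w \<in> V\<rbrakk> \<Longrightarrow> P v \<otimes>\<^bsub>A\<^esub> P w = (if v = w then P v else \<zero>\<^bsub>A\<^esub>)"
    and local_units: "a \<in> carrier A \<Longrightarrow>
      \<exists>F. finite F \<and> F \<subseteq> V \<and> (\<forall>v\<in>V - F. a \<otimes>\<^bsub>A\<^esub> P v = \<zero>\<^bsub>A\<^esub>) \<and> a = finsum A (\<lambda>v. a \<otimes>\<^bsub>A\<^esub> P v) F"
begin

definition supp :: "('k, 'a, 'm) rmodule \<Rightarrow> 'v set" where
  "supp M = {v \<in> V. \<exists>m\<in>carrier M. act M m (P v) \<noteq> \<zero>\<^bsub>M\<^esub>}"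

lemma unital_moduleI:
  assumes M: "right_module K A M" and F: "F \<subseteq> V"
    and dec: "\<And>m. m \<in> carrier M \<Longrightarrow> m = finsum M (\<lambda>v. act M m (P v)) F"
  shows "unital_module K A M"
proof -
  interpret M: right_module K A M by fact
  let ?S = "{act M m a | m a. m \<in> carrier M \<and> a \<in> carrier A}"
  have S: "?S \<subseteq> carrier M" using M.act_closed by auto
  have "m \<in> generate (add_monoid M) ?S" if m: "m \<in> carrier M" for m
  proof -
    have "finsum M (\<lambda>v. act M m (P v)) F \<in> generate (add_monoid M) ?S"
      by (rule M.finsum_in_generate[OF S]) (use m F P_closed in auto)
    then show ?thesis using dec[OF m] by simp
  qed
  then show ?thesis
    using M M.generate_in_carrier[OF S] by (auto simp: unital_module_def)
qed

text \<open>The local unit of \<open>a\<close> serves for \<open>m a\<close>, and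
  \<open>M A = M\<close> makes every element a finite sum of such elements; for a sum the union of
  the two vertex sets is taken.\<close>

lemma unital_local_units:
  fixes M :: "('k, 'a, 'm) rmodule"
  assumes unital: "unital_module K A M" and m: "m \<in> carrier M"
  shows "\<exists>F. finite F \<and> F \<subseteq> V \<and> (\<forall>v\<in>V - F. act M m (P v) = \<zero>\<^bsub>M\<^esub>) \<and>
    m = finsum M (\<lambda>v. act M m (P v)) F"
proof -
  interpret M: right_module K A M using unital by (simp add: unital_module_def)
  let ?S = "{act M m a | m a. m \<in> carrier M \<and> a \<in> carrier A}"
  let ?Q = "\<lambda>m. m \<in> carrier M \<and> (\<exists>F. finite F \<and> F \<subseteq> V \<and> (\<forall>v\<in>V - F. act M m (P v) = \<zero>\<^bsub>M\<^esub>) \<and>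
    m = finsum M (\<lambda>v. act M m (P v)) F)"
  have base: "?Q (act M m a)" if m: "m \<in> carrier M" and a: "a \<in> carrier A" for m a
  proof -
    obtain F where F: "finite F" "F \<subseteq> V" "\<forall>v\<in>V - F. a \<otimes>\<^bsub>A\<^esub> P v = \<zero>\<^bsub>A\<^esub>"
      "a = finsum A (\<lambda>v. a \<otimes>\<^bsub>A\<^esub> P v) F" using local_units[OF a] by blast
    have eq: "act M (act M m a) (P v) = act M m (a \<otimes>\<^bsub>A\<^esub> P v)" if "v \<in> V" for v
      using M.act_mult m a P_closed that by simp
    have "act M m a = act M m (finsum A (\<lambda>v. a \<otimes>\<^bsub>A\<^esub> P v) F)" using F(4) by simp
    also have "\<dots> = finsum M (\<lambda>v. act M m (a \<otimes>\<^bsub>A\<^esub> P v)) F"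
      using m a F(2) by (intro M.act_finsum_right) (auto intro!: mult_closed P_closed)
    also have "\<dots> = finsum M (\<lambda>v. act M (act M m a) (P v)) F"
      by (rule M.vs.M.finsum_cong') (use F(2) eq m a P_closed M.act_closed mult_closed in \<open>auto simp: subset_iff\<close>)
    finally have "act M m a = finsum M (\<lambda>v. act M (act M m a) (P v)) F" .
    moreover have "\<forall>v\<in>V - F. act M (act M m a) (P v) = \<zero>\<^bsub>M\<^esub>"
      using eq F(3) M.act_zero_right m by auto
    ultimately show ?thesis using F(1,2) M.act_closed m a by blast
  qed
  have "?Q m" if "m \<in> generate (add_monoid M) ?S" for m
    using that
  proof induction
    case one
    then show ?case using M.act_zero_left P_closed by (auto intro!: exI[of _ "{}"])
  next
    case (incl h)
    then show ?case using base by blast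
  next
    case (inv h)
    then obtain m a where h: "h = act M m a" "m \<in> carrier M" "a \<in> carrier A" by blast
    \<comment> \<open>\<open>generate\<close> also closes under negation. Moving the scalar -1 onto
      the module element shows that \<open>-(m a) = (-m) a\<close> is again of the basic
      form.\<close>
    have "\<ominus>\<^bsub>M\<^esub> h = (\<ominus>\<^bsub>K\<^esub> \<one>\<^bsub>K\<^esub>) \<odot>\<^bsub>M\<^esub> h"
      using h M.act_closed by (simp add: M.vs.smult_l_minus)
    also have "\<dots> = act M ((\<ominus>\<^bsub>K\<^esub> \<one>\<^bsub>K\<^esub>) \<odot>\<^bsub>M\<^esub> m) a"
      using h by (simp add: M.act_smult_left)
    finally show ?case using base[of "(\<ominus>\<^bsub>K\<^esub> \<one>\<^bsub>K\<^esub>) \<odot>\<^bsub>M\<^esub> m" a] h by (simp add: a_inv_def)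
  next
    case (eng x y)
    then obtain F F' where F: "finite F" "F \<subseteq> V" "\<forall>v\<in>V - F. act M x (P v) = \<zero>\<^bsub>M\<^esub>"
        "x = finsum M (\<lambda>v. act M x (P v)) F"
      and F': "finite F'" "F' \<subseteq> V" "\<forall>v\<in>V - F'. act M y (P v) = \<zero>\<^bsub>M\<^esub>"
        "y = finsum M (\<lambda>v. act M y (P v)) F'" by blast
    have x: "x \<in> carrier M" and y: "y \<in> carrier M" using eng by auto
    let ?F = "F \<union> F'"
    have V: "v \<in> V" if "v \<in> ?F" for v using that F F' by auto
    have "x = finsum M (\<lambda>v. act M x (P v)) ?F"
      by (subst M.vs.M.finsum_mono_neutral[of ?F F]) (use F F' x V M.act_closed P_closed in auto)
    moreover have "y = finsum M (\<lambda>v. act M y (P v)) ?F"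
      by (subst M.vs.M.finsum_mono_neutral[of ?F F']) (use F F' y V M.act_closed P_closed in auto)
    ultimately have "x \<oplus>\<^bsub>M\<^esub> y = finsum M (\<lambda>v. act M x (P v)) ?F \<oplus>\<^bsub>M\<^esub> finsum M (\<lambda>v. act M y (P v)) ?F"
      by simp
    also have "\<dots> = finsum M (\<lambda>v. act M x (P v) \<oplus>\<^bsub>M\<^esub> act M y (P v)) ?F"
      by (rule M.vs.M.finsum_addf[symmetric]) (use x y V M.act_closed P_closed in auto)
    also have "\<dots> = finsum M (\<lambda>v. act M (x \<oplus>\<^bsub>M\<^esub> y) (P v)) ?F"
      by (rule M.vs.M.finsum_cong') (use x y V M.act_closed M.act_add_left P_closed in auto)
    finally have "x \<oplus>\<^bsub>M\<^esub> y = finsum M (\<lambda>v. act M (x \<oplus>\<^bsub>M\<^esub> y) (P v)) ?F" .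
    moreover have "\<forall>v\<in>V - ?F. act M (x \<oplus>\<^bsub>M\<^esub> y) (P v) = \<zero>\<^bsub>M\<^esub>"
      using F(3) F'(3) x y P_closed by (simp add: M.act_add_left)
    ultimately show ?case using F F' x y by (auto intro!: exI[of _ ?F])
  qed
  then show ?thesis using m unital by (auto simp: unital_module_def)
qed

text \<open>Each of the finitely many spanning vectors is moved to something nonzero by only
  finitely many \<open>P v\<close>. Any other \<open>P v\<close> annihilates a spanning set, hence
  all of \<open>M\<close>.\<close>

lemma fd_support:
  fixes M :: "('k, 'a, 'm) rmodule"
  assumes M: "M \<in> Obj (fd_modules K A)"
  shows finite_supp: "finite (supp M)"
    and supp_decomposition: "m \<in> carrier M \<Longrightarrow> m = finsum M (\<lambda>v. act M m (P v)) (supp M)"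
proof -
  interpret M: right_module K A M by (rule fd_modules_Obj(1)[OF M])
  note unital = fd_modules_Obj(2)[OF M]
  obtain B where B: "finite B" "B \<subseteq> carrier M"
      "\<And>m. m \<in> carrier M \<Longrightarrow> \<exists>c\<in>B \<rightarrow> carrier K. m = finsum M (\<lambda>b. c b \<odot>\<^bsub>M\<^esub> b) B"
    using fd_modules_Obj(3)[OF M] by (auto simp: finite_dim_def)
  define Q where "Q b F \<longleftrightarrow> finite F \<and> (\<forall>v\<in>V - F. act M b (P v) = \<zero>\<^bsub>M\<^esub>)" for b F
  have "\<forall>b\<in>B. \<exists>F. Q b F"
  proof
    fix b assume "b \<in> B"
    then show "\<exists>F. Q b F" using unital_local_units[OF unital, of b] B(2) unfolding Q_def by blast
  qed
  then obtain F where Q: "\<forall>b\<in>B. Q b (F b)" by (rule bchoice[THEN exE])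
  have F: "finite (F b)" "\<And>v. v \<in> V - F b \<Longrightarrow> act M b (P v) = \<zero>\<^bsub>M\<^esub>" if "b \<in> B" for b
    using Q that unfolding Q_def by blast+
  have "supp M \<subseteq> (\<Union>b\<in>B. F b)"
  proof
    fix v assume "v \<in> supp M"
    then obtain m where v: "v \<in> V" and m: "m \<in> carrier M" "act M m (P v) \<noteq> \<zero>\<^bsub>M\<^esub>"
      by (auto simp: supp_def)
    obtain c where c: "c \<in> B \<rightarrow> carrier K" "m = finsum M (\<lambda>b. c b \<odot>\<^bsub>M\<^esub> b) B" using B(3)[OF m(1)] by blast
    show "v \<in> (\<Union>b\<in>B. F b)"
    proof (rule ccontr)
      assume n: "v \<notin> (\<Union>b\<in>B. F b)"
      have "act M m (P v) = finsum M (\<lambda>b. act M (c b \<odot>\<^bsub>M\<^esub> b) (P v)) B"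
        unfolding c(2) using c(1) B(2) P_closed[OF v] by (intro M.act_finsum_left) auto
      also have "\<dots> = finsum M (\<lambda>b. \<zero>\<^bsub>M\<^esub>) B"
      proof (rule M.vs.M.finsum_cong')
        fix b assume b: "b \<in> B"
        then have "act M b (P v) = \<zero>\<^bsub>M\<^esub>" using F(2) n v by blast
        then show "act M (c b \<odot>\<^bsub>M\<^esub> b) (P v) = \<zero>\<^bsub>M\<^esub>"
          using b c(1) B(2) P_closed[OF v] by (auto simp: M.act_smult_left Pi_def subset_iff)
      qed auto
      finally show False using m(2) by simp
    qed
  qed
  then show fin: "finite (supp M)" using finite_subset F(1) B(1) by blast
  assume m: "m \<in> carrier M"
  obtain F where F: "finite F" "F \<subseteq> V" "\<forall>v\<in>V - F. act M m (P v) = \<zero>\<^bsub>M\<^esub>"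
    "m = finsum M (\<lambda>v. act M m (P v)) F" using unital_local_units[OF unital m] by blast
  have V: "v \<in> V" if "v \<in> F \<union> supp M" for v using that F(2) by (auto simp: supp_def)
  have "finsum M (\<lambda>v. act M m (P v)) (F \<union> supp M) = finsum M (\<lambda>v. act M m (P v)) F"
    by (rule M.vs.M.finsum_mono_neutral) (use F fin V m M.act_closed P_closed in auto)
  moreover have "finsum M (\<lambda>v. act M m (P v)) (F \<union> supp M) = finsum M (\<lambda>v. act M m (P v)) (supp M)"
  proof (rule M.vs.M.finsum_mono_neutral)
    fix v assume "v \<in> F \<union> supp M - supp M"
    then show "act M m (P v) = \<zero>\<^bsub>M\<^esub>" using V[of v] m unfolding supp_def by blast
  qed (use F fin V m M.act_closed P_closed in auto)
  ultimately show "m = finsum M (\<lambda>v. act M m (P v)) (supp M)" using F(4) by simp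
qed

lemma act_zero_outside_supp:
  "\<lbrakk>v \<in> V; v \<notin> supp M; m \<in> carrier M\<rbrakk> \<Longrightarrow> act M m (P v) = \<zero>\<^bsub>M\<^esub>"
  by (auto simp: supp_def)

end

section \<open>The corner functor\<close>

text \<open>
  The idempotents \<open>P v\<close> with \<open>cls v = i\<close> are all equivalent to \<open>P (rep i)\<close>, by means of
  \<open>U v\<close> and \<open>W v\<close>, and \<open>\<theta> i\<close> maps \<open>B\<close> onto the corner at \<open>P (rep i)\<close>; so \<open>A\<close> is a quotient of a
  direct sum over \<open>I\<close> of finite matrix algebras over \<open>B\<close>.
\<close>

locale corner_algebra = idempotent_algebra K A V P + B: nonunital_algebra K B
  for K :: "('k, 'x) ring_scheme" (structure) and A :: "('k, 'a) module" (structure)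
    and V :: "'v set" and P :: "'v \<Rightarrow> 'a" and B :: "('k, 'b) module" +
  fixes u :: 'b and I :: "'i set" and cls :: "'v \<Rightarrow> 'i" and rep :: "'i \<Rightarrow> 'v"
    and U W :: "'v \<Rightarrow> 'a" and \<theta> :: "'i \<Rightarrow> 'b \<Rightarrow> 'a"
  assumes unit: "u \<in> carrier B" "b \<in> carrier B \<Longrightarrow> b \<otimes>\<^bsub>B\<^esub> u = b" "b \<in> carrier B \<Longrightarrow> u \<otimes>\<^bsub>B\<^esub> b = b"
    and cls: "v \<in> V \<Longrightarrow> cls v \<in> I" and rep: "i \<in> I \<Longrightarrow> rep i \<in> V" "i \<in> I \<Longrightarrow> cls (rep i) = i"
    and finite_cls: "i \<in> I \<Longrightarrow> finite {v \<in> V. cls v = i}"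
    and U: "v \<in> V \<Longrightarrow> U v \<in> carrier A" "v \<in> V \<Longrightarrow> P (rep (cls v)) \<otimes>\<^bsub>A\<^esub> U v = U v"
      "v \<in> V \<Longrightarrow> U v \<otimes>\<^bsub>A\<^esub> P v = U v" "i \<in> I \<Longrightarrow> U (rep i) = P (rep i)"
    and W: "v \<in> V \<Longrightarrow> W v \<in> carrier A" "v \<in> V \<Longrightarrow> P v \<otimes>\<^bsub>A\<^esub> W v = W v"
      "v \<in> V \<Longrightarrow> W v \<otimes>\<^bsub>A\<^esub> P (rep (cls v)) = W v"
    and UW: "v \<in> V \<Longrightarrow> U v \<otimes>\<^bsub>A\<^esub> W v = P (rep (cls v))" and WU: "v \<in> V \<Longrightarrow> W v \<otimes>\<^bsub>A\<^esub> U v = P v"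
    and \<theta>: "i \<in> I \<Longrightarrow> \<theta> i \<in> linear_maps K B A" "i \<in> I \<Longrightarrow> \<theta> i u = P (rep i)"
      "\<lbrakk>i \<in> I; b \<in> carrier B; b' \<in> carrier B\<rbrakk> \<Longrightarrow> \<theta> i (b \<otimes>\<^bsub>B\<^esub> b') = \<theta> i b \<otimes>\<^bsub>A\<^esub> \<theta> i b'"
    and spanning: "\<lbrakk>X \<subseteq> carrier A; \<zero>\<^bsub>A\<^esub> \<in> X; \<And>x y. \<lbrakk>x \<in> X; y \<in> X\<rbrakk> \<Longrightarrow> x \<oplus>\<^bsub>A\<^esub> y \<in> X;
        \<And>v w b. \<lbrakk>v \<in> V; w \<in> V; cls v = cls w; b \<in> carrier B\<rbrakk>
          \<Longrightarrow> W v \<otimes>\<^bsub>A\<^esub> (\<theta> (cls v) b \<otimes>\<^bsub>A\<^esub> U w) \<in> X\<rbrakk> \<Longrightarrow> carrier A \<subseteq> X"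
begin

text \<open>Only the carrier is cut down, to the vectors fixed by the idempotent; all vector space
  operations are inherited. A homomorphism thus passes to the corners by mere restriction.\<close>

definition corner :: "'i \<Rightarrow> ('k, 'a, 'm) rmodule \<Rightarrow> ('k, 'b, 'm) rmodule" where
  "corner i M = \<lparr>carrier = {m \<in> carrier M. act M m (P (rep i)) = m}, mult = undefined, one = undefined,
     zero = \<zero>\<^bsub>M\<^esub>, add = add M, smult = smult M, act = (\<lambda>m b. act M m (\<theta> i b))\<rparr>"

lemma corner_simps [simp]:
  "m \<in> carrier (corner i M) \<longleftrightarrow> m \<in> carrier M \<and> act M m (P (rep i)) = m"
  "\<zero>\<^bsub>corner i M\<^esub> = \<zero>\<^bsub>M\<^esub>" "add (corner i M) = add M" "smult (corner i M) = smult M"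
  "act (corner i M) m b = act M m (\<theta> i b)"
  by (auto simp: corner_def)

lemma \<theta>_closed: "\<lbrakk>i \<in> I; b \<in> carrier B\<rbrakk> \<Longrightarrow> \<theta> i b \<in> carrier A"
  by (rule linear_maps_closed[OF \<theta>(1)])

lemma \<theta>_corner: "\<lbrakk>i \<in> I; b \<in> carrier B\<rbrakk> \<Longrightarrow> \<theta> i b \<otimes>\<^bsub>A\<^esub> P (rep i) = \<theta> i b"
  using \<theta>(3)[of i b u] by (simp add: \<theta>(2) unit)

text \<open>\<open>U v\<close> ends at \<open>v\<close> and \<open>W w\<close> begins at
  \<open>w\<close>, so inserting \<open>P v P w = 0\<close> between them kills the product.\<close>

lemma UW_orthogonal:
  assumes v: "v \<in> V" and w: "w \<in> V" and ne: "v \<noteq> w"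
  shows "U v \<otimes>\<^bsub>A\<^esub> W w = \<zero>\<^bsub>A\<^esub>"
proof -
  have "U v \<otimes>\<^bsub>A\<^esub> W w = (U v \<otimes>\<^bsub>A\<^esub> P v) \<otimes>\<^bsub>A\<^esub> (P w \<otimes>\<^bsub>A\<^esub> W w)" by (simp only: U(3)[OF v] W(2)[OF w])
  also have "\<dots> = U v \<otimes>\<^bsub>A\<^esub> ((P v \<otimes>\<^bsub>A\<^esub> P w) \<otimes>\<^bsub>A\<^esub> W w)"
    using v w by (simp add: mult_assoc U(1) W(1) P_closed mult_closed)
  finally show ?thesis using v w ne by (simp add: P_mult mult_zero_left mult_zero_right U(1) W(1))
qed

text \<open>The corner is the image of the linear operator by which \<open>P (rep i)\<close> acts.
  As that element is idempotent, the image is the same as the set of fixed vectors.\<close>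

lemma corner_module:
  fixes M :: "('k, 'a, 'm) rmodule"
  assumes M: "right_module K A M" and i: "i \<in> I"
  shows "right_module K B (corner i M)"
proof -
  interpret M: right_module K A M by fact
  note r = P_closed[OF rep(1)[OF i]]
  have idem: "act M (act M m (P (rep i))) (P (rep i)) = act M m (P (rep i))" if "m \<in> carrier M" for m
    using that r M.act_mult[of m "P (rep i)" "P (rep i)"] rep(1)[OF i] by (simp add: P_mult)
  have "Module.module K (corner i M)"
  proof (rule module_surjective_image[OF M.modules(2), of _ "\<lambda>m. act M m (P (rep i))"])
    show "carrier (corner i M) = (\<lambda>m. act M m (P (rep i))) ` carrier M"
      using idem M.act_closed r by (force simp: image_iff)
  qed (use r in \<open>simp_all add: M.act_zero_left M.act_add_left M.act_smult_left\<close>)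
  moreover have "act M (act M m (\<theta> i b)) (P (rep i)) = act M m (\<theta> i b)"
    if "m \<in> carrier M" "b \<in> carrier B" for m b
    using that M.act_mult[of m "\<theta> i b" "P (rep i)"] r \<theta>_corner[OF i] \<theta>_closed[OF i] by simp
  ultimately show ?thesis
    by (intro right_module.intro right_module_axioms.intro B.nonunital_algebra_axioms)
      (simp_all add: M.act_closed M.act_add_left M.act_add_right M.act_smult_left M.act_smult_right
        M.act_mult \<theta>_closed[OF i] \<theta>(3)[OF i] linear_maps_add[OF \<theta>(1)[OF i]]
        linear_maps_smult[OF \<theta>(1)[OF i]])
qed

text \<open>The corner is a linear image of \<open>M\<close>, hence finite dimensional. It is unital
  because \<open>u\<close> acts through \<open>P (rep i)\<close>, which fixes every vector of the
  corner.\<close>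

lemma corner_fd:
  fixes M :: "('k, 'a, 'm) rmodule"
  assumes M: "M \<in> Obj (fd_modules K A)" and i: "i \<in> I"
  shows "corner i M \<in> Obj (fd_modules K B)"
proof -
  interpret M: right_module K A M by (rule fd_modules_Obj(1)[OF M])
  interpret C: right_module K B "corner i M" by (rule corner_module[OF M.right_module_axioms i])
  note r = P_closed[OF rep(1)[OF i]]
  let ?S = "{act (corner i M) m a | m a. m \<in> carrier (corner i M) \<and> a \<in> carrier B}"
  have S: "?S \<subseteq> carrier (corner i M)" using C.act_closed by auto
  have mem: "m \<in> ?S" if "m \<in> carrier (corner i M)" for m
  proof -
    have "m = act (corner i M) m u" using that i by (simp add: \<theta>(2))
    then show ?thesis using that unit(1) by blast
  qed
  have unital: "unital_module K B (corner i M)"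
    unfolding unital_module_def
  proof (intro conjI C.right_module_axioms equalityI C.generate_in_carrier[OF S] subsetI)
    fix m assume "m \<in> carrier (corner i M)"
    then show "m \<in> generate (add_monoid (corner i M)) ?S" by (rule generate.incl[OF mem])
  qed
  have "finite_dim K (corner i M)"
  proof (rule finite_dim_sum_images[where F = "{()}" and N = "\<lambda>_. M" and \<iota> = "\<lambda>_ m. act M m (P (rep i))"])
    show "(\<lambda>m. act M m (P (rep i))) \<in> linear_maps K M (corner i M)"
      using r M.act_mult[of _ "P (rep i)" "P (rep i)", symmetric] rep(1)[OF i]
      by (intro linear_mapsI) (simp_all add: M.act_closed M.act_add_left M.act_smult_left P_mult)
    show "\<exists>n. (\<forall>v\<in>{()}. n v \<in> carrier M) \<and>
        m = finsum (corner i M) (\<lambda>v. act M (n v) (P (rep i))) {()}" if "m \<in> carrier (corner i M)" for m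
      using that by (intro exI[of _ "\<lambda>_. m"]) (auto simp: Pi_def)
  qed (use M.modules C.modules fd_modules_Obj(3)[OF M] in auto)
  then show ?thesis using unital by (simp add: fd_modules_def)
qed

abbreviation Fo :: "('k, 'a, 'u) rmodule \<Rightarrow> 'i \<Rightarrow> ('k, 'b, 'u) rmodule" where
  "Fo M \<equiv> \<lambda>i\<in>I. corner i M"

abbreviation Fm :: "('k, 'a, 'u) rmodule \<Rightarrow> ('k, 'a, 'u) rmodule \<Rightarrow> ('u \<Rightarrow> 'u) \<Rightarrow> 'i \<Rightarrow> 'u \<Rightarrow> 'u" where
  "Fm M N f \<equiv> \<lambda>i\<in>I. restrict f (carrier (corner i M))"

text \<open>A nonzero corner at \<open>i\<close> puts \<open>rep i\<close> into the finite support
  of \<open>M\<close>, and \<open>rep\<close> is injective because \<open>cls\<close> undoes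
  it.\<close>

lemma Fo_in_Obj:
  fixes M :: "('k, 'a, 'u) rmodule"
  assumes M: "M \<in> Obj (fd_modules K A)"
  shows "Fo M \<in> Obj (direct_sum_cat (fd_modules K B) I)"
proof -
  interpret M: right_module K A M by (rule fd_modules_Obj(1)[OF M])
  have "rep ` {i \<in> I. \<not> zero_object (fd_modules K B) (corner i M)} \<subseteq> supp M"
  proof
    fix v assume "v \<in> rep ` {i \<in> I. \<not> zero_object (fd_modules K B) (corner i M)}"
    then obtain i where i: "v = rep i" "i \<in> I" "\<not> zero_object (fd_modules K B) (corner i M)" by blast
    have "carrier (corner i M) \<noteq> {\<zero>\<^bsub>M\<^esub>}"
      using zero_object_fd_modules[OF corner_fd[OF M i(2)]] i(3) by simp
    moreover have "\<zero>\<^bsub>M\<^esub> \<in> carrier (corner i M)"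
      using M.act_zero_left P_closed[OF rep(1)[OF i(2)]] by simp
    ultimately obtain m where "m \<in> carrier (corner i M)" "m \<noteq> \<zero>\<^bsub>M\<^esub>" by blast
    then have "m \<in> carrier M" "act M m (P v) \<noteq> \<zero>\<^bsub>M\<^esub>" using i(1) by auto
    then show "v \<in> supp M" using i rep(1) by (auto simp: supp_def)
  qed
  then have "finite (rep ` {i \<in> I. \<not> zero_object (fd_modules K B) (corner i M)})"
    using finite_supp[OF M] finite_subset by blast
  moreover have "inj_on rep {i \<in> I. \<not> zero_object (fd_modules K B) (corner i M)}"
    by (rule inj_on_inverseI[where g = cls]) (simp add: rep)
  ultimately have "finite {i \<in> I. \<not> zero_object (fd_modules K B) (corner i M)}"
    by (rule finite_imageD)
  moreover have "{i \<in> I. \<not> zero_object (fd_modules K B) (Fo M i)}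
      = {i \<in> I. \<not> zero_object (fd_modules K B) (corner i M)}" by auto
  ultimately show ?thesis using corner_fd[OF M] by (simp add: direct_sum_cat_def)
qed

lemma restrict_corner_hom:
  fixes M N :: "('k, 'a, 'u) rmodule"
  assumes M: "right_module K A M" and f: "f \<in> module_homs K A M N" and i: "i \<in> I"
  shows "restrict f (carrier (corner i M)) \<in> module_homs K B (corner i M) (corner i N)"
proof (rule restrict_module_homs[OF corner_module[OF M i]])
  note r = P_closed[OF rep(1)[OF i]]
  show "f \<in> linear_maps K (corner i M) (corner i N)"
    using module_homsD(3,4)[OF f] r linear_maps_add[OF module_homsD(1)[OF f]]
      linear_maps_smult[OF module_homsD(1)[OF f]]
    by (intro linear_mapsI) (simp_all, metis)
qed (use module_homsD(4)[OF f] \<theta>_closed[OF i] in simp)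

lemma Fm_functor: "cat_functor (fd_modules K A :: (('k, 'a, 'u) rmodule, 'u \<Rightarrow> 'u) cat)
    (direct_sum_cat (fd_modules K B) I) Fo Fm"
proof (intro cat_functor.intro cat_functor_axioms.intro category_fd_modules category_direct_sum_cat)
  fix X :: "('k, 'a, 'u) rmodule" assume X: "X \<in> Obj (fd_modules K A)"
  then show "Fo X \<in> Obj (direct_sum_cat (fd_modules K B) I)" by (rule Fo_in_Obj)
  show "Fm X X (Idn (fd_modules K A) X) = Idn (direct_sum_cat (fd_modules K B) I) (Fo X)"
    by (auto simp: fd_modules_def direct_sum_cat_def fun_eq_iff)
  fix Y :: "('k, 'a, 'u) rmodule" assume Y: "Y \<in> Obj (fd_modules K A)"
  fix f assume "f \<in> Hom (fd_modules K A) X Y"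
  then have f: "f \<in> module_homs K A X Y" by (simp add: fd_modules_def)
  then show "Fm X Y f \<in> Hom (direct_sum_cat (fd_modules K B) I) (Fo X) (Fo Y)"
    using restrict_corner_hom[OF fd_modules_Obj(1)[OF X]] by (auto simp: direct_sum_cat_def fd_modules_def)
  fix Z :: "('k, 'a, 'u) rmodule" and g
  have "f x \<in> carrier (corner i Y)" if "i \<in> I" "x \<in> carrier (corner i X)" for i x
    using module_homsD(3)[OF restrict_corner_hom[OF fd_modules_Obj(1)[OF X] f that(1)] that(2)] that(2) by simp
  then show "Fm X Z (Cmp (fd_modules K A) X Y Z g f)
      = Cmp (direct_sum_cat (fd_modules K B) I) (Fo X) (Fo Y) (Fo Z) (Fm Y Z g) (Fm X Y f)"
    by (auto simp: direct_sum_cat_def fd_modules_def compose_def fun_eq_iff simp del: corner_simps(1),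
        auto)
qed

end

text \<open>Coordinates with respect to a finite spanning list embed the module into the lists over
  K, and \<open>\<iota>\<close> carries these into the universe. The structure is copied along the
  resulting injection.\<close>

lemma right_module_transport:
  fixes M\<^sub>0 :: "('k, 'a, 'm) rmodule" and \<iota> :: "'k list \<Rightarrow> 'u"
  assumes M\<^sub>0: "right_module K A M\<^sub>0" and fd: "finite_dim K M\<^sub>0"
    and \<iota>: "inj_on \<iota> (lists (carrier K))"
  obtains M :: "('k, 'a, 'u) rmodule" and h where "right_module K A M" "inj_on h (carrier M\<^sub>0)"
    "carrier M = h ` carrier M\<^sub>0" "h \<in> linear_maps K M\<^sub>0 M"
    "\<And>m a. \<lbrakk>m \<in> carrier M\<^sub>0; a \<in> carrier A\<rbrakk> \<Longrightarrow> act M (h m) a = h (act M\<^sub>0 m a)"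
    "finite_dim K M"
proof -
  interpret M\<^sub>0: right_module K A M\<^sub>0 by fact
  obtain B where B': "finite B \<and> B \<subseteq> carrier M\<^sub>0 \<and>
      (\<forall>m\<in>carrier M\<^sub>0. \<exists>c\<in>B \<rightarrow> carrier K. m = finsum M\<^sub>0 (\<lambda>b. c b \<odot>\<^bsub>M\<^sub>0\<^esub> b) B)"
    using fd unfolding finite_dim_def by (rule exE)
  have B: "finite B" "B \<subseteq> carrier M\<^sub>0"
    and ex: "\<forall>m\<in>carrier M\<^sub>0. \<exists>c\<in>B \<rightarrow> carrier K. m = finsum M\<^sub>0 (\<lambda>b. c b \<odot>\<^bsub>M\<^sub>0\<^esub> b) B"
    using B' by simp_all
  note BM = B(2)
  obtain bs where bs: "set bs = B" using finite_list[OF B(1)] by blast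
  \<comment> \<open>The spanning set may be linearly dependent, so one coordinate family is chosen
    for each vector. A vector can be recovered from its coordinates, so injectivity survives the
    arbitrary choice.\<close>
  define c where "c m = (SOME c. c \<in> B \<rightarrow> carrier K \<and> m = finsum M\<^sub>0 (\<lambda>b. c b \<odot>\<^bsub>M\<^sub>0\<^esub> b) B)" for m
  have c: "c m \<in> B \<rightarrow> carrier K" "m = finsum M\<^sub>0 (\<lambda>b. c m b \<odot>\<^bsub>M\<^sub>0\<^esub> b) B" if "m \<in> carrier M\<^sub>0" for m
  proof -
    have "\<exists>c. c \<in> B \<rightarrow> carrier K \<and> m = finsum M\<^sub>0 (\<lambda>b. c b \<odot>\<^bsub>M\<^sub>0\<^esub> b) B"
      using ex that by (simp add: Bex_def)
    then have "c m \<in> B \<rightarrow> carrier K \<and> m = finsum M\<^sub>0 (\<lambda>b. c m b \<odot>\<^bsub>M\<^sub>0\<^esub> b) B"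
      unfolding c_def by (rule someI_ex)
    then show "c m \<in> B \<rightarrow> carrier K" "m = finsum M\<^sub>0 (\<lambda>b. c m b \<odot>\<^bsub>M\<^sub>0\<^esub> b) B" by blast+
  qed
  define h where "h m = \<iota> (map (c m) bs)" for m
  have inj: "inj_on h (carrier M\<^sub>0)"
  proof (rule inj_onI)
    fix m n assume m: "m \<in> carrier M\<^sub>0" and n: "n \<in> carrier M\<^sub>0" and eq: "h m = h n"
    have "map (c m) bs \<in> lists (carrier K)" "map (c n) bs \<in> lists (carrier K)"
      using c(1)[OF m] c(1)[OF n] bs by auto
    then have "map (c m) bs = map (c n) bs"
      using eq inj_onD[OF \<iota>] unfolding h_def by blast
    then have "c m b = c n b" if "b \<in> B" for b using bs that by auto
    then have "finsum M\<^sub>0 (\<lambda>b. c m b \<odot>\<^bsub>M\<^sub>0\<^esub> b) B = finsum M\<^sub>0 (\<lambda>b. c n b \<odot>\<^bsub>M\<^sub>0\<^esub> b) B"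
      using c(1)[OF n] BM by (intro M\<^sub>0.vs.M.finsum_cong') auto
    then show "m = n" using c(2)[OF m] c(2)[OF n] by simp
  qed
  define g where "g = inv_into (carrier M\<^sub>0) h"
  have gh: "g (h m) = m" if "m \<in> carrier M\<^sub>0" for m
    using inj that by (simp add: g_def inv_into_f_f)
  define M :: "('k, 'a, 'u) rmodule" where
    "M = \<lparr>carrier = h ` carrier M\<^sub>0, mult = undefined, one = undefined, zero = h \<zero>\<^bsub>M\<^sub>0\<^esub>,
      add = (\<lambda>x y. h (g x \<oplus>\<^bsub>M\<^sub>0\<^esub> g y)), smult = (\<lambda>k x. h (k \<odot>\<^bsub>M\<^sub>0\<^esub> g x)),
      act = (\<lambda>x a. h (act M\<^sub>0 (g x) a))\<rparr>"
  have M: "right_module K A M"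
    by (rule right_module_surjective_image[OF M\<^sub>0, of _ h]) (simp_all add: M_def gh)
  then interpret M: right_module K A M .
  have h: "h \<in> linear_maps K M\<^sub>0 M" by (rule linear_mapsI) (simp_all add: M_def gh)
  have "finite_dim K M"
  proof (rule finite_dim_sum_images[where F = "{()}" and N = "\<lambda>_. M\<^sub>0" and \<iota> = "\<lambda>_. h"])
    fix x assume "x \<in> carrier M"
    then obtain m where m: "m \<in> carrier M\<^sub>0" "x = h m" by (auto simp: M_def)
    then show "\<exists>n. (\<forall>v\<in>{()}. n v \<in> carrier M\<^sub>0) \<and> x = finsum M (\<lambda>v. h (n v)) {()}"
      using linear_maps_closed[OF h m(1)] by (intro exI[of _ "\<lambda>_. m"]) (auto simp: Pi_def)
  qed (use h fd M.modules M\<^sub>0.modules in auto)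
  then show ?thesis using that[OF M inj _ h] by (simp add: M_def gh)
qed

section \<open>Full faithfulness of the corner functor\<close>

context corner_algebra
begin

lemma act_W_corner:
  fixes M :: "('k, 'a, 'm) rmodule"
  assumes "right_module K A M" and "m \<in> carrier M" and "v \<in> V"
  shows "act M m (W v) \<in> carrier (corner (cls v) M)"
proof -
  interpret M: right_module K A M by fact
  show ?thesis
    using assms M.act_mult[of m "W v" "P (rep (cls v))"] W[OF assms(3)] P_closed[OF rep(1)[OF cls[OF assms(3)]]]
    by (simp add: M.act_closed)
qed

text \<open>Since \<open>P v = W v U v\<close>, the component of \<open>m\<close> at
  \<open>v\<close> is reached by passing through the corner of its class.\<close>

lemma act_P_eq:
  fixes M :: "('k, 'a, 'm) rmodule"
  assumes "right_module K A M" and "m \<in> carrier M" and "v \<in> V"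
  shows "act M m (P v) = act M (act M m (W v)) (U v)"
proof -
  interpret M: right_module K A M by fact
  show ?thesis
    using assms M.act_mult[of m "W v" "U v"] U(1) W(1) by (simp add: WU)
qed

text \<open>Every \<open>m\<close> is the sum of the vectors \<open>(m W v) U v\<close> over the
  support, and each \<open>m W v\<close> lies in a corner. A homomorphism is therefore determined by
  its restrictions to the corners.\<close>

lemma Fm_inj_on:
  fixes M N :: "('k, 'a, 'u) rmodule"
  assumes M: "M \<in> Obj (fd_modules K A)" and N: "N \<in> Obj (fd_modules K A)"
  shows "inj_on (Fm M N) (module_homs K A M N)"
proof (rule inj_onI)
  interpret M: right_module K A M by (rule fd_modules_Obj(1)[OF M])
  interpret N: right_module K A N by (rule fd_modules_Obj(1)[OF N])
  fix f f' assume f: "f \<in> module_homs K A M N" and f': "f' \<in> module_homs K A M N"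
    and eq: "Fm M N f = Fm M N f'"
  have corner_eq: "f x = f' x" if "i \<in> I" "x \<in> carrier (corner i M)" for i x
    using fun_cong[OF fun_cong[OF eq, of i], of x] that by simp
  have dec: "g m = finsum N (\<lambda>v. act N (g (act M m (W v))) (U v)) (supp M)"
    if g: "g \<in> module_homs K A M N" and m: "m \<in> carrier M" for g m
  proof -
    have S: "v \<in> V" if "v \<in> supp M" for v using that by (simp add: supp_def)
    have "g m = g (finsum M (\<lambda>v. act M m (P v)) (supp M))"
      using supp_decomposition[OF M m] by simp
    also have "\<dots> = finsum N (\<lambda>v. g (act M m (P v))) (supp M)"
      using M.act_closed[OF m P_closed[OF S]]
      by (intro linear_maps_finsum[OF module_homsD(1)[OF g] M.modules(2) N.modules(2)]) auto
    also have "\<dots> = finsum N (\<lambda>v. act N (g (act M m (W v))) (U v)) (supp M)"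
    proof (rule N.vs.M.finsum_cong')
      fix v assume "v \<in> supp M"
      then have v: "v \<in> V" by (rule S)
      show "g (act M m (P v)) = act N (g (act M m (W v))) (U v)"
        unfolding act_P_eq[OF M.right_module_axioms m v]
        by (rule module_homsD(4)[OF g M.act_closed[OF m W(1)[OF v]] U(1)[OF v]])
    next
      show "(\<lambda>v. act N (g (act M m (W v))) (U v)) \<in> supp M \<rightarrow> carrier N"
        using N.act_closed[OF module_homsD(3)[OF g M.act_closed[OF m W(1)[OF S]]] U(1)[OF S]] by blast
    qed simp
    finally show ?thesis .
  qed
  show "f = f'"
  proof (rule extensionalityI[OF module_homsD(2)[OF f] module_homsD(2)[OF f']])
    fix m assume m: "m \<in> carrier M"
    have "finsum N (\<lambda>v. act N (f (act M m (W v))) (U v)) (supp M)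
        = finsum N (\<lambda>v. act N (f' (act M m (W v))) (U v)) (supp M)"
    proof (rule N.vs.M.finsum_cong')
      fix v assume "v \<in> supp M"
      then have v: "v \<in> V" by (simp add: supp_def)
      show "act N (f (act M m (W v))) (U v) = act N (f' (act M m (W v))) (U v)"
        using corner_eq[OF cls[OF v] act_W_corner[OF M.right_module_axioms m v]] by simp
    next
      show "(\<lambda>v. act N (f' (act M m (W v))) (U v)) \<in> supp M \<rightarrow> carrier N"
        using N.act_closed[OF module_homsD(3)[OF f' M.act_closed[OF m W(1)]] U(1)]
        by (auto simp: supp_def)
    qed simp
    then show "f m = f' m" using dec[OF f m] dec[OF f' m] by simp
  qed
qed

text \<open>The decomposition behind injectivity dictates the extension of \<open>g\<close>. What
  has to be shown is that the extended map commutes with the whole algebra.\<close>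

lemma Fm_surj:
  fixes M N :: "('k, 'a, 'u) rmodule"
  assumes M: "M \<in> Obj (fd_modules K A)" and N: "N \<in> Obj (fd_modules K A)"
    and g: "\<And>i. i \<in> I \<Longrightarrow> g i \<in> module_homs K B (corner i M) (corner i N)"
  obtains f where "f \<in> module_homs K A M N"
    "\<And>i. i \<in> I \<Longrightarrow> restrict f (carrier (corner i M)) = g i"
proof -
  interpret M: right_module K A M by (rule fd_modules_Obj(1)[OF M])
  interpret N: right_module K A N by (rule fd_modules_Obj(1)[OF N])
  have S: "v \<in> V" if "v \<in> supp M" for v using that by (simp add: supp_def)
  have g_closed: "g i x \<in> carrier N" "act N (g i x) (P (rep i)) = g i x"
    if "i \<in> I" "x \<in> carrier (corner i M)" for i x
    using module_homsD(3)[OF g[OF that(1)] that(2)] by simp_all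
  have g_zero: "g i \<zero>\<^bsub>M\<^esub> = \<zero>\<^bsub>N\<^esub>" if i: "i \<in> I" for i
    using linear_maps_zero[OF module_homsD(1)[OF g[OF i]]
        right_module.modules(2)[OF corner_module[OF M.right_module_axioms i]]
        right_module.modules(2)[OF corner_module[OF N.right_module_axioms i]]] by simp
  \<comment> \<open>Carry each component of \<open>m\<close> into the corner by \<open>W v\<close>,
    apply \<open>g\<close> there, and bring the result back by \<open>U v\<close>.\<close>
  define f where "f m = finsum N (\<lambda>v. act N (g (cls v) (act M m (W v))) (U v)) (supp M)" for m
  note mW = act_W_corner[OF M.right_module_axioms]
  have term_closed: "act N (g (cls v) (act M m (W v))) (U v) \<in> carrier N"
    if "m \<in> carrier M" "v \<in> V" for m v
    using that by (intro N.act_closed g_closed(1) cls mW U)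
  have f_lin: "f \<in> linear_maps K M N"
    unfolding f_def
  proof (rule linear_maps_finsum_map[OF N.modules(2)])
    fix v assume "v \<in> supp M"
    then have v: "v \<in> V" by (rule S)
    have 1: "(\<lambda>m. act M m (W v)) \<in> linear_maps K M (corner (cls v) M)"
      using mW[OF _ v] W(1)[OF v] by (intro linear_mapsI) (simp_all add: M.act_add_left M.act_smult_left)
    have 2: "(\<lambda>n. act N n (U v)) \<in> linear_maps K (corner (cls v) N) N"
      using U(1)[OF v]
      by (intro linear_mapsI) (simp_all add: N.act_add_left N.act_smult_left N.act_closed)
    show "(\<lambda>m. act N (g (cls v) (act M m (W v))) (U v)) \<in> linear_maps K M N"
      by (rule linear_maps_comp[OF linear_maps_comp[OF 1 module_homsD(1)[OF g[OF cls[OF v]]]] 2])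
  qed
  have f_closed: "f m \<in> carrier N" if "m \<in> carrier M" for m
    by (rule linear_maps_closed[OF f_lin that])
  \<comment> \<open>For \<open>y\<close> in a corner the vector \<open>y U w\<close> has a single
    component: \<open>U w W v\<close> vanishes for \<open>v \<noteq> w\<close>, and
    \<open>U w W w\<close> is the idempotent that fixes \<open>y\<close>. So one summand of
    \<open>f\<close> survives.\<close>
  have f_U: "f (act M y (U w)) = act N (g (cls w) y) (U w)"
    if w: "w \<in> V" and y: "y \<in> carrier (corner (cls w) M)" for w y
  proof -
    have yM: "y \<in> carrier M" and yP: "act M y (P (rep (cls w))) = y" using y by simp_all
    let ?z = "act M y (U w)"
    have z: "?z \<in> carrier M" using M.act_closed[OF yM U(1)[OF w]] .
    have zW: "act M ?z (W v) = (if v = w then y else \<zero>\<^bsub>M\<^esub>)" if v: "v \<in> V" for v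
      using M.act_mult[OF yM U(1)[OF w] W(1)[OF v], symmetric] UW_orthogonal[OF w v] UW[OF w] yP
        M.act_zero_right[OF yM] by auto
    show ?thesis unfolding f_def
    proof (rule N.vs.M.finsum_one_term[OF finite_supp[OF M], of w])
      fix v assume v: "v \<in> supp M" "v \<noteq> w"
      then show "act N (g (cls v) (act M ?z (W v))) (U v) = \<zero>\<^bsub>N\<^esub>"
        using zW[OF S[OF v(1)]] g_zero[OF cls[OF S[OF v(1)]]] N.act_zero_left[OF U(1)[OF S[OF v(1)]]] by simp
    next
      show "act N (g (cls w) y) (U w) \<in> carrier N"
        by (intro N.act_closed g_closed(1) cls w y U)
      show "act N (g (cls w) (act M ?z (W w))) (U w) = act N (g (cls w) y) (U w)"
        using zW[OF w] by simp
      \<comment> \<open>The expected summand is then absent from the sum. But \<open>y\<close>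
        equals \<open>(y U w) P w W w\<close>, which is zero here, so the value to be produced is
        zero as well.\<close>
      assume "w \<notin> supp M"
      then have "act M ?z (P w) = \<zero>\<^bsub>M\<^esub>" using act_zero_outside_supp[OF w _ z] by simp
      then have "act M (act M ?z (P w)) (W w) = \<zero>\<^bsub>M\<^esub>" using M.act_zero_left W(1)[OF w] by simp
      then have "act M ?z (W w) = \<zero>\<^bsub>M\<^esub>"
        using M.act_mult[OF z P_closed[OF w] W(1)[OF w]] W(2)[OF w] by simp
      then have "y = \<zero>\<^bsub>M\<^esub>" using zW[OF w] by simp
      then show "act N (g (cls w) y) (U w) = \<zero>\<^bsub>N\<^esub>"
        using g_zero[OF cls[OF w]] N.act_zero_left[OF U(1)[OF w]] by simp
    qed
  qed
  \<comment> \<open>The counterpart of \<open>f_U\<close>: applying \<open>W v\<close> to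
    \<open>f m\<close> isolates the summand at \<open>v\<close>, because the elements
    \<open>U v' W v\<close> vanish for \<open>v' \<noteq> v\<close>.\<close>
  have f_W: "act N (f m) (W v) = g (cls v) (act M m (W v))" if m: "m \<in> carrier M" and v: "v \<in> V" for m v
  proof -
    have "act N (f m) (W v)
        = finsum N (\<lambda>v'. act N (act N (g (cls v') (act M m (W v'))) (U v')) (W v)) (supp M)"
      unfolding f_def using term_closed[OF m S] W(1)[OF v] by (intro N.act_finsum_left) auto
    also have "\<dots> = g (cls v) (act M m (W v))"
    proof (rule N.vs.M.finsum_one_term[OF finite_supp[OF M], of v])
      fix v' assume v': "v' \<in> supp M" "v' \<noteq> v"
      note c = g_closed(1)[OF cls[OF S[OF v'(1)]] mW[OF m S[OF v'(1)]]]
      show "act N (act N (g (cls v') (act M m (W v'))) (U v')) (W v) = \<zero>\<^bsub>N\<^esub>"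
        using N.act_mult[OF c U(1)[OF S[OF v'(1)]] W(1)[OF v], symmetric]
          UW_orthogonal[OF S[OF v'(1)] v v'(2)] N.act_zero_right[OF c] by simp
    next
      note c = g_closed[OF cls[OF v] mW[OF m v]]
      show "g (cls v) (act M m (W v)) \<in> carrier N" by (rule c)
      show "act N (act N (g (cls v) (act M m (W v))) (U v)) (W v) = g (cls v) (act M m (W v))"
        using N.act_mult[OF c(1) U(1)[OF v] W(1)[OF v], symmetric] UW[OF v] c(2) by simp
      assume "v \<notin> supp M"
      then have "act M m (P v) = \<zero>\<^bsub>M\<^esub>" using act_zero_outside_supp[OF v _ m] by simp
      then have "act M m (W v) = \<zero>\<^bsub>M\<^esub>"
        using M.act_mult[OF m P_closed[OF v] W(1)[OF v]] W(2)[OF v] M.act_zero_left[OF W(1)[OF v]] by simp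
      then show "g (cls v) (act M m (W v)) = \<zero>\<^bsub>N\<^esub>" using g_zero[OF cls[OF v]] by simp
    qed
    finally show ?thesis .
  qed
  \<comment> \<open>The elements commuting with \<open>f\<close> are closed under addition, so by
    \<open>spanning\<close> it suffices to treat the products of \<open>W v\<close>,
    \<open>\<theta> b\<close> and \<open>U w\<close>. There \<open>f_W\<close>, linearity of
    \<open>g\<close> over \<open>B\<close> and \<open>f_U\<close> take care of the three factors in
    turn.\<close>
  have "carrier A \<subseteq> {a \<in> carrier A. \<forall>m\<in>carrier M. f (act M m a) = act N (f m) a}"
  proof (rule spanning)
    show "\<zero>\<^bsub>A\<^esub> \<in> {a \<in> carrier A. \<forall>m\<in>carrier M. f (act M m a) = act N (f m) a}"
      using M.act_zero_right N.act_zero_right f_closed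
        linear_maps_zero[OF f_lin M.modules(2) N.modules(2)] by simp
    show "x \<oplus>\<^bsub>A\<^esub> y \<in> {a \<in> carrier A. \<forall>m\<in>carrier M. f (act M m a) = act N (f m) a}"
      if "x \<in> {a \<in> carrier A. \<forall>m\<in>carrier M. f (act M m a) = act N (f m) a}"
        "y \<in> {a \<in> carrier A. \<forall>m\<in>carrier M. f (act M m a) = act N (f m) a}" for x y
      using that by (simp add: M.act_add_right N.act_add_right f_closed M.act_closed linear_maps_add[OF f_lin])
    fix v w b assume v: "v \<in> V" and w: "w \<in> V" and vw: "cls v = cls w" and b: "b \<in> carrier B"
    let ?i = "cls v"
    note i = cls[OF v]
    note cl = W(1)[OF v] \<theta>_closed[OF i b] U(1)[OF w]
    have "f (act M m (W v \<otimes>\<^bsub>A\<^esub> (\<theta> ?i b \<otimes>\<^bsub>A\<^esub> U w))) = act N (f m) (W v \<otimes>\<^bsub>A\<^esub> (\<theta> ?i b \<otimes>\<^bsub>A\<^esub> U w))"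
      if m: "m \<in> carrier M" for m
    proof -
      let ?x = "act M m (W v)"
      have x: "?x \<in> carrier (corner ?i M)" by (rule mW[OF m v])
      have y: "act (corner ?i M) ?x b \<in> carrier (corner ?i M)"
        by (rule right_module.act_closed[OF corner_module[OF M.right_module_axioms i] x b])
      have "act M m (W v \<otimes>\<^bsub>A\<^esub> (\<theta> ?i b \<otimes>\<^bsub>A\<^esub> U w)) = act M (act (corner ?i M) ?x b) (U w)"
        using m cl M.act_closed[OF m cl(1)] by (simp add: M.act_mult mult_closed)
      then have "f (act M m (W v \<otimes>\<^bsub>A\<^esub> (\<theta> ?i b \<otimes>\<^bsub>A\<^esub> U w)))
          = act N (g ?i (act (corner ?i M) ?x b)) (U w)"
        using f_U[OF w] y vw by simp
      also have "\<dots> = act N (act N (act N (f m) (W v)) (\<theta> ?i b)) (U w)"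
        using module_homsD(4)[OF g[OF i] x b] f_W[OF m v] by simp
      also have "\<dots> = act N (f m) (W v \<otimes>\<^bsub>A\<^esub> (\<theta> ?i b \<otimes>\<^bsub>A\<^esub> U w))"
        using f_closed[OF m] cl N.act_closed[OF f_closed[OF m] cl(1)] by (simp add: N.act_mult mult_closed)
      finally show ?thesis .
    qed
    then show "W v \<otimes>\<^bsub>A\<^esub> (\<theta> ?i b \<otimes>\<^bsub>A\<^esub> U w) \<in> {a \<in> carrier A. \<forall>m\<in>carrier M. f (act M m a) = act N (f m) a}"
      using cl by (simp add: mult_closed)
  qed auto
  then have f_act: "f (act M m a) = act N (f m) a" if "m \<in> carrier M" "a \<in> carrier A" for m a
    using that by blast
  show ?thesis
  proof (rule that)
    show "restrict f (carrier M) \<in> module_homs K A M N"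
      by (rule restrict_module_homs[OF M.right_module_axioms f_lin f_act])
    fix i assume i: "i \<in> I"
    show "restrict (restrict f (carrier M)) (carrier (corner i M)) = g i"
    proof (rule extensionalityI[OF _ module_homsD(2)[OF g[OF i]]])
      fix y assume y: "y \<in> carrier (corner i M)"
      then have "act M y (U (rep i)) = y" by (simp add: U(4) i)
      moreover have "act N (g i y) (U (rep i)) = g i y" using g_closed(2)[OF i y] by (simp add: U(4) i)
      ultimately have "f y = g i y" using f_U[OF rep(1)[OF i], of y] y rep(2)[OF i] by simp
      then show "restrict (restrict f (carrier M)) (carrier (corner i M)) y = g i y" using y by simp
    qed (rule restrict_extensional)
  qed
qed

lemma Fm_fully_faithful:
  fixes M N :: "('k, 'a, 'u) rmodule"
  assumes M: "M \<in> Obj (fd_modules K A)" and N: "N \<in> Obj (fd_modules K A)"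
  shows "bij_betw (Fm M N) (Hom (fd_modules K A) M N)
    (Hom (direct_sum_cat (fd_modules K B) I) (Fo M) (Fo N))"
proof -
  have Hom: "Hom (direct_sum_cat (fd_modules K B) I) (Fo M) (Fo N)
      = (\<Pi>\<^sub>E i\<in>I. module_homs K B (corner i M) (corner i N))"
    by (auto simp: direct_sum_cat_def fd_modules_def intro!: PiE_cong)
  have Hom': "Hom (fd_modules K A) M N = module_homs K A M N" by (simp add: fd_modules_def)
  have "Fm M N ` module_homs K A M N = (\<Pi>\<^sub>E i\<in>I. module_homs K B (corner i M) (corner i N))"
  proof (intro equalityI subsetI)
    fix g assume "g \<in> Fm M N ` module_homs K A M N"
    then obtain f where f: "f \<in> module_homs K A M N" "g = Fm M N f" by blast
    show "g \<in> (\<Pi>\<^sub>E i\<in>I. module_homs K B (corner i M) (corner i N))"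
      unfolding f(2) using restrict_corner_hom[OF fd_modules_Obj(1)[OF M] f(1)]
      by (intro restrict_PiE_iff[THEN iffD2] ballI)
  next
    fix g assume g: "g \<in> (\<Pi>\<^sub>E i\<in>I. module_homs K B (corner i M) (corner i N))"
    obtain f where f: "f \<in> module_homs K A M N" "\<And>i. i \<in> I \<Longrightarrow> restrict f (carrier (corner i M)) = g i"
      using Fm_surj[OF M N PiE_mem[OF g]] by blast
    have "g = Fm M N f"
      by (rule extensionalityI[OF _ restrict_extensional]) (use g f(2) in \<open>simp_all add: PiE_iff\<close>)
    then show "g \<in> Fm M N ` module_homs K A M N" using f(1) by blast
  qed
  then show ?thesis unfolding Hom Hom' bij_betw_def using Fm_inj_on[OF M N] by blast
qed

section \<open>Essential surjectivity of the corner functor\<close>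

definition realizes :: "('k, 'a, 'v \<Rightarrow> 'u) rmodule \<Rightarrow> ('i \<Rightarrow> ('k, 'b, 'u) rmodule) \<Rightarrow> bool" where
  "realizes M N \<longleftrightarrow> right_module K A M \<and>
     carrier M = (\<Pi>\<^sub>E v\<in>V. carrier (N (cls v))) \<and>
     \<zero>\<^bsub>M\<^esub> = (\<lambda>v\<in>V. \<zero>\<^bsub>N (cls v)\<^esub>) \<and>
     (\<forall>m\<in>carrier M. \<forall>n\<in>carrier M. m \<oplus>\<^bsub>M\<^esub> n = (\<lambda>v\<in>V. m v \<oplus>\<^bsub>N (cls v)\<^esub> n v)) \<and>
     (\<forall>k\<in>carrier K. \<forall>m\<in>carrier M. k \<odot>\<^bsub>M\<^esub> m = (\<lambda>v\<in>V. k \<odot>\<^bsub>N (cls v)\<^esub> m v)) \<and>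
     (\<forall>m\<in>carrier M. \<forall>v\<in>V. act M m (P v) = (\<lambda>w\<in>V. if w = v then m w else \<zero>\<^bsub>N (cls w)\<^esub>)) \<and>
     (\<forall>m\<in>carrier M. \<forall>i\<in>I. \<forall>b\<in>carrier B. act M m (\<theta> i b) (rep i) = act (N i) (m (rep i)) b)"

text \<open>The corner of the product module at \<open>i\<close> consists of the families
  concentrated at \<open>rep i\<close>, which form a copy of \<open>N i\<close>; this is why
  \<open>realizes\<close> prescribes the action of the \<open>P v\<close> and of
  \<open>\<theta> i\<close> at \<open>rep i\<close>. The product lives on functions from vertices
  and is moved to the universe by \<open>right_module_transport\<close>.\<close>

lemma realizes_imp_essential_image:
  fixes N :: "'i \<Rightarrow> ('k, 'b, 'u) rmodule" and \<iota> :: "'k list \<Rightarrow> 'u"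
  assumes N: "N \<in> Obj (direct_sum_cat (fd_modules K B) I)" and real: "realizes M\<^sub>0 N"
    and \<iota>: "inj_on \<iota> (lists (carrier K))"
  obtains M \<phi> where "M \<in> Obj (fd_modules K A)"
    "iso_morphism (direct_sum_cat (fd_modules K B) I) (Fo M) N \<phi>"
    "\<And>i. i \<in> I \<Longrightarrow> bij_betw (\<phi> i) (carrier (corner i M)) (carrier (N i))"
proof -
  have NI: "N i \<in> Obj (fd_modules K B)" if "i \<in> I" for i
    using N that by (auto simp: direct_sum_cat_def)
  note Nmod = fd_modules_Obj(1)[OF NI]
  have M\<^sub>0: "right_module K A M\<^sub>0" and carrier: "carrier M\<^sub>0 = (\<Pi>\<^sub>E v\<in>V. carrier (N (cls v)))"
    and zero: "\<zero>\<^bsub>M\<^sub>0\<^esub> = (\<lambda>v\<in>V. \<zero>\<^bsub>N (cls v)\<^esub>)"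
    and add: "\<And>m n. \<lbrakk>m \<in> carrier M\<^sub>0; n \<in> carrier M\<^sub>0\<rbrakk> \<Longrightarrow> m \<oplus>\<^bsub>M\<^sub>0\<^esub> n = (\<lambda>v\<in>V. m v \<oplus>\<^bsub>N (cls v)\<^esub> n v)"
    and smult: "\<And>k m. \<lbrakk>k \<in> carrier K; m \<in> carrier M\<^sub>0\<rbrakk> \<Longrightarrow> k \<odot>\<^bsub>M\<^sub>0\<^esub> m = (\<lambda>v\<in>V. k \<odot>\<^bsub>N (cls v)\<^esub> m v)"
    and actP: "\<And>m v. \<lbrakk>m \<in> carrier M\<^sub>0; v \<in> V\<rbrakk>
      \<Longrightarrow> act M\<^sub>0 m (P v) = (\<lambda>w\<in>V. if w = v then m w else \<zero>\<^bsub>N (cls w)\<^esub>)"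
    and act\<theta>: "\<And>m i b. \<lbrakk>m \<in> carrier M\<^sub>0; i \<in> I; b \<in> carrier B\<rbrakk>
      \<Longrightarrow> act M\<^sub>0 m (\<theta> i b) (rep i) = act (N i) (m (rep i)) b"
    using real by (auto simp: realizes_def)
  interpret M\<^sub>0: right_module K A M\<^sub>0 by (rule M\<^sub>0)
  have Ncm: "Module.module K (N (cls v))" if "v \<in> V" for v
    by (rule right_module.modules(2)[OF Nmod[OF cls[OF that]]])
  have Nz: "\<zero>\<^bsub>N (cls v)\<^esub> \<in> carrier (N (cls v))" if "v \<in> V" for v
  proof -
    interpret Nv: Module.module K "N (cls v)" by (rule Ncm[OF that])
    show ?thesis by (rule Nv.M.zero_closed)
  qed
  define \<epsilon> where "\<epsilon> v n = (\<lambda>w\<in>V. if w = v then n else \<zero>\<^bsub>N (cls w)\<^esub>)" for v n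
  have eval: "(\<lambda>m. m w) \<in> linear_maps K M\<^sub>0 (N (cls w))" if "w \<in> V" for w
    using that by (intro linear_mapsI) (auto simp: carrier add smult)
  have \<epsilon>_closed: "\<epsilon> v n \<in> carrier M\<^sub>0" if "v \<in> V" "n \<in> carrier (N (cls v))" for v n
    using that Nz by (auto simp: carrier \<epsilon>_def)
  have \<epsilon>: "\<epsilon> v \<in> linear_maps K (N (cls v)) M\<^sub>0" if v: "v \<in> V" for v
  proof (rule linear_mapsI)
    fix n n' assume n: "n \<in> carrier (N (cls v))" "n' \<in> carrier (N (cls v))"
    show "\<epsilon> v (n \<oplus>\<^bsub>N (cls v)\<^esub> n') = \<epsilon> v n \<oplus>\<^bsub>M\<^sub>0\<^esub> \<epsilon> v n'"
    proof
      fix w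
      show "\<epsilon> v (n \<oplus>\<^bsub>N (cls v)\<^esub> n') w = (\<epsilon> v n \<oplus>\<^bsub>M\<^sub>0\<^esub> \<epsilon> v n') w"
      proof (cases "w \<in> V")
        case True
        interpret Nw: Module.module K "N (cls w)" by (rule Ncm[OF True])
        show ?thesis using True \<epsilon>_closed[OF v] n by (simp add: add) (simp add: \<epsilon>_def)
      qed (use \<epsilon>_closed[OF v] n in \<open>simp add: add, simp add: \<epsilon>_def\<close>)
    qed
  next
    fix k n assume n: "k \<in> carrier K" "n \<in> carrier (N (cls v))"
    show "\<epsilon> v (k \<odot>\<^bsub>N (cls v)\<^esub> n) = k \<odot>\<^bsub>M\<^sub>0\<^esub> \<epsilon> v n"
    proof
      fix w
      show "\<epsilon> v (k \<odot>\<^bsub>N (cls v)\<^esub> n) w = (k \<odot>\<^bsub>M\<^sub>0\<^esub> \<epsilon> v n) w"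
      proof (cases "w \<in> V")
        case True
        interpret Nw: Module.module K "N (cls w)" by (rule Ncm[OF True])
        show ?thesis using True \<epsilon>_closed[OF v] n by (simp add: smult) (simp add: \<epsilon>_def)
      qed (use \<epsilon>_closed[OF v] n in \<open>simp add: smult, simp add: \<epsilon>_def\<close>)
    qed
  qed (rule \<epsilon>_closed[OF v])
  \<comment> \<open>The vertices that carry a nonzero space. They are finitely many, since finitely
    many \<open>N i\<close> are nonzero and each class has finitely many vertices. The full product
    is thereby a finite direct sum, and finite dimensional.\<close>
  define F where "F = {v \<in> V. carrier (N (cls v)) \<noteq> {\<zero>\<^bsub>N (cls v)\<^esub>}}"
  have "F \<subseteq> (\<Union>i\<in>{i \<in> I. \<not> zero_object (fd_modules K B) (N i)}. {v \<in> V. cls v = i})"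
    using zero_object_fd_modules[OF NI[OF cls]] cls by (auto simp: F_def)
  moreover have "finite {i \<in> I. \<not> zero_object (fd_modules K B) (N i)}"
    using N by (simp add: direct_sum_cat_def)
  ultimately have F: "finite F"
    by (rule finite_subset[OF _ finite_UN_I]) (simp add: finite_cls)
  have FV: "v \<in> V" if "v \<in> F" for v using that by (simp add: F_def)
  have actP_\<epsilon>: "act M\<^sub>0 m (P v) = \<epsilon> v (m v)" if "m \<in> carrier M\<^sub>0" "v \<in> V" for m v
    using that by (auto simp: actP \<epsilon>_def fun_eq_iff)
  have mv: "m v \<in> carrier (N (cls v))" if "m \<in> carrier M\<^sub>0" "v \<in> V" for m v
    using that by (auto simp: carrier)
  have dec: "m = finsum M\<^sub>0 (\<lambda>v. \<epsilon> v (m v)) F" if m: "m \<in> carrier M\<^sub>0" for m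
  proof -
    have fc: "finsum M\<^sub>0 (\<lambda>v. \<epsilon> v (m v)) F \<in> carrier M\<^sub>0"
      using \<epsilon>_closed mv[OF m] FV by (intro M\<^sub>0.vs.M.finsum_closed) auto
    show ?thesis
    proof (rule extensionalityI)
      show "m \<in> extensional V" "finsum M\<^sub>0 (\<lambda>v. \<epsilon> v (m v)) F \<in> extensional V"
        using m fc by (auto simp: carrier PiE_iff)
      fix w assume w: "w \<in> V"
      interpret Nw: Module.module K "N (cls w)" by (rule Ncm[OF w])
      have "finsum M\<^sub>0 (\<lambda>v. \<epsilon> v (m v)) F w = finsum (N (cls w)) (\<lambda>v. \<epsilon> v (m v) w) F"
        using \<epsilon>_closed mv[OF m] FV
        by (intro linear_maps_finsum[OF eval[OF w] M\<^sub>0.modules(2) Ncm[OF w]]) auto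
      also have "\<dots> = m w"
        by (rule Nw.M.finsum_one_term[OF F, of w]) (use w mv[OF m w] in \<open>auto simp: \<epsilon>_def F_def\<close>)
      finally show "m w = finsum M\<^sub>0 (\<lambda>v. \<epsilon> v (m v)) F w" ..
    qed
  qed
  have "finite_dim K M\<^sub>0"
  proof (rule finite_dim_sum_images[OF M\<^sub>0.modules(2) F, of "\<lambda>v. N (cls v)" \<epsilon>])
    show "\<exists>n. (\<forall>v\<in>F. n v \<in> carrier (N (cls v))) \<and> m = finsum M\<^sub>0 (\<lambda>v. \<epsilon> v (n v)) F"
      if "m \<in> carrier M\<^sub>0" for m
      using dec[OF that] mv[OF that FV] by (intro exI[of _ m]) blast
  qed (simp_all add: FV Ncm \<epsilon> fd_modules_Obj(3)[OF NI] cls)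
  then obtain M :: "('k, 'a, 'u) rmodule" and h where M: "right_module K A M"
    and inj: "inj_on h (carrier M\<^sub>0)" and cM: "carrier M = h ` carrier M\<^sub>0"
    and h: "h \<in> linear_maps K M\<^sub>0 M"
    and acth: "\<And>m a. \<lbrakk>m \<in> carrier M\<^sub>0; a \<in> carrier A\<rbrakk> \<Longrightarrow> act M (h m) a = h (act M\<^sub>0 m a)"
    and fdM: "finite_dim K M"
    using right_module_transport[OF M\<^sub>0 _ \<iota>] by blast
  interpret M: right_module K A M by (rule M)
  have hc: "h m \<in> carrier M" if "m \<in> carrier M\<^sub>0" for m using that by (simp add: cM)
  have "unital_module K A M"
  proof (rule unital_moduleI[OF M])
    show "F \<subseteq> V" by (auto simp: F_def)
    fix x assume "x \<in> carrier M"
    then obtain m where m: "m \<in> carrier M\<^sub>0" "x = h m" by (auto simp: cM)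
    have "x = h (finsum M\<^sub>0 (\<lambda>v. \<epsilon> v (m v)) F)" using dec[OF m(1)] m(2) by simp
    also have "\<dots> = finsum M (\<lambda>v. h (\<epsilon> v (m v))) F"
      using \<epsilon>_closed mv[OF m(1)] FV by (intro linear_maps_finsum[OF h M\<^sub>0.modules(2) M.modules(2)]) auto
    also have "\<dots> = finsum M (\<lambda>v. act M x (P v)) F"
    proof (rule M.vs.M.finsum_cong')
      fix v assume "v \<in> F"
      then have v: "v \<in> V" by (rule FV)
      show "h (\<epsilon> v (m v)) = act M x (P v)"
        unfolding m(2) acth[OF m(1) P_closed[OF v]] actP_\<epsilon>[OF m(1) v] ..
    next
      show "(\<lambda>v. act M x (P v)) \<in> F \<rightarrow> carrier M"
        using M.act_closed[OF hc[OF m(1)] P_closed[OF FV]] m(2) by auto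
    qed simp
    finally show "x = finsum M (\<lambda>v. act M x (P v)) F" .
  qed
  then have MObj: "M \<in> Obj (fd_modules K A)" using fdM by (simp add: fd_modules_def)
  define g where "g = inv_into (carrier M\<^sub>0) h"
  have gh: "g (h m) = m" if "m \<in> carrier M\<^sub>0" for m
    using inj that by (simp add: g_def inv_into_f_f)
  \<comment> \<open>A vector is fixed by \<open>P (rep i)\<close> exactly when its family is
    concentrated at \<open>rep i\<close>; \<open>h\<close> being injective, this can be read off
    before the transport.\<close>
  have cornerE: "\<exists>m\<in>carrier M\<^sub>0. x = h m \<and> m = \<epsilon> (rep i) (m (rep i))"
    if i: "i \<in> I" and x: "x \<in> carrier (corner i M)" for i x
  proof -
    obtain m where m: "m \<in> carrier M\<^sub>0" "x = h m" using x by (auto simp: cM)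
    have "h (\<epsilon> (rep i) (m (rep i))) = h m"
      using x acth[OF m(1) P_closed[OF rep(1)[OF i]]] actP_\<epsilon>[OF m(1) rep(1)[OF i]] m(2) by simp
    then have "\<epsilon> (rep i) (m (rep i)) = m"
      using inj_onD[OF inj] \<epsilon>_closed[OF rep(1)[OF i] mv[OF m(1) rep(1)[OF i]]] m(1) by blast
    then show ?thesis using m by metis
  qed
  define \<phi> where "\<phi> i = restrict (\<lambda>x. g x (rep i)) (carrier (corner i M))" for i
  have hom: "\<phi> i \<in> module_homs K B (corner i M) (N i)" if i: "i \<in> I" for i
    unfolding \<phi>_def
  proof (rule restrict_module_homs[OF corner_module[OF M i]])
    note r = rep(1)[OF i]
    show "(\<lambda>x. g x (rep i)) \<in> linear_maps K (corner i M) (N i)"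
    proof (rule linear_mapsI)
      fix x assume x: "x \<in> carrier (corner i M)"
      then obtain m where m: "m \<in> carrier M\<^sub>0" "x = h m" using cornerE[OF i] by blast
      show "g x (rep i) \<in> carrier (N i)" using mv[OF m(1) r] m gh rep(2)[OF i] by simp
      fix y assume "y \<in> carrier (corner i M)"
      then obtain n where n: "n \<in> carrier M\<^sub>0" "y = h n" using cornerE[OF i] by blast
      have "x \<oplus>\<^bsub>corner i M\<^esub> y = h (m \<oplus>\<^bsub>M\<^sub>0\<^esub> n)" using linear_maps_add[OF h m(1) n(1)] m n by simp
      then show "g (x \<oplus>\<^bsub>corner i M\<^esub> y) (rep i) = g x (rep i) \<oplus>\<^bsub>N i\<^esub> g y (rep i)"
        using gh[OF M\<^sub>0.vs.M.a_closed[OF m(1) n(1)]] gh[OF m(1)] gh[OF n(1)] m n r rep(2)[OF i] by (simp add: add)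
    next
      fix k x assume k: "k \<in> carrier K" and x: "x \<in> carrier (corner i M)"
      then obtain m where m: "m \<in> carrier M\<^sub>0" "x = h m" using cornerE[OF i] by blast
      have "k \<odot>\<^bsub>corner i M\<^esub> x = h (k \<odot>\<^bsub>M\<^sub>0\<^esub> m)" using linear_maps_smult[OF h k m(1)] m by simp
      then show "g (k \<odot>\<^bsub>corner i M\<^esub> x) (rep i) = k \<odot>\<^bsub>N i\<^esub> g x (rep i)"
        using gh[OF M\<^sub>0.vs.smult_closed[OF k m(1)]] gh[OF m(1)] k m r rep(2)[OF i] by (simp add: smult)
    qed
    fix x b assume x: "x \<in> carrier (corner i M)" and b: "b \<in> carrier B"
    obtain m where m: "m \<in> carrier M\<^sub>0" "x = h m" using cornerE[OF i x] by blast
    have "act (corner i M) x b = h (act M\<^sub>0 m (\<theta> i b))"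
      using acth[OF m(1) \<theta>_closed[OF i b]] m(2) by simp
    then show "g (act (corner i M) x b) (rep i) = act (N i) (g x (rep i)) b"
      using gh[OF M\<^sub>0.act_closed[OF m(1) \<theta>_closed[OF i b]]] gh[OF m(1)] act\<theta>[OF m(1) i b] m(2) by simp
  qed
  have bij: "bij_betw (\<phi> i) (carrier (corner i M)) (carrier (N i))" if i: "i \<in> I" for i
  proof (rule bij_betwI')
    note r = rep(1)[OF i]
    fix x y assume x: "x \<in> carrier (corner i M)" and y: "y \<in> carrier (corner i M)"
    obtain m where m: "m \<in> carrier M\<^sub>0" "x = h m" "m = \<epsilon> (rep i) (m (rep i))" using cornerE[OF i x] by blast
    obtain n where n: "n \<in> carrier M\<^sub>0" "y = h n" "n = \<epsilon> (rep i) (n (rep i))" using cornerE[OF i y] by blast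
    have "\<phi> i x = m (rep i)" "\<phi> i y = n (rep i)" using x y m n gh by (simp_all add: \<phi>_def)
    then show "(\<phi> i x = \<phi> i y) = (x = y)" using m n by metis
  next
    fix x assume "x \<in> carrier (corner i M)"
    then show "\<phi> i x \<in> carrier (N i)" by (rule module_homsD(3)[OF hom[OF i]])
  next
    note r = rep(1)[OF i]
    fix n assume n: "n \<in> carrier (N i)"
    then have n': "n \<in> carrier (N (cls (rep i)))" using rep(2)[OF i] by simp
    let ?m = "\<epsilon> (rep i) n"
    have m: "?m \<in> carrier M\<^sub>0" by (rule \<epsilon>_closed[OF r n'])
    have mr: "?m (rep i) = n" using r by (simp add: \<epsilon>_def)
    have "act M (h ?m) (P (rep i)) = h ?m"
      unfolding acth[OF m P_closed[OF r]] actP_\<epsilon>[OF m r] mr ..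
    then have "h ?m \<in> carrier (corner i M)" using hc[OF m] by simp
    moreover have "n = \<phi> i (h ?m)" using calculation gh[OF m] mr by (simp add: \<phi>_def)
    ultimately show "\<exists>x\<in>carrier (corner i M). n = \<phi> i x" by blast
  qed
  have "iso_morphism (direct_sum_cat (fd_modules K B) I) (Fo M) N (\<lambda>i\<in>I. \<phi> i)"
    by (rule iso_morphism_direct_sum_cat)
      (use fd_modules_iso[OF corner_fd[OF MObj] NI hom bij] in simp)
  then show ?thesis using that[OF MObj, of "\<lambda>i\<in>I. \<phi> i"] bij by simp
qed

text \<open>\<open>u\<close> fixes every \<open>m b\<close>, since \<open>b u = b\<close>, and by
  unitality such elements generate the module.\<close>

lemma unit_acts:
  fixes N :: "('k, 'b, 'u) rmodule"
  assumes N: "unital_module K B N" and n: "n \<in> carrier N"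
  shows "act N n u = n"
proof -
  interpret N: right_module K B N using N by (simp add: unital_module_def)
  let ?S = "{act N m a | m a. m \<in> carrier N \<and> a \<in> carrier B}"
  have base: "act N (act N m b) u = act N m b" if "m \<in> carrier N" "b \<in> carrier B" for m b
    using N.act_mult[OF that unit(1)] unit(2)[OF that(2)] by simp
  have "x \<in> carrier N \<and> act N x u = x" if "x \<in> generate (add_monoid N) ?S" for x
    using that
  proof induction
    case one
    then show ?case using N.act_zero_left unit(1) by simp
  next
    case (incl h)
    then show ?case using base N.act_closed by blast
  next
    case (inv h)
    then obtain m b where h: "h = act N m b" "m \<in> carrier N" "b \<in> carrier B" by blast
    have "\<ominus>\<^bsub>N\<^esub> h = (\<ominus>\<^bsub>K\<^esub> \<one>\<^bsub>K\<^esub>) \<odot>\<^bsub>N\<^esub> h" using h N.act_closed by (simp add: N.vs.smult_l_minus)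
    also have "\<dots> = act N ((\<ominus>\<^bsub>K\<^esub> \<one>\<^bsub>K\<^esub>) \<odot>\<^bsub>N\<^esub> m) b" using h by (simp add: N.act_smult_left)
    finally show ?case
      using base[of "(\<ominus>\<^bsub>K\<^esub> \<one>\<^bsub>K\<^esub>) \<odot>\<^bsub>N\<^esub> m" b] N.act_closed[of "(\<ominus>\<^bsub>K\<^esub> \<one>\<^bsub>K\<^esub>) \<odot>\<^bsub>N\<^esub> m" b] h
      by (simp add: a_inv_def)
  next
    case (eng x y)
    then show ?case using N.act_add_left[of x y u] unit(1) by simp
  qed
  then show ?thesis using n N by (auto simp: unital_module_def)
qed

lemma corner_equivalence:
  fixes \<iota> :: "'k list \<Rightarrow> 'u"
  assumes \<iota>: "inj_on \<iota> (lists (carrier K))"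
    and real: "\<And>N :: 'i \<Rightarrow> ('k, 'b, 'u) rmodule.
      (\<And>i. i \<in> I \<Longrightarrow> N i \<in> Obj (fd_modules K B)) \<Longrightarrow> \<exists>M. realizes M N"
  shows "equivalent_cats (fd_modules K A :: (('k, 'a, 'u) rmodule, 'u \<Rightarrow> 'u) cat)
    (direct_sum_cat (fd_modules K B :: (('k, 'b, 'u) rmodule, 'u \<Rightarrow> 'u) cat) I)"
proof -
  have ess: "\<exists>X\<in>Obj (fd_modules K A :: (('k, 'a, 'u) rmodule, 'u \<Rightarrow> 'u) cat).
      \<exists>f. iso_morphism (direct_sum_cat (fd_modules K B) I) (Fo X) N f"
    if N: "N \<in> Obj (direct_sum_cat (fd_modules K B) I)" for N
  proof -
    have "N i \<in> Obj (fd_modules K B)" if "i \<in> I" for i using that N by (auto simp: direct_sum_cat_def)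
    then obtain M\<^sub>0 where "realizes M\<^sub>0 N" using real by blast
    then show ?thesis using realizes_imp_essential_image[OF N _ \<iota>] by metis
  qed
  have "ff_es_functor (fd_modules K A :: (('k, 'a, 'u) rmodule, 'u \<Rightarrow> 'u) cat)
      (direct_sum_cat (fd_modules K B) I) Fo Fm"
    by (rule ff_es_functor.intro[OF Fm_functor ff_es_functor_axioms.intro[OF Fm_fully_faithful ess]])
  then show ?thesis by (rule ff_es_functor.equivalent)
qed

text \<open>\<open>N\<^sub>0\<close> is placed at the index \<open>j\<close> and the zero module
  everywhere else. The module that realizes this family has a corner in bijection with
  \<open>N\<^sub>0\<close>, so it is nonzero.\<close>

lemma nonzero_fd_module:
  fixes \<iota> :: "'k list \<Rightarrow> 'u" and N\<^sub>0 :: "('k, 'b, 'u) rmodule"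
  assumes \<iota>: "inj_on \<iota> (lists (carrier K))" and j: "j \<in> I"
    and real: "\<And>N :: 'i \<Rightarrow> ('k, 'b, 'u) rmodule.
      (\<And>i. i \<in> I \<Longrightarrow> N i \<in> Obj (fd_modules K B)) \<Longrightarrow> \<exists>M. realizes M N"
    and N\<^sub>0: "N\<^sub>0 \<in> Obj (fd_modules K B)" "carrier N\<^sub>0 \<noteq> {\<zero>\<^bsub>N\<^sub>0\<^esub>}"
  shows "\<exists>M\<in>Obj (fd_modules K A :: (('k, 'a, 'u) rmodule, 'u \<Rightarrow> 'u) cat). carrier M \<noteq> {\<zero>\<^bsub>M\<^esub>}"
proof -
  interpret N\<^sub>0: right_module K B N\<^sub>0 by (rule fd_modules_Obj(1)[OF N\<^sub>0(1)])
  \<comment> \<open>A zero module of the required record type, namely the image of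
    \<open>N\<^sub>0\<close> under the constant zero map.\<close>
  define Z where "Z = N\<^sub>0\<lparr>carrier := {\<zero>\<^bsub>N\<^sub>0\<^esub>}\<rparr>"
  have Z_mod: "right_module K B Z"
    by (rule right_module_surjective_image[OF N\<^sub>0.right_module_axioms, of _ "\<lambda>_. \<zero>\<^bsub>N\<^sub>0\<^esub>"])
      (auto simp: Z_def N\<^sub>0.act_zero_left)
  interpret Z: right_module K B Z by (rule Z_mod)
  have Zc: "carrier Z = {\<zero>\<^bsub>Z\<^esub>}" by (simp add: Z_def)
  have "finite_dim K Z" unfolding finite_dim_def by (rule exI[of _ "{}"]) (simp add: Zc)
  moreover have "unital_module K B Z"
    unfolding unital_module_def
  proof (intro conjI Z_mod equalityI Z.generate_in_carrier)
    show "carrier Z \<subseteq> generate (add_monoid Z) {act Z m a | m a. m \<in> carrier Z \<and> a \<in> carrier B}"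
      using generate.one[of "add_monoid Z"] by (simp add: Zc)
  qed (use Z.act_closed in blast)
  ultimately have Z: "Z \<in> Obj (fd_modules K B)" by (simp add: fd_modules_def)
  define N where "N = (\<lambda>i\<in>I. if i = j then N\<^sub>0 else Z)"
  have NI: "N i \<in> Obj (fd_modules K B)" if "i \<in> I" for i using that Z N\<^sub>0 by (simp add: N_def)
  have "{i \<in> I. \<not> zero_object (fd_modules K B) (N i)} \<subseteq> {j}"
    using zero_object_fd_modules[OF Z] Zc by (auto simp: N_def)
  then have "finite {i \<in> I. \<not> zero_object (fd_modules K B) (N i)}" by (rule finite_subset) simp
  moreover have "N \<in> extensional I" by (simp add: N_def)
  ultimately have N: "N \<in> Obj (direct_sum_cat (fd_modules K B) I)"
    using NI by (simp add: direct_sum_cat_def PiE_iff)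
  obtain M\<^sub>0 where M\<^sub>0: "realizes M\<^sub>0 N" using real NI by blast
  show ?thesis
  proof (rule realizes_imp_essential_image[OF N M\<^sub>0 \<iota>])
    fix M :: "('k, 'a, 'u) rmodule" and \<phi>
    assume M: "M \<in> Obj (fd_modules K A)"
      "\<And>i. i \<in> I \<Longrightarrow> bij_betw (\<phi> i) (carrier (corner i M)) (carrier (N i))"
    have "carrier M \<noteq> {\<zero>\<^bsub>M\<^esub>}"
    proof
      assume "carrier M = {\<zero>\<^bsub>M\<^esub>}"
      then have "carrier (corner j M) \<subseteq> {\<zero>\<^bsub>M\<^esub>}" by (auto simp: corner_def)
      then have "carrier (N j) \<subseteq> {\<phi> j \<zero>\<^bsub>M\<^esub>}" using M(2)[OF j] unfolding bij_betw_def by blast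
      then have "carrier N\<^sub>0 \<subseteq> {\<phi> j \<zero>\<^bsub>M\<^esub>}" using j by (simp add: N_def)
      moreover have "\<zero>\<^bsub>N\<^sub>0\<^esub> \<in> carrier N\<^sub>0" by (rule N\<^sub>0.vs.M.zero_closed)
      ultimately have "carrier N\<^sub>0 = {\<zero>\<^bsub>N\<^sub>0\<^esub>}" by (metis empty_iff singletonD subset_singletonD)
      then show False using N\<^sub>0(2) by simp
    qed
    then show ?thesis by (intro bexI[of _ M] M(1))
  qed
qed

end

section \<open>Representations of Leavitt path algebras\<close>

text \<open>Negatives are left out of the closure rules: where this is applied, \<open>T\<close> is
  closed under scalars and so contains them.\<close>

inductive_set additive_closure :: "('a, 'y) ring_scheme \<Rightarrow> 'a set \<Rightarrow> 'a set" for A T where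
  zero: "\<zero>\<^bsub>A\<^esub> \<in> additive_closure A T"
| incl: "t \<in> T \<Longrightarrow> t \<in> additive_closure A T"
| add: "\<lbrakk>x \<in> additive_closure A T; y \<in> additive_closure A T\<rbrakk> \<Longrightarrow> x \<oplus>\<^bsub>A\<^esub> y \<in> additive_closure A T"

context lpa
begin

text \<open>Each generator is fixed from the right by one vertex: an edge by its range, a ghost edge
  by its source. For a product the vertex set of the right factor serves, for a sum the union of
  both.\<close>

lemma L_idempotent_algebra: "idempotent_algebra K L (verts E) (\<lambda>v. gen (Vertex v))"
proof
  fix v w assume v: "v \<in> verts E"
  show "gen (Vertex v) \<in> carrier L" by (rule gen_closed) (simp add: v)
  assume "w \<in> verts E"
  then show "gen (Vertex v) \<otimes>\<^bsub>L\<^esub> gen (Vertex w) = (if v = w then gen (Vertex v) else \<zero>\<^bsub>L\<^esub>)"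
    using v by (auto simp: vertex_mult)
next
  let ?P = "\<lambda>v. gen (Vertex v)"
  have P: "?P v \<in> carrier L" if "v \<in> verts E" for v using that by (simp add: gen_closed)
  define Q where "Q a F \<longleftrightarrow> finite F \<and> F \<subseteq> verts E \<and> (\<forall>v\<in>verts E - F. a \<otimes>\<^bsub>L\<^esub> ?P v = \<zero>\<^bsub>L\<^esub>) \<and>
    a = finsum L (\<lambda>v. a \<otimes>\<^bsub>L\<^esub> ?P v) F" for a F
  have one: "\<exists>F. Q a F" if a: "a \<in> carrier L" and w: "w \<in> verts E" "a \<otimes>\<^bsub>L\<^esub> ?P w = a" for a w
  proof
    have "a \<otimes>\<^bsub>L\<^esub> ?P v = \<zero>\<^bsub>L\<^esub>" if v: "v \<in> verts E - {w}" for v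
    proof -
      have "a \<otimes>\<^bsub>L\<^esub> ?P v = a \<otimes>\<^bsub>L\<^esub> (?P w \<otimes>\<^bsub>L\<^esub> ?P v)"
        using L.mult_assoc[OF a P[OF w(1)], of "?P v"] P[of v] v w(2) by simp
      also have "?P w \<otimes>\<^bsub>L\<^esub> ?P v = \<zero>\<^bsub>L\<^esub>" using vertex_mult[of w v] v w(1) by auto
      finally show ?thesis by (simp only: L.mult_zero_right[OF a])
    qed
    moreover have "finsum L (\<lambda>v. a \<otimes>\<^bsub>L\<^esub> ?P v) {w} = a" using a w by (simp add: Pi_def)
    ultimately show "Q a {w}" using w(1) by (simp add: Q_def)
  qed
  fix a assume "a \<in> carrier L"
  then have "a \<in> carrier L \<and> (\<exists>F. Q a F)"
  proof (induction rule: L_induct)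
    case (gen g)
    then consider v where "g = Vertex v" "v \<in> verts E" | e where "g = Edge e" "e \<in> arcs E"
      | e where "g = Ghost e" "e \<in> arcs E" by (auto simp: lpa_gens_def)
    then have "\<exists>w\<in>verts E. gen g \<otimes>\<^bsub>L\<^esub> ?P w = gen g"
    proof cases
      case 1
      then show ?thesis by (intro bexI[of _ v]) (simp_all add: vertex_mult)
    next
      case 2
      then show ?thesis by (intro bexI[of _ "head E e"]) (simp_all add: range_mult)
    next
      case 3
      then show ?thesis by (intro bexI[of _ "tail E e"]) (simp_all add: ghost_range_mult)
    qed
    then show ?case using one gen gen_closed by blast
  next
    case (mult x y)
    then obtain F where F: "Q y F" and x: "x \<in> carrier L" and y: "y \<in> carrier L" by blast
    have V: "v \<in> verts E" if "v \<in> F" for v using that F by (auto simp: Q_def)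
    have eq: "(x \<otimes>\<^bsub>L\<^esub> y) \<otimes>\<^bsub>L\<^esub> ?P v = x \<otimes>\<^bsub>L\<^esub> (y \<otimes>\<^bsub>L\<^esub> ?P v)" if "v \<in> verts E" for v
      by (rule L.mult_assoc[OF x y P[OF that]])
    have "x \<otimes>\<^bsub>L\<^esub> y = x \<otimes>\<^bsub>L\<^esub> finsum L (\<lambda>v. y \<otimes>\<^bsub>L\<^esub> ?P v) F" using F by (simp add: Q_def)
    also have "\<dots> = finsum L (\<lambda>v. x \<otimes>\<^bsub>L\<^esub> (y \<otimes>\<^bsub>L\<^esub> ?P v)) F"
      using y V P by (intro linear_maps_finsum[OF L.mult_linear_right[OF x] L.is_module L.is_module])
        (auto intro!: L.mult_closed)
    also have "\<dots> = finsum L (\<lambda>v. (x \<otimes>\<^bsub>L\<^esub> y) \<otimes>\<^bsub>L\<^esub> ?P v) F"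
      by (rule L.M.finsum_cong') (use eq V x y P in \<open>auto intro!: L.mult_closed\<close>)
    finally have "Q (x \<otimes>\<^bsub>L\<^esub> y) F"
      using F eq L.mult_zero_right[OF x] by (simp add: Q_def)
    then show ?case using L.mult_closed[OF x y] by blast
  next
    case (add x y)
    then obtain F F' where F: "Q x F" and F': "Q y F'" and x: "x \<in> carrier L" and y: "y \<in> carrier L" by blast
    let ?F = "F \<union> F'"
    have V: "v \<in> verts E" if "v \<in> ?F" for v using that F F' by (auto simp: Q_def)
    have fin: "finite ?F" using F F' by (simp add: Q_def)
    have eq: "(x \<oplus>\<^bsub>L\<^esub> y) \<otimes>\<^bsub>L\<^esub> ?P v = x \<otimes>\<^bsub>L\<^esub> ?P v \<oplus>\<^bsub>L\<^esub> y \<otimes>\<^bsub>L\<^esub> ?P v" if "v \<in> verts E" for v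
      by (rule L.mult_add_left[OF x y P[OF that]])
    have cl: "z \<otimes>\<^bsub>L\<^esub> ?P v \<in> carrier L" if "z \<in> carrier L" "v \<in> ?F" for z v
      by (rule L.mult_closed[OF that(1) P[OF V[OF that(2)]]])
    have sup: "z = finsum L (\<lambda>v. z \<otimes>\<^bsub>L\<^esub> ?P v) ?F"
      if z: "z \<in> carrier L" "Q z F0" "F0 \<subseteq> ?F" for z F0
    proof -
      have "finsum L (\<lambda>v. z \<otimes>\<^bsub>L\<^esub> ?P v) ?F = finsum L (\<lambda>v. z \<otimes>\<^bsub>L\<^esub> ?P v) F0"
      proof (rule L.M.finsum_mono_neutral[OF fin z(3)])
        show "z \<otimes>\<^bsub>L\<^esub> ?P i = \<zero>\<^bsub>L\<^esub>" if "i \<in> ?F - F0" for i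
          using that z(2) V[of i] unfolding Q_def by blast
      qed (use cl[OF z(1)] z(3) in blast)
      then show ?thesis using z(2) by (simp add: Q_def)
    qed
    have "x \<oplus>\<^bsub>L\<^esub> y = finsum L (\<lambda>v. x \<otimes>\<^bsub>L\<^esub> ?P v) ?F \<oplus>\<^bsub>L\<^esub> finsum L (\<lambda>v. y \<otimes>\<^bsub>L\<^esub> ?P v) ?F"
      using sup[OF x F] sup[OF y F'] by simp
    also have "\<dots> = finsum L (\<lambda>v. x \<otimes>\<^bsub>L\<^esub> ?P v \<oplus>\<^bsub>L\<^esub> y \<otimes>\<^bsub>L\<^esub> ?P v) ?F"
      by (rule L.M.finsum_addf[symmetric]) (use cl x y in blast)+
    also have "\<dots> = finsum L (\<lambda>v. (x \<oplus>\<^bsub>L\<^esub> y) \<otimes>\<^bsub>L\<^esub> ?P v) ?F"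
    proof (rule L.M.finsum_cong')
      show "(\<lambda>v. (x \<oplus>\<^bsub>L\<^esub> y) \<otimes>\<^bsub>L\<^esub> ?P v) \<in> ?F \<rightarrow> carrier L" using cl[OF L.M.a_closed[OF x y]] by blast
    qed (use eq V in auto)
    finally have "x \<oplus>\<^bsub>L\<^esub> y = finsum L (\<lambda>v. (x \<oplus>\<^bsub>L\<^esub> y) \<otimes>\<^bsub>L\<^esub> ?P v) ?F" .
    moreover have "\<forall>v\<in>verts E - ?F. (x \<oplus>\<^bsub>L\<^esub> y) \<otimes>\<^bsub>L\<^esub> ?P v = \<zero>\<^bsub>L\<^esub>"
      using F F' eq by (simp add: Q_def)
    moreover have "?F \<subseteq> verts E" using V by blast
    ultimately have "Q (x \<oplus>\<^bsub>L\<^esub> y) ?F" unfolding Q_def using fin by blast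
    then show ?case using L.M.a_closed[OF x y] by blast
  next
    case (smult k x)
    then obtain F where F: "Q x F" and x: "x \<in> carrier L" and k: "k \<in> carrier K" by blast
    have V: "v \<in> verts E" if "v \<in> F" for v using that F by (auto simp: Q_def)
    have kl: "(\<lambda>x. k \<odot>\<^bsub>L\<^esub> x) \<in> linear_maps K L L"
      using k by (auto intro!: linear_mapsI simp: L.smult_r_distr L.smult_assoc1[symmetric] m_comm)
    have eq: "(k \<odot>\<^bsub>L\<^esub> x) \<otimes>\<^bsub>L\<^esub> ?P v = k \<odot>\<^bsub>L\<^esub> (x \<otimes>\<^bsub>L\<^esub> ?P v)" if "v \<in> verts E" for v
      by (rule L.mult_smult_left[OF k x P[OF that]])
    have cl: "z \<otimes>\<^bsub>L\<^esub> ?P v \<in> carrier L" if "z \<in> carrier L" "v \<in> F" for z v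
      by (rule L.mult_closed[OF that(1) P[OF V[OF that(2)]]])
    have "k \<odot>\<^bsub>L\<^esub> x = k \<odot>\<^bsub>L\<^esub> finsum L (\<lambda>v. x \<otimes>\<^bsub>L\<^esub> ?P v) F" using F by (simp add: Q_def)
    also have "\<dots> = finsum L (\<lambda>v. k \<odot>\<^bsub>L\<^esub> (x \<otimes>\<^bsub>L\<^esub> ?P v)) F"
      using cl[OF x] by (intro linear_maps_finsum[OF kl L.is_module L.is_module])
    also have "\<dots> = finsum L (\<lambda>v. (k \<odot>\<^bsub>L\<^esub> x) \<otimes>\<^bsub>L\<^esub> ?P v) F"
    proof (rule L.M.finsum_cong')
      show "(\<lambda>v. (k \<odot>\<^bsub>L\<^esub> x) \<otimes>\<^bsub>L\<^esub> ?P v) \<in> F \<rightarrow> carrier L" using cl[OF L.smult_closed[OF k x]] by blast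
    qed (use eq V in auto)
    finally have "Q (k \<odot>\<^bsub>L\<^esub> x) F" using F eq k by (simp add: Q_def)
    then show ?case using L.smult_closed[OF k x] by blast
  next
    case zero
    have "Q \<zero>\<^bsub>L\<^esub> {}" using P L.mult_zero_left by (simp add: Q_def)
    then show ?case by blast
  qed
  then show "\<exists>F. finite F \<and> F \<subseteq> verts E \<and> (\<forall>v\<in>verts E - F. a \<otimes>\<^bsub>L\<^esub> ?P v = \<zero>\<^bsub>L\<^esub>) \<and>
      a = finsum L (\<lambda>v. a \<otimes>\<^bsub>L\<^esub> ?P v) F"
    by (simp add: Q_def)
qed

text \<open>The sums of elements of \<open>T\<close> already form a subalgebra containing the
  generators. Products may leave \<open>T\<close> for zero because paths that do not compose
  multiply to zero.\<close>

lemma additively_spanning: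
  assumes T: "T \<subseteq> carrier L" and smult: "\<And>k t. \<lbrakk>k \<in> carrier K; t \<in> T\<rbrakk> \<Longrightarrow> k \<odot>\<^bsub>L\<^esub> t \<in> T"
    and mult: "\<And>s t. \<lbrakk>s \<in> T; t \<in> T\<rbrakk> \<Longrightarrow> s \<otimes>\<^bsub>L\<^esub> t \<in> insert \<zero>\<^bsub>L\<^esub> T"
    and gens: "\<And>g. g \<in> lpa_gens E \<Longrightarrow> gen g \<in> T"
    and X: "\<zero>\<^bsub>L\<^esub> \<in> X" "\<And>x y. \<lbrakk>x \<in> X; y \<in> X\<rbrakk> \<Longrightarrow> x \<oplus>\<^bsub>L\<^esub> y \<in> X" "T \<subseteq> X"
  shows "carrier L \<subseteq> X"
proof
  let ?C = "additive_closure L T"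
  have cl: "x \<in> carrier L" if "x \<in> ?C" for x
    using that by induction (use T in auto)
  have sm: "k \<odot>\<^bsub>L\<^esub> x \<in> ?C" if "x \<in> ?C" "k \<in> carrier K" for k x
    using that
    by induction (auto simp: L.smult_r_distr cl intro: additive_closure.intros smult)
  have ml: "x \<otimes>\<^bsub>L\<^esub> t \<in> ?C" if "x \<in> ?C" "t \<in> T" for x t
    using that(1)
  proof induction
    case zero
    show ?case using that(2) T by (simp add: subset_iff L.mult_zero_left additive_closure.zero)
  next
    case (incl s)
    then show ?case using mult[OF incl that(2)] by (auto intro: additive_closure.intros)
  next
    case (add x y)
    have "t \<in> carrier L" using that(2) T by blast
    then have "(x \<oplus>\<^bsub>L\<^esub> y) \<otimes>\<^bsub>L\<^esub> t = x \<otimes>\<^bsub>L\<^esub> t \<oplus>\<^bsub>L\<^esub> y \<otimes>\<^bsub>L\<^esub> t"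
      using L.mult_add_left[OF cl[OF add.hyps(1)] cl[OF add.hyps(2)]] by blast
    then show ?case using additive_closure.add[OF add.IH] by simp
  qed
  have mr: "x \<otimes>\<^bsub>L\<^esub> y \<in> ?C" if "y \<in> ?C" "x \<in> ?C" for x y
    using that(1)
  proof induction
    case zero
    show ?case using cl[OF that(2)] by (simp add: L.mult_zero_right additive_closure.zero)
  next
    case (incl s)
    then show ?case using ml that(2) by blast
  next
    case (add y z)
    have "x \<otimes>\<^bsub>L\<^esub> (y \<oplus>\<^bsub>L\<^esub> z) = x \<otimes>\<^bsub>L\<^esub> y \<oplus>\<^bsub>L\<^esub> x \<otimes>\<^bsub>L\<^esub> z"
      by (rule L.mult_add_right[OF cl[OF that(2)] cl[OF add.hyps(1)] cl[OF add.hyps(2)]])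
    then show ?case using additive_closure.add[OF add.IH] by simp
  qed
  have CX: "x \<in> X" if "x \<in> ?C" for x
    using that by induction (use X in auto)
  fix x assume "x \<in> carrier L"
  then have "x \<in> ?C"
    by (induction rule: L_induct) (auto intro: additive_closure.intros gens mr sm)
  then show "x \<in> X" by (rule CX)
qed

end

section \<open>Matrix units on a product of vector spaces\<close>

definition prod_module :: "'v set \<Rightarrow> ('v \<Rightarrow> ('k, 'm, 'z) module_scheme) \<Rightarrow> ('k, 'v \<Rightarrow> 'm) module" where
  "prod_module V N = \<lparr>carrier = (\<Pi>\<^sub>E v\<in>V. carrier (N v)), mult = undefined, one = undefined,
     zero = (\<lambda>v\<in>V. \<zero>\<^bsub>N v\<^esub>), add = (\<lambda>m n. \<lambda>v\<in>V. m v \<oplus>\<^bsub>N v\<^esub> n v),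
     smult = (\<lambda>k m. \<lambda>v\<in>V. k \<odot>\<^bsub>N v\<^esub> m v)\<rparr>"

text \<open>The operator matrix whose only nonzero entry is \<open>f\<close>, leading from
  coordinate \<open>s\<close> to coordinate \<open>t\<close>. Vertices, edges and ghost edges will
  all act by such matrices.\<close>

definition entry_map :: "'v set \<Rightarrow> ('v \<Rightarrow> ('k, 'm, 'z) module_scheme) \<Rightarrow> 'v \<Rightarrow> 'v \<Rightarrow> ('m \<Rightarrow> 'm)
    \<Rightarrow> ('v \<Rightarrow> 'm) \<Rightarrow> 'v \<Rightarrow> 'm" where
  "entry_map V N s t f m = (\<lambda>w\<in>V. if w = t then f (m s) else \<zero>\<^bsub>N w\<^esub>)"

context
  fixes K :: "('k, 'x) ring_scheme" and V :: "'v set" and N :: "'v \<Rightarrow> ('k, 'm, 'z) module_scheme"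
  assumes K: "cring K" and N: "\<And>v. v \<in> V \<Longrightarrow> Module.module K (N v)"
begin

lemma module_prod_module: "Module.module K (prod_module V N)"
proof -
  have ag: "abelian_group (N v)" if "v \<in> V" for v
    using N[OF that] by (simp add: Module.module_def)
  have md: "\<And>v k x. \<lbrakk>v \<in> V; k \<in> carrier K; x \<in> carrier (N v)\<rbrakk> \<Longrightarrow> k \<odot>\<^bsub>N v\<^esub> x \<in> carrier (N v)"
    "\<And>v k x y. \<lbrakk>v \<in> V; k \<in> carrier K; x \<in> carrier (N v); y \<in> carrier (N v)\<rbrakk>
      \<Longrightarrow> k \<odot>\<^bsub>N v\<^esub> (x \<oplus>\<^bsub>N v\<^esub> y) = k \<odot>\<^bsub>N v\<^esub> x \<oplus>\<^bsub>N v\<^esub> k \<odot>\<^bsub>N v\<^esub> y"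
    by (rule Module.module.smult_closed[OF N] Module.module.smult_r_distr[OF N]; assumption)+
  note md = md Module.module.smult_l_distr[OF N] Module.module.smult_assoc1[OF N]
    Module.module.smult_one[OF N]
  note agd = abelian_groupE[OF ag]
  show ?thesis
  proof (rule moduleI[OF K])
    show "abelian_group (prod_module V N)"
    proof (rule abelian_groupI)
      fix m assume m: "m \<in> carrier (prod_module V N)"
      let ?n = "\<lambda>v\<in>V. \<ominus>\<^bsub>N v\<^esub> m v"
      have "?n \<in> carrier (prod_module V N)"
        using m ag by (auto simp: prod_module_def intro!: abelian_group.a_inv_closed)
      moreover have "?n \<oplus>\<^bsub>prod_module V N\<^esub> m = \<zero>\<^bsub>prod_module V N\<^esub>"
        using m ag by (auto simp: prod_module_def fun_eq_iff abelian_group.l_neg PiE_iff)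
      ultimately show "\<exists>y\<in>carrier (prod_module V N). y \<oplus>\<^bsub>prod_module V N\<^esub> m = \<zero>\<^bsub>prod_module V N\<^esub>" by blast
      show "\<zero>\<^bsub>prod_module V N\<^esub> \<oplus>\<^bsub>prod_module V N\<^esub> m = m"
        using m agd(5) by (auto simp: prod_module_def fun_eq_iff PiE_iff extensional_def)
      fix n assume n: "n \<in> carrier (prod_module V N)"
      show "m \<oplus>\<^bsub>prod_module V N\<^esub> n \<in> carrier (prod_module V N)"
        using m n agd(1) by (auto simp: prod_module_def PiE_iff)
      show "m \<oplus>\<^bsub>prod_module V N\<^esub> n = n \<oplus>\<^bsub>prod_module V N\<^esub> m"
        using m n agd(4) by (auto simp: prod_module_def PiE_iff fun_eq_iff)
      fix q assume q: "q \<in> carrier (prod_module V N)"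
      show "m \<oplus>\<^bsub>prod_module V N\<^esub> n \<oplus>\<^bsub>prod_module V N\<^esub> q = m \<oplus>\<^bsub>prod_module V N\<^esub> (n \<oplus>\<^bsub>prod_module V N\<^esub> q)"
        using m n q agd(3) by (auto simp: prod_module_def PiE_iff fun_eq_iff)
    qed (use agd(2) in \<open>auto simp: prod_module_def\<close>)
  qed (use md in \<open>auto simp: prod_module_def PiE_iff fun_eq_iff extensional_def\<close>)
qed

lemma entry_map_linear:
  assumes s: "s \<in> V" and t: "t \<in> V" and f: "f \<in> linear_maps K (N s) (N t)"
  shows "entry_map V N s t f \<in> linear_maps K (prod_module V N) (prod_module V N)"
proof (rule linear_mapsI)
  have z: "\<zero>\<^bsub>N w\<^esub> \<in> carrier (N w)" "\<zero>\<^bsub>N w\<^esub> \<oplus>\<^bsub>N w\<^esub> \<zero>\<^bsub>N w\<^esub> = \<zero>\<^bsub>N w\<^esub>"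
    "\<And>k. k \<in> carrier K \<Longrightarrow> k \<odot>\<^bsub>N w\<^esub> \<zero>\<^bsub>N w\<^esub> = \<zero>\<^bsub>N w\<^esub>" if "w \<in> V" for w
  proof -
    interpret Nw: Module.module K "N w" by (rule N[OF that])
    show "\<zero>\<^bsub>N w\<^esub> \<in> carrier (N w)" "\<zero>\<^bsub>N w\<^esub> \<oplus>\<^bsub>N w\<^esub> \<zero>\<^bsub>N w\<^esub> = \<zero>\<^bsub>N w\<^esub>"
      "\<And>k. k \<in> carrier K \<Longrightarrow> k \<odot>\<^bsub>N w\<^esub> \<zero>\<^bsub>N w\<^esub> = \<zero>\<^bsub>N w\<^esub>" by simp_all
  qed
  fix m assume m: "m \<in> carrier (prod_module V N)"
  then have ms: "m s \<in> carrier (N s)" using s by (auto simp: prod_module_def)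
  show "entry_map V N s t f m \<in> carrier (prod_module V N)"
    using linear_maps_closed[OF f ms] z(1) by (auto simp: prod_module_def entry_map_def)
  {
    fix n assume "n \<in> carrier (prod_module V N)"
    then have ns: "n s \<in> carrier (N s)" using s by (auto simp: prod_module_def)
    show "entry_map V N s t f (m \<oplus>\<^bsub>prod_module V N\<^esub> n)
        = entry_map V N s t f m \<oplus>\<^bsub>prod_module V N\<^esub> entry_map V N s t f n"
      using linear_maps_add[OF f ms ns] z(2) s by (auto simp: prod_module_def entry_map_def fun_eq_iff)
  next
    fix k assume "k \<in> carrier K"
    then show "entry_map V N s t f (k \<odot>\<^bsub>prod_module V N\<^esub> m) = k \<odot>\<^bsub>prod_module V N\<^esub> entry_map V N s t f m"
      using linear_maps_smult[OF f _ ms] z(3) s by (auto simp: prod_module_def entry_map_def fun_eq_iff)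
  }
qed

text \<open>The multiplication rule of matrix units with operator entries. Linearity of
  \<open>g\<close> enters only through \<open>g\<close> preserving zero.\<close>

lemma entry_map_comp:
  assumes "s \<in> V" "t \<in> V" "t' \<in> V" "w \<in> V" and "g \<in> linear_maps K (N t') (N w)"
  shows "entry_map V N t' w g (entry_map V N s t f m)
    = (if t' = t then entry_map V N s w (\<lambda>n. g (f n)) m else \<zero>\<^bsub>prod_module V N\<^esub>)"
  using assms linear_maps_zero[OF assms(5) N[OF assms(3)] N[OF assms(4)]]
  by (auto simp: entry_map_def prod_module_def fun_eq_iff)

end

lemma entry_map_cong:
  assumes "m \<in> carrier (prod_module V N)" "s \<in> V" "\<And>n. n \<in> carrier (N s) \<Longrightarrow> f n = g n"
  shows "entry_map V N s t f m = entry_map V N s t g m"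
  using assms by (auto simp: entry_map_def prod_module_def fun_eq_iff)

text \<open>Injectivity of \<open>tail\<close> says that each vertex emits at most one edge e. The
  Cuntz-Krieger relations then make e and its ghost mutually inverse between the spaces at the tail
  and at the head, and any choice of such isomorphisms satisfies all relations. Vertices that emit
  no edge impose nothing.\<close>

lemma (in lpa) product_representation:
  fixes N :: "'v \<Rightarrow> ('k, 'm, 'z) module_scheme"
  assumes tail: "inj_on (tail E) (arcs E)"
    and N: "\<And>v. v \<in> verts E \<Longrightarrow> Module.module K (N v)"
    and f: "\<And>e. e \<in> arcs E \<Longrightarrow> f e \<in> linear_maps K (N (tail E e)) (N (head E e))"
    and f': "\<And>e. e \<in> arcs E \<Longrightarrow> f' e \<in> linear_maps K (N (head E e)) (N (tail E e))"
    and inv: "\<And>e n. \<lbrakk>e \<in> arcs E; n \<in> carrier (N (tail E e))\<rbrakk> \<Longrightarrow> f' e (f e n) = n"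
      "\<And>e n. \<lbrakk>e \<in> arcs E; n \<in> carrier (N (head E e))\<rbrakk> \<Longrightarrow> f e (f' e n) = n"
  obtains M :: "('k, (('v, 'e) lpa_gen list \<Rightarrow> 'k) set, 'v \<Rightarrow> 'm) rmodule"
  where "right_module K L M" "carrier M = (\<Pi>\<^sub>E v\<in>verts E. carrier (N v))"
    "\<zero>\<^bsub>M\<^esub> = (\<lambda>v\<in>verts E. \<zero>\<^bsub>N v\<^esub>)"
    "add M = (\<lambda>m n. \<lambda>v\<in>verts E. m v \<oplus>\<^bsub>N v\<^esub> n v)" "smult M = (\<lambda>k m. \<lambda>v\<in>verts E. k \<odot>\<^bsub>N v\<^esub> m v)"
    "\<And>m v. \<lbrakk>m \<in> carrier M; v \<in> verts E\<rbrakk>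
      \<Longrightarrow> act M m (gen (Vertex v)) = entry_map (verts E) N v v (\<lambda>n. n) m"
    "\<And>m e. \<lbrakk>m \<in> carrier M; e \<in> arcs E\<rbrakk>
      \<Longrightarrow> act M m (gen (Edge e)) = entry_map (verts E) N (tail E e) (head E e) (f e) m"
    "\<And>m e. \<lbrakk>m \<in> carrier M; e \<in> arcs E\<rbrakk>
      \<Longrightarrow> act M m (gen (Ghost e)) = entry_map (verts E) N (head E e) (tail E e) (f' e) m"
proof -
  let ?V = "verts E"
  let ?M = "prod_module ?V N"
  let ?\<rho> = "\<lambda>g. case g of Vertex v \<Rightarrow> entry_map ?V N v v (\<lambda>n. n)
    | Edge e \<Rightarrow> entry_map ?V N (tail E e) (head E e) (f e)
    | Ghost e \<Rightarrow> entry_map ?V N (head E e) (tail E e) (f' e)"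
  note M = module_prod_module[OF is_cring N]
  note comp = entry_map_comp[OF is_cring N]
  note lin = entry_map_linear[OF is_cring N]
  have tailD: "e = e'" if "tail E e = tail E e'" "e \<in> arcs E" "e' \<in> arcs E" for e e'
    using inj_onD[OF tail] that by blast
  show ?thesis
  proof (rule right_module_exists[OF M, where \<rho> = ?\<rho>])
    show "?\<rho> g \<in> linear_maps K ?M ?M" if "g \<in> lpa_gens E" for g
      using that by (auto simp: lpa_gens_def intro!: lin f f' linear_maps_id)
    fix m assume m: "m \<in> carrier ?M"
    show "?\<rho> (Vertex w) (?\<rho> (Vertex v) m) = (if v = w then ?\<rho> (Vertex w) m else \<zero>\<^bsub>?M\<^esub>)"
      if "v \<in> ?V" "w \<in> ?V" for v w
      using that by (auto simp: comp linear_maps_id)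
    {
      fix e assume e: "e \<in> arcs E"
      note ht = head_in_verts[OF e] tail_in_verts[OF e]
      show "?\<rho> (Edge e) (?\<rho> (Vertex (tail E e)) m) = ?\<rho> (Edge e) m"
        "?\<rho> (Vertex (head E e)) (?\<rho> (Edge e) m) = ?\<rho> (Edge e) m"
        "?\<rho> (Ghost e) (?\<rho> (Vertex (head E e)) m) = ?\<rho> (Ghost e) m"
        "?\<rho> (Vertex (tail E e)) (?\<rho> (Ghost e) m) = ?\<rho> (Ghost e) m"
        using ht e by (simp_all add: comp f f' linear_maps_id)
      fix e' assume e': "e' \<in> arcs E"
      show "?\<rho> (Edge e') (?\<rho> (Ghost e) m) = (if e = e' then ?\<rho> (Vertex (head E e)) m else \<zero>\<^bsub>?M\<^esub>)"
      proof (cases "e = e'")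
        case True
        then show ?thesis
          using ht e entry_map_cong[OF m ht(1) inv(2)[OF e], where t = "head E e"] by (simp add: comp f)
      next
        \<comment> \<open>The ghost of \<open>e\<close> lands at the tail of \<open>e\<close>,
          whereas \<open>e'\<close> starts from its own tail. Distinct edges have distinct tails, so
          the matrix units do not compose.\<close>
        case False
        then show ?thesis
          using ht e e' tailD head_in_verts[OF e'] tail_in_verts[OF e'] by (auto simp: comp f)
      qed
    }
    fix v assume v: "v \<in> ?V" "out_arcs E v \<noteq> {}"
    then obtain e where "e \<in> out_arcs E v" by blast
    then have e: "e \<in> arcs E" "tail E e = v" by simp_all
    \<comment> \<open>The sum in the second Cuntz-Krieger relation has a single term, so the
      relation becomes invertibility of the edge.\<close>
    have oa: "out_arcs E v = {e}"
    proof -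
      have "x = e" if "x \<in> out_arcs E v" for x
        by (rule tailD) (use that e in simp_all)
      then show ?thesis using \<open>e \<in> out_arcs E v\<close> by blast
    qed
    note ht = head_in_verts[OF e(1)] tail_in_verts[OF e(1)]
    interpret M: Module.module K ?M by (rule M)
    have "entry_map ?V N (tail E e) (tail E e) (\<lambda>n. f' e (f e n)) m
        = entry_map ?V N (tail E e) (tail E e) (\<lambda>n. n) m"
      by (rule entry_map_cong[OF m ht(2) inv(1)[OF e(1)]])
    then have 1: "?\<rho> (Ghost e) (?\<rho> (Edge e) m) = ?\<rho> (Vertex v) m"
      unfolding e(2)[symmetric] using ht e(1) by (simp add: comp f')
    have "entry_map ?V N v v (\<lambda>n. n) \<in> linear_maps K ?M ?M"
      by (rule lin) (use N v(1) linear_maps_id in auto)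
    then have "?\<rho> (Vertex v) m \<in> carrier ?M"
      using linear_maps_closed[OF _ m] by simp
    then show "?\<rho> (Vertex v) m = finsum ?M (\<lambda>e. ?\<rho> (Ghost e) (?\<rho> (Edge e) m)) (out_arcs E v)"
      unfolding oa using 1 by simp
  next
    fix M' :: "('k, (('v, 'e) lpa_gen list \<Rightarrow> 'k) set, 'v \<Rightarrow> 'm) rmodule"
    assume M': "right_module K L M'" "carrier M' = carrier ?M" "add M' = add ?M" "smult M' = smult ?M"
      "\<zero>\<^bsub>M'\<^esub> = \<zero>\<^bsub>?M\<^esub>" and act: "\<And>m g. \<lbrakk>m \<in> carrier ?M; g \<in> lpa_gens E\<rbrakk> \<Longrightarrow> act M' m (gen g) = ?\<rho> g m"
    show ?thesis
      by (rule that[OF M'(1)]) (use M'(2-) act in \<open>simp_all add: prod_module_def\<close>)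
  qed
qed

section \<open>Hopf graphs\<close>

locale hopf = group G for G :: "('g, 'x) monoid_scheme" (structure) +
  fixes \<rr> :: "'g set \<Rightarrow> nat"
  assumes finite_support: "finite_support G \<rr>"
begin

text \<open>The edges that leave a fixed vertex, with that vertex stripped off; the set is the same
  for all vertices. Its cardinality is \<open>ram_degree\<close>, so the degree hypothesis of
  condition (2) says that there is exactly one label.\<close>

definition labels :: "('g set \<times> 'g \<times> nat) set" where
  "labels = {(C, c, i). C \<in> conj_classes G \<and> c \<in> C \<and> i < \<rr> C}"

definition shift :: "'g set \<times> 'g \<times> nat \<Rightarrow> 'g" where
  "shift = (\<lambda>(C, c, i). c)"

lemma conj_classE:
  assumes "C \<in> conj_classes G"
  obtains h where "h \<in> carrier G" "C = {g \<otimes> h \<otimes> inv g | g. g \<in> carrier G}" "h \<in> C"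
proof -
  obtain h where h: "h \<in> carrier G" "C = {g \<otimes> h \<otimes> inv g | g. g \<in> carrier G}"
    using assms by (auto simp: conj_classes_def orbits_def orbit_def)
  have "h = \<one> \<otimes> h \<otimes> inv \<one>" using h(1) by simp
  then have "h \<in> C" unfolding h(2) by blast
  then show ?thesis using that h by blast
qed

lemma conj_class_subset: "\<lbrakk>C \<in> conj_classes G; c \<in> C\<rbrakk> \<Longrightarrow> c \<in> carrier G"
  by (elim conj_classE) auto

lemma conj_class_nonempty: "C \<in> conj_classes G \<Longrightarrow> C \<noteq> {}"
  by (elim conj_classE) auto

lemma singleton_class_central:
  assumes "{c} \<in> conj_classes G" and g: "g \<in> carrier G"
  shows "g \<otimes> c = c \<otimes> g"
proof -
  obtain h where h: "h \<in> carrier G" "{c} = {g \<otimes> h \<otimes> inv g | g. g \<in> carrier G}" "h \<in> {c}"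
    using assms(1) by (rule conj_classE)
  have hc: "h = c" using h(3) by simp
  have "g \<otimes> c \<otimes> inv g \<in> {c}" unfolding h(2) hc using g by blast
  then have "g \<otimes> c \<otimes> inv g = c" by simp
  moreover have "g \<otimes> c \<otimes> inv g \<otimes> g = g \<otimes> c" using h(1) hc g by (simp add: m_assoc)
  ultimately show ?thesis by simp
qed

lemma verts_hopf: "verts (hopf_graph G \<rr>) = carrier G"
  by (simp add: hopf_graph_def)

lemma arcs_hopf: "arcs (hopf_graph G \<rr>) = carrier G \<times> labels"
  by (auto simp: hopf_graph_def labels_def)

lemma tail_hopf: "tail (hopf_graph G \<rr>) (x, j) = x"
  by (cases j) (simp add: hopf_graph_def)

lemma head_hopf: "head (hopf_graph G \<rr>) (x, j) = x \<otimes> shift j"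
  by (cases j) (simp add: hopf_graph_def shift_def)

lemma shift_closed: "j \<in> labels \<Longrightarrow> shift j \<in> carrier G"
  by (auto simp: labels_def shift_def conj_class_subset)

lemma wf_hopf: "wf_digraph (hopf_graph G \<rr>)"
  by unfold_locales (auto simp: verts_hopf arcs_hopf tail_hopf head_hopf shift_closed)

lemma labels_Sigma: "labels = Sigma (ram_supp G \<rr>) (\<lambda>C. C \<times> {..<\<rr> C})"
  by (auto simp: labels_def ram_supp_def)

lemma finite_ram_supp: "finite (ram_supp G \<rr>)" "C \<in> ram_supp G \<rr> \<Longrightarrow> finite C"
  using finite_support finite_UnionD finite_subset[of C "\<Union>(ram_supp G \<rr>)"]
  by (auto simp: finite_support_def)

lemma card_labels: "card labels = ram_degree G \<rr>"
  unfolding labels_Sigma ram_degree_def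
  by (subst card_SigmaI) (auto simp: finite_ram_supp card_cartesian_product mult.commute)

lemma labels_empty_iff: "labels = {} \<longleftrightarrow> ram_zero G \<rr>"
proof
  assume e: "labels = {}"
  show "ram_zero G \<rr>"
    unfolding ram_zero_def
  proof
    fix C assume C: "C \<in> conj_classes G"
    then obtain c where "c \<in> C" using conj_class_nonempty by blast
    then have "0 < \<rr> C \<Longrightarrow> (C, c, 0) \<in> labels" using C by (simp add: labels_def)
    then show "\<rr> C = 0" using e by auto
  qed
qed (auto simp: labels_def ram_zero_def)

text \<open>Every element of a class \<open>C\<close> in the support, together with every index
  below \<open>\<rr> C\<close>, gives a label. A single label thus leaves room for one class, with
  one element and multiplicity one. What matters later is that \<open>{c}\<close> is a whole
  conjugacy class, so that \<open>c\<close> is central.\<close>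

lemma label_class:
  assumes "ram_degree G \<rr> = 1"
  obtains c where "labels = {({c}, c, 0)}" "c \<in> carrier G" "{c} \<in> conj_classes G"
    "ram_supp G \<rr> = {{c}}" "\<rr> {c} = 1"
proof -
  obtain j where j: "labels = {j}" using assms card_1_singletonE unfolding card_labels[symmetric] by blast
  obtain C c i where jC: "j = (C, c, i)" by (cases j)
  have "(C, c, i) \<in> labels" using j jC by simp
  then have C: "C \<in> conj_classes G" "c \<in> C" "i < \<rr> C" by (simp_all add: labels_def)
  have "(C, d, k) \<in> labels" if "d \<in> C" "k < \<rr> C" for d k using that C(1) by (simp add: labels_def)
  then have uniq: "d = c \<and> k = i" if "d \<in> C" "k < \<rr> C" for d k using that j jC by auto
  have Cc: "C = {c}" using uniq[OF _ C(3)] C(2) by blast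
  have "0 < \<rr> C" "\<rr> C - 1 < \<rr> C" using C(3) by simp_all
  then have "0 = i" "\<rr> C - 1 = i" using uniq[OF C(2)] by blast+
  then have i: "i = 0" "\<rr> C = 1" using C(3) by simp_all
  have "D = {c}" if D: "D \<in> ram_supp G \<rr>" for D
  proof -
    obtain d where "d \<in> D" using D conj_class_nonempty by (auto simp: ram_supp_def)
    then have "(D, d, 0) \<in> labels" using D by (simp add: labels_def ram_supp_def)
    then show ?thesis using j jC Cc by auto
  qed
  moreover have "{c} \<in> ram_supp G \<rr>" using C Cc by (simp add: ram_supp_def)
  ultimately have "ram_supp G \<rr> = {{c}}" by blast
  then show ?thesis using that[of c] j jC Cc i C conj_class_subset by auto
qed

lemma nat_pow_in_semigroup:
  assumes "c \<in> \<Union>(ram_supp G \<rr>)" and c: "c \<in> carrier G" and "0 < n"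
  shows "c [^] (n :: nat) \<in> ram_semigroup G \<rr>"
  using assms(3)
proof (induction n rule: nat_induct_non_zero)
  case 1
  then show ?case using ram_semigroup.gen[OF assms(1)] c by simp
next
  case (Suc n)
  then show ?case using ram_semigroup.mult[OF Suc.IH ram_semigroup.gen[OF assms(1)]] by simp
qed

lemma ram_semigroup_closed: "x \<in> ram_semigroup G \<rr> \<Longrightarrow> x \<in> carrier G"
  by (induction rule: ram_semigroup.induct) (auto simp: ram_supp_def conj_class_subset)

lemma one_imp_submonoid: "\<one> \<in> ram_semigroup G \<rr> \<Longrightarrow> submonoid (ram_semigroup G \<rr>) G"
  by unfold_locales (auto simp: ram_semigroup_closed ram_semigroup.mult)

end

section \<open>Necessity: consequences of a nonzero finite dimensional module\<close>

locale hopf_field = hopf G \<rr> + K: field K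
  for G :: "('g, 'x) monoid_scheme" (structure) and \<rr> and K :: "('k, 'y) ring_scheme"
begin

sublocale lpa K "hopf_graph G \<rr>"
  by (intro lpa.intro K.field_axioms wf_hopf)

sublocale idem: idempotent_algebra K L "carrier G" "\<lambda>v. gen (Vertex v)"
  using L_idempotent_algebra by (simp add: verts_hopf)

lemma nonzero_module_imp_trivial_or_cyclic:
  fixes M :: "('k, (('g, 'g \<times> 'g set \<times> 'g \<times> nat) lpa_gen list \<Rightarrow> 'k) set, 'u) rmodule"
  assumes M: "M \<in> Obj (fd_modules K L)" and nz: "carrier M \<noteq> {\<zero>\<^bsub>M\<^esub>}"
  shows "ram_zero G \<rr> \<or> ram_degree G \<rr> = 1 \<and> submonoid (ram_semigroup G \<rr>) G"
proof -
  interpret M: right_module K L M by (rule fd_modules_Obj(1)[OF M])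
  define S where "S = idem.supp M"
  have fin: "finite S" using idem.finite_supp[OF M] by (simp add: S_def)
  have SG: "x \<in> carrier G" if "x \<in> S" for x using that by (simp add: S_def idem.supp_def)
  let ?P = "\<lambda>x. gen (Vertex x)" and ?e = "\<lambda>x j. gen (Edge (x, j))" and ?g = "\<lambda>x j. gen (Ghost (x, j))"
  have P: "?P x \<in> carrier L" if "x \<in> carrier G" for x using that by (intro idem.P_closed)
  have eg: "?e x j \<in> carrier L" "?g x j \<in> carrier L" if "x \<in> carrier G" "j \<in> labels" for x j
    using that by (auto intro!: gen_closed simp: arcs_hopf)
  have ge: "?g y j \<otimes>\<^bsub>L\<^esub> ?e x k = (if y = x \<and> j = k then ?P (x \<otimes> shift j) else \<zero>\<^bsub>L\<^esub>)"
    if "x \<in> carrier G" "y \<in> carrier G" "j \<in> labels" "k \<in> labels" for x y j k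
    using CK1_mult[of "(y, j)" "(x, k)"] that by (auto simp: arcs_hopf head_hopf)
  have gP: "?g x j \<otimes>\<^bsub>L\<^esub> ?P x = ?g x j" if "x \<in> carrier G" "j \<in> labels" for x j
    using ghost_range_mult[of "(x, j)"] that by (simp add: arcs_hopf tail_hopf)
  have shift_back: "x \<in> S" if x: "x \<in> carrier G" and j: "j \<in> labels" and xj: "x \<otimes> shift j \<in> S" for x j
  proof (rule ccontr)
    assume "x \<notin> S"
    obtain m where m: "m \<in> carrier M" "act M m (?P (x \<otimes> shift j)) \<noteq> \<zero>\<^bsub>M\<^esub>"
      using xj by (auto simp: S_def idem.supp_def)
    have "act M m (?g x j) = act M (act M m (?g x j)) (?P x)"
      using M.act_mult[OF m(1) eg(2)[OF x j] P[OF x]] gP[OF x j] by simp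
    also have "\<dots> = \<zero>\<^bsub>M\<^esub>"
      using idem.act_zero_outside_supp[OF x, of M] \<open>x \<notin> S\<close> M.act_closed[OF m(1) eg(2)[OF x j]]
      by (simp add: S_def)
    finally have "act M (act M m (?g x j)) (?e x j) = \<zero>\<^bsub>M\<^esub>"
      using M.act_zero_left[OF eg(1)[OF x j]] by simp
    then show False using m M.act_mult[OF m(1) eg(2,1)[OF x j]] x j by (auto simp: ge)
  qed
  have shift_bij: "(\<lambda>x. x \<otimes> shift j) ` S = S" if j: "j \<in> labels" for j
  proof -
    note c = shift_closed[OF j]
    have "(\<lambda>y. y \<otimes> inv (shift j)) ` S \<subseteq> S"
    proof
      fix x assume "x \<in> (\<lambda>y. y \<otimes> inv (shift j)) ` S"
      then obtain y where y: "y \<in> S" "x = y \<otimes> inv (shift j)" by blast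
      then have "x \<otimes> shift j = y" using c SG[OF y(1)] by (simp add: m_assoc)
      then show "x \<in> S" using shift_back[of x j] y c j SG[OF y(1)] by simp
    qed
    moreover have "inj_on (\<lambda>y. y \<otimes> inv (shift j)) S"
      using c SG by (intro inj_onI) simp
    ultimately have eq: "(\<lambda>y. y \<otimes> inv (shift j)) ` S = S" using endo_inj_surj[OF fin] by blast
    have "(\<lambda>x. x \<otimes> shift j) ` ((\<lambda>y. y \<otimes> inv (shift j)) ` S) = S"
    proof -
      have "y \<otimes> inv (shift j) \<otimes> shift j = y" if "y \<in> S" for y
        using c SG[OF that] by (simp add: m_assoc)
      then show ?thesis by (force simp: image_image)
    qed
    then show ?thesis by (simp only: eq)
  qed
  \<comment> \<open>G may be infinite, so the sums over all vertices are cut down to the support.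
    Nothing is lost on \<open>M\<close>: edges and ghost edges attached to \<open>x\<close> outside
    the support act as zero.\<close>
  define T where "T j m = finsum M (\<lambda>x. act M m (?e x j)) S" for j m
  define U where "U j m = finsum M (\<lambda>x. act M m (?g x j)) S" for j m
  have T: "T j \<in> linear_maps K M M" and U: "U j \<in> linear_maps K M M" if "j \<in> labels" for j
    unfolding T_def U_def
    using eg[OF SG that] by (auto intro!: linear_maps_finsum_map M.modules M.act_linear_left)
  have dec: "m = finsum M (\<lambda>v. act M m (?P v)) S" if "m \<in> carrier M" for m
    using idem.supp_decomposition[OF M that] by (simp add: S_def)
  have TU: "T k (U j m) = (if j = k then m else \<zero>\<^bsub>M\<^esub>)"
    if j: "j \<in> labels" and k: "k \<in> labels" and m: "m \<in> carrier M" for j k m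
  proof -
    let ?z = "\<lambda>x. if j = k then act M m (?P (x \<otimes> shift j)) else \<zero>\<^bsub>M\<^esub>"
    have zc: "?z x \<in> carrier M" if "x \<in> S" for x
      using M.act_closed[OF m P[OF m_closed[OF SG[OF that] shift_closed[OF j]]]] M.vs.M.zero_closed
      by presburger
    have inner: "act M (U j m) (?e x k) = ?z x" if x: "x \<in> S" for x
    proof -
      have "act M (U j m) (?e x k) = finsum M (\<lambda>y. act M (act M m (?g y j)) (?e x k)) S"
        unfolding U_def
        using M.act_closed[OF m eg(2)[OF SG j]] by (intro M.act_finsum_left eg(1)[OF SG[OF x] k])
      also have "\<dots> = ?z x"
      \<comment> \<open>The ghost edges at \<open>y\<close> and the edges at \<open>x\<close>
        multiply to zero unless \<open>y = x\<close> and the labels agree, so only the summand at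
        \<open>x\<close> remains.\<close>
      proof (rule M.vs.M.finsum_one_term[OF fin, of x])
        have eq: "act M (act M m (?g y j)) (?e x k)
            = (if y = x \<and> j = k then act M m (?P (x \<otimes> shift j)) else \<zero>\<^bsub>M\<^esub>)" if "y \<in> S" for y
          using M.act_mult[OF m eg(2)[OF SG[OF that] j] eg(1)[OF SG[OF x] k]]
            ge[OF SG[OF x] SG[OF that] j k] M.act_zero_right[OF m] by auto
        show "act M (act M m (?g y j)) (?e x k) = \<zero>\<^bsub>M\<^esub>" if "y \<in> S" "y \<noteq> x" for y
          using eq that by simp
        show "act M (act M m (?g x j)) (?e x k) = ?z x" using eq[OF x] by simp
        show "?z x \<in> carrier M" by (rule zc[OF x])
      qed (use x in simp)
      finally show ?thesis .
    qed
    have "T k (U j m) = finsum M ?z S"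
      unfolding T_def by (rule M.vs.M.finsum_cong') (use inner zc in auto)
    also have "\<dots> = (if j = k then m else \<zero>\<^bsub>M\<^esub>)"
    proof (cases "j = k")
      \<comment> \<open>The idempotents that occur are those at \<open>x c\<close> with
        \<open>x\<close> in \<open>S\<close>. They add up to the identity on \<open>M\<close> only
        because right multiplication by \<open>c\<close> permutes \<open>S\<close>; hence the
        reindexing.\<close>
      case True
      have "inj_on (\<lambda>x. x \<otimes> shift j) S"
        using shift_closed[OF j] SG by (intro inj_onI) simp
      then have "finsum M (\<lambda>v. act M m (?P v)) ((\<lambda>x. x \<otimes> shift j) ` S)
          = finsum M (\<lambda>x. act M m (?P (x \<otimes> shift j))) S"
        using M.act_closed[OF m P] SG shift_closed[OF j] by (intro M.vs.M.finsum_reindex) auto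
      then have "m = finsum M (\<lambda>x. act M m (?P (x \<otimes> shift j))) S"
        unfolding shift_bij[OF j] dec[OF m, symmetric] .
      then show ?thesis unfolding True by simp
    qed simp
    finally show ?thesis .
  qed
  have unique: "j = k" if j: "j \<in> labels" and k: "k \<in> labels" for j k
  proof (rule ccontr)
    assume ne: "j \<noteq> k"
    have "inj_on (U j) (carrier M)"
      by (rule inj_on_inverseI[where g = "T j"]) (simp add: TU[OF j j])
    then have surj: "U j ` carrier M = carrier M"
      by (rule finite_dim_injective_surjective[OF K.field_axioms M.modules(2) fd_modules_Obj(3)[OF M] U[OF j]])
    have "m = \<zero>\<^bsub>M\<^esub>" if m: "m \<in> carrier M" for m
    proof -
      have "U k m \<in> U j ` carrier M" using linear_maps_closed[OF U[OF k] m] surj by simp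
      then obtain n where n: "n \<in> carrier M" "U k m = U j n" by blast
      have "m = T k (U k m)" using TU[OF k k m] by simp
      also have "\<dots> = \<zero>\<^bsub>M\<^esub>" using TU[OF j k n(1)] ne n(2) by simp
      finally show ?thesis .
    qed
    then show False using nz M.vs.M.zero_closed by blast
  qed
  show ?thesis
  proof (cases "labels = {}")
    case True
    then show ?thesis by (simp add: labels_empty_iff)
  next
    case False
    then obtain j where "labels = {j}" using unique by blast
    then have deg: "ram_degree G \<rr> = 1" by (simp add: card_labels[symmetric])
    obtain c where c: "labels = {({c}, c, 0)}" "c \<in> carrier G" "ram_supp G \<rr> = {{c}}"
      using label_class[OF deg] by metis
    have "S \<noteq> {}"
    proof
      assume "S = {}"
      then have "m = \<zero>\<^bsub>M\<^esub>" if "m \<in> carrier M" for m using dec[OF that] by simp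
      then show False using nz M.vs.M.zero_closed by blast
    qed
    then obtain x where x: "x \<in> S" by blast
    have step: "y \<otimes> c \<in> S" if "y \<in> S" for y
      using shift_bij[of "({c}, c, 0)"] c(1) that by (auto simp: shift_def)
    have pow: "x \<otimes> c [^] (n :: nat) \<in> S" for n
    proof (induction n)
      case 0
      then show ?case using x SG by simp
    next
      case (Suc n)
      then show ?case using step[OF Suc.IH] c(2) SG[OF x] by (simp add: m_assoc)
    qed
    have "\<not> inj (\<lambda>n :: nat. x \<otimes> c [^] n)"
    proof
      assume "inj (\<lambda>n :: nat. x \<otimes> c [^] n)"
      moreover have "finite (range (\<lambda>n :: nat. x \<otimes> c [^] n))"
        by (rule finite_subset[OF _ fin]) (use pow in blast)
      ultimately show False using finite_imageD infinite_UNIV_nat by blast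
    qed
    then obtain a b :: nat where ab: "a < b" "x \<otimes> c [^] a = x \<otimes> c [^] b"
      unfolding inj_def by (metis nat_neq_iff)
    then have "c [^] a = c [^] b" using SG[OF x] c(2) by simp
    then have "c [^] (b - a) = \<one>" by (rule pow_eq_div2[OF c(2) sym])
    \<comment> \<open>Because \<open>a < b\<close>, the exponent is positive, which membership in a
      semigroup generated by \<open>c\<close> requires.\<close>
    moreover have "c [^] (b - a) \<in> ram_semigroup G \<rr>"
      by (rule nat_pow_in_semigroup) (use c ab in auto)
    ultimately show ?thesis using deg one_imp_submonoid by simp
  qed
qed

end

section \<open>Graphs without edges and graphs of disjoint cycles\<close>

lemma (in field) field_algebra_is_algebra: "nonunital_algebra R (field_algebra R)"
proof -
  have "abelian_group (field_algebra R)"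
  proof (rule abelian_groupI)
    fix x assume "x \<in> carrier (field_algebra R)"
    then show "\<exists>y\<in>carrier (field_algebra R). y \<oplus>\<^bsub>field_algebra R\<^esub> x = \<zero>\<^bsub>field_algebra R\<^esub>"
      by (intro bexI[of _ "\<ominus> x"]) (simp_all add: field_algebra_def l_neg)
  qed (simp_all add: field_algebra_def a_ac)
  then have "Module.module R (field_algebra R)"
    by (intro moduleI) (auto simp: field_algebra_def is_cring l_distr r_distr m_assoc)
  then show ?thesis
    by (intro nonunital_algebra.intro nonunital_algebra_axioms.intro)
      (auto simp: field_algebra_def l_distr r_distr m_assoc m_lcomm)
qed

text \<open>A character of \<open>B\<close> turns K itself into a one-dimensional module, unital
  since \<open>\<chi> u\<close> is one. It is built on the type of scalars and then transported into
  the universe.\<close>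

lemma nonzero_character_module:
  fixes B :: "('k, 'b) module" and \<iota> :: "'k list \<Rightarrow> 'u"
  assumes K: "field K" and B: "nonunital_algebra K B"
    and \<chi>: "\<chi> \<in> linear_maps K B (field_algebra K)"
    and mult: "\<And>a b. \<lbrakk>a \<in> carrier B; b \<in> carrier B\<rbrakk> \<Longrightarrow> \<chi> (a \<otimes>\<^bsub>B\<^esub> b) = \<chi> a \<otimes>\<^bsub>K\<^esub> \<chi> b"
    and u: "u \<in> carrier B" "\<chi> u = \<one>\<^bsub>K\<^esub>"
    and \<iota>: "inj_on \<iota> (lists (carrier K))"
  shows "\<exists>N :: ('k, 'b, 'u) rmodule. N \<in> Obj (fd_modules K B) \<and> carrier N \<noteq> {\<zero>\<^bsub>N\<^esub>}"
proof -
  interpret K: field K by fact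
  interpret F: nonunital_algebra K "field_algebra K" by (rule K.field_algebra_is_algebra)
  define M\<^sub>0 :: "('k, 'b, 'k) rmodule" where
    "M\<^sub>0 = \<lparr>carrier = carrier K, mult = undefined, one = undefined, zero = \<zero>\<^bsub>K\<^esub>, add = add K,
      smult = mult K, act = (\<lambda>x b. x \<otimes>\<^bsub>K\<^esub> \<chi> b)\<rparr>"
  have mod: "Module.module K M\<^sub>0"
    by (rule module_surjective_image[OF F.is_module, of _ "\<lambda>x. x"]) (auto simp: M\<^sub>0_def field_algebra_def)
  have \<chi>c: "\<chi> b \<in> carrier K" if "b \<in> carrier B" for b
    using linear_maps_closed[OF \<chi> that] by (simp add: field_algebra_def)
  have \<chi>a: "\<chi> (a \<oplus>\<^bsub>B\<^esub> b) = \<chi> a \<oplus>\<^bsub>K\<^esub> \<chi> b" if "a \<in> carrier B" "b \<in> carrier B" for a b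
    using linear_maps_add[OF \<chi> that] by (simp add: field_algebra_def)
  have \<chi>s: "\<chi> (k \<odot>\<^bsub>B\<^esub> b) = k \<otimes>\<^bsub>K\<^esub> \<chi> b" if "k \<in> carrier K" "b \<in> carrier B" for k b
    using linear_maps_smult[OF \<chi> that] by (simp add: field_algebra_def)
  have M\<^sub>0: "right_module K B M\<^sub>0"
    by (intro right_module.intro right_module_axioms.intro B mod)
      (simp_all add: M\<^sub>0_def \<chi>c \<chi>a \<chi>s mult K.l_distr K.r_distr K.m_assoc K.m_lcomm)
  interpret M\<^sub>0: right_module K B M\<^sub>0 by (rule M\<^sub>0)
  have "m = finsum M\<^sub>0 (\<lambda>b. m \<odot>\<^bsub>M\<^sub>0\<^esub> b) {\<one>\<^bsub>K\<^esub>}" if "m \<in> carrier K" for m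
  proof -
    have "finsum M\<^sub>0 (\<lambda>b. m \<odot>\<^bsub>M\<^sub>0\<^esub> b) {\<one>\<^bsub>K\<^esub>} = m \<odot>\<^bsub>M\<^sub>0\<^esub> \<one>\<^bsub>K\<^esub>"
      by (rule M\<^sub>0.vs.M.finsum_one_term[where j = "\<one>\<^bsub>K\<^esub>"]) (use that in \<open>auto simp: M\<^sub>0_def\<close>)
    then show ?thesis using that by (simp add: M\<^sub>0_def)
  qed
  then have "finite_dim K M\<^sub>0"
    unfolding finite_dim_def
    by (intro exI[of _ "{\<one>\<^bsub>K\<^esub>}"]) (auto simp: M\<^sub>0_def intro!: bexI[of _ "\<lambda>_. _"])
  then obtain N :: "('k, 'b, 'u) rmodule" and h where N: "right_module K B N"
    and h: "inj_on h (carrier M\<^sub>0)" "carrier N = h ` carrier M\<^sub>0" "h \<in> linear_maps K M\<^sub>0 N"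
    and act: "\<And>m a. \<lbrakk>m \<in> carrier M\<^sub>0; a \<in> carrier B\<rbrakk> \<Longrightarrow> act N (h m) a = h (act M\<^sub>0 m a)"
    and fd: "finite_dim K N"
    using right_module_transport[OF M\<^sub>0 _ \<iota>] by blast
  interpret N: right_module K B N by (rule N)
  let ?S = "{act N m a | m a. m \<in> carrier N \<and> a \<in> carrier B}"
  have "unital_module K B N"
    unfolding unital_module_def
  proof (intro conjI N equalityI N.generate_in_carrier subsetI)
    fix x assume x: "x \<in> carrier N"
    then obtain m where m: "m \<in> carrier M\<^sub>0" "x = h m" using h(2) by blast
    have "act M\<^sub>0 m u = m" using m(1) u by (simp add: M\<^sub>0_def)
    then have "x = act N x u" using act[OF m(1) u(1)] m(2) by simp
    then show "x \<in> generate (add_monoid N) ?S" using x u(1) by (intro generate.incl) blast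
  next
    fix x assume "x \<in> ?S"
    then show "x \<in> carrier N" using N.act_closed by blast
  qed
  moreover have "h \<one>\<^bsub>K\<^esub> \<noteq> h \<zero>\<^bsub>K\<^esub>"
    using inj_onD[OF h(1), of "\<one>\<^bsub>K\<^esub>" "\<zero>\<^bsub>K\<^esub>"] by (auto simp: M\<^sub>0_def)
  moreover have "h \<one>\<^bsub>K\<^esub> \<in> carrier N" "h \<zero>\<^bsub>K\<^esub> \<in> carrier N" using h(2) by (simp_all add: M\<^sub>0_def)
  ultimately have "unital_module K B N" "carrier N \<noteq> {\<zero>\<^bsub>N\<^esub>}" by fastforce+
  then show ?thesis using fd by (auto simp: fd_modules_def)
qed

section \<open>Graphs without edges\<close>

locale edgeless_lpa = lpa K E for K :: "('k, 'x) ring_scheme" (structure) and E :: "('v, 'e) pre_digraph" +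
  assumes no_arcs: "arcs E = {}"
begin

text \<open>Every vertex forms a component of its own, so the connecting elements \<open>U\<close>
  and \<open>W\<close> are the vertices themselves. Spanning holds because the scalar multiples of
  vertices contain all generators and are closed under products up to zero.\<close>

sublocale corner: corner_algebra K L "verts E" "\<lambda>v. gen (Vertex v)" "field_algebra K" "\<one>" "verts E"
  "\<lambda>v. v" "\<lambda>v. v" "\<lambda>v. gen (Vertex v)" "\<lambda>v. gen (Vertex v)" "\<lambda>v k. k \<odot>\<^bsub>L\<^esub> gen (Vertex v)"
proof (intro corner_algebra.intro corner_algebra_axioms.intro L_idempotent_algebra field_algebra_is_algebra)
  interpret idem: idempotent_algebra K L "verts E" "\<lambda>v. gen (Vertex v)" by (rule L_idempotent_algebra)
  note P = idem.P_closed
  fix X assume X: "X \<subseteq> carrier L" "\<zero>\<^bsub>L\<^esub> \<in> X" "\<And>x y. \<lbrakk>x \<in> X; y \<in> X\<rbrakk> \<Longrightarrow> x \<oplus>\<^bsub>L\<^esub> y \<in> X"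
    and WU: "\<And>v w b. \<lbrakk>v \<in> verts E; w \<in> verts E; v = w; b \<in> carrier (field_algebra K)\<rbrakk>
      \<Longrightarrow> gen (Vertex v) \<otimes>\<^bsub>L\<^esub> (b \<odot>\<^bsub>L\<^esub> gen (Vertex v) \<otimes>\<^bsub>L\<^esub> gen (Vertex w)) \<in> X"
  let ?T = "{k \<odot>\<^bsub>L\<^esub> gen (Vertex v) | k v. k \<in> carrier K \<and> v \<in> verts E}"
  show "carrier L \<subseteq> X"
  proof (rule additively_spanning[of ?T])
    show "?T \<subseteq> carrier L" using P by auto
    show "k \<odot>\<^bsub>L\<^esub> t \<in> ?T" if k: "k \<in> carrier K" and t: "t \<in> ?T" for k t
    proof -
      obtain l v where t: "t = l \<odot>\<^bsub>L\<^esub> gen (Vertex v)" "l \<in> carrier K" "v \<in> verts E" using t by blast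
      have "k \<odot>\<^bsub>L\<^esub> t = (k \<otimes> l) \<odot>\<^bsub>L\<^esub> gen (Vertex v)" using k t P by (simp add: L.smult_assoc1)
      then show ?thesis using k t by blast
    qed
    show "s \<otimes>\<^bsub>L\<^esub> t \<in> insert \<zero>\<^bsub>L\<^esub> ?T" if s: "s \<in> ?T" and t: "t \<in> ?T" for s t
    proof -
      obtain l v where t: "t = l \<odot>\<^bsub>L\<^esub> gen (Vertex v)" "l \<in> carrier K" "v \<in> verts E" using t by blast
      obtain k w where s: "s = k \<odot>\<^bsub>L\<^esub> gen (Vertex w)" "k \<in> carrier K" "w \<in> verts E" using s by blast
      have "s \<otimes>\<^bsub>L\<^esub> t = (k \<otimes> l) \<odot>\<^bsub>L\<^esub> (gen (Vertex w) \<otimes>\<^bsub>L\<^esub> gen (Vertex v))"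
        using s t P
        by (simp add: L.mult_smult_left L.mult_smult_right L.mult_closed L.smult_assoc1[symmetric] m_comm)
      also have "\<dots> \<in> insert \<zero>\<^bsub>L\<^esub> ?T" using s t by (auto simp: vertex_mult)
      finally show ?thesis .
    qed
    show "gen g \<in> ?T" if g: "g \<in> lpa_gens E" for g
    proof -
      obtain v where v: "g = Vertex v" "v \<in> verts E" using g by (auto simp: lpa_gens_def no_arcs)
      then have "gen g = \<one> \<odot>\<^bsub>L\<^esub> gen (Vertex v)" using P by simp
      then show ?thesis using v by blast
    qed
    show "?T \<subseteq> X"
    proof
      fix t assume "t \<in> ?T"
      then obtain k v where t: "t = k \<odot>\<^bsub>L\<^esub> gen (Vertex v)" "k \<in> carrier K" "v \<in> verts E" by blast
      have "gen (Vertex v) \<otimes>\<^bsub>L\<^esub> (k \<odot>\<^bsub>L\<^esub> gen (Vertex v) \<otimes>\<^bsub>L\<^esub> gen (Vertex v)) = t"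
        using t P by (simp add: L.mult_smult_left L.mult_smult_right vertex_mult L.mult_closed)
      then show "t \<in> X" using WU[of v v k] t by (simp add: field_algebra_def)
    qed
  qed (use X in auto)
next
  interpret idem: idempotent_algebra K L "verts E" "\<lambda>v. gen (Vertex v)" by (rule L_idempotent_algebra)
  fix i assume "i \<in> verts E"
  then show "(\<lambda>k. k \<odot>\<^bsub>L\<^esub> gen (Vertex i)) \<in> linear_maps K (field_algebra K) L"
    by (intro linear_mapsI)
      (auto simp: field_algebra_def idem.P_closed L.smult_l_distr L.smult_assoc1)
  show "finite {v \<in> verts E. v = i}" by (rule finite_subset[of _ "{i}"]) auto
qed (simp_all add: field_algebra_def vertex_mult gen_closed L.mult_smult_left L.mult_smult_right
    L.smult_assoc1[symmetric] L.mult_closed m_comm)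

text \<open>The product of the \<open>N v\<close> with its coordinate projections. A module over K
  as an algebra carries two actions of the scalars; they agree because the unit acts as the
  identity.\<close>

lemma realizable:
  fixes N :: "'v \<Rightarrow> ('k, 'k, 'u) rmodule"
  assumes N: "\<And>v. v \<in> verts E \<Longrightarrow> N v \<in> Obj (fd_modules K (field_algebra K))"
  shows "\<exists>M. corner.realizes M N"
proof -
  have Nm: "Module.module K (N v)" if "v \<in> verts E" for v
    by (rule right_module.modules(2)[OF fd_modules_Obj(1)[OF N[OF that]]])
  obtain M :: "('k, (('v, 'e) lpa_gen list \<Rightarrow> 'k) set, 'v \<Rightarrow> 'u) rmodule"
    where M: "right_module K L M" "carrier M = (\<Pi>\<^sub>E v\<in>verts E. carrier (N v))"
      "\<zero>\<^bsub>M\<^esub> = (\<lambda>v\<in>verts E. \<zero>\<^bsub>N v\<^esub>)"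
      "add M = (\<lambda>m n. \<lambda>v\<in>verts E. m v \<oplus>\<^bsub>N v\<^esub> n v)" "smult M = (\<lambda>k m. \<lambda>v\<in>verts E. k \<odot>\<^bsub>N v\<^esub> m v)"
    and act: "\<And>m v. \<lbrakk>m \<in> carrier M; v \<in> verts E\<rbrakk>
      \<Longrightarrow> act M m (gen (Vertex v)) = entry_map (verts E) N v v (\<lambda>n. n) m"
    by (rule product_representation[of N "\<lambda>_ n. n" "\<lambda>_ n. n"]) (auto simp: no_arcs Nm)
  interpret M: right_module K L M by (rule M(1))
  have "act M m (b \<odot>\<^bsub>L\<^esub> gen (Vertex i)) i = act (N i) (m i) b"
    if m: "m \<in> carrier M" and i: "i \<in> verts E" and b: "b \<in> carrier K" for m i b
  proof -
    interpret Ni: right_module K "field_algebra K" "N i" by (rule fd_modules_Obj(1)[OF N[OF i]])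
    have mi: "m i \<in> carrier (N i)" using m i by (auto simp: M(2))
    have "act M m (b \<odot>\<^bsub>L\<^esub> gen (Vertex i)) = b \<odot>\<^bsub>M\<^esub> act M m (gen (Vertex i))"
      using m i b by (intro M.act_smult_right) (auto simp: gen_closed)
    then have "act M m (b \<odot>\<^bsub>L\<^esub> gen (Vertex i)) i = b \<odot>\<^bsub>N i\<^esub> m i"
      using i by (simp add: act[OF m i] M(5) entry_map_def)
    also have "\<dots> = b \<odot>\<^bsub>N i\<^esub> act (N i) (m i) \<one>"
      using corner.unit_acts[OF fd_modules_Obj(2)[OF N[OF i]] mi] by simp
    also have "\<dots> = act (N i) (m i) (b \<odot>\<^bsub>field_algebra K\<^esub> \<one>)"
      using Ni.act_smult_right[OF b mi, of \<one>] by (simp add: field_algebra_def)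
    finally show ?thesis using b by (simp add: field_algebra_def)
  qed
  then have "corner.realizes M N"
    unfolding corner.realizes_def using M act
    by (auto simp: entry_map_def fun_eq_iff field_algebra_def)
  then show ?thesis by blast
qed

lemma equivalence:
  fixes \<iota> :: "'k list \<Rightarrow> 'u"
  assumes \<iota>: "inj_on \<iota> (lists (carrier K))"
  shows "equivalent_cats (fd_modules K L :: ((_, _, 'u) rmodule, _) cat)
    (direct_sum_cat (fd_modules K (field_algebra K) :: ((_, _, 'u) rmodule, _) cat) (verts E))"
  by (rule corner.corner_equivalence[OF \<iota> realizable])

lemma nonzero_module:
  fixes \<iota> :: "'k list \<Rightarrow> 'u"
  assumes \<iota>: "inj_on \<iota> (lists (carrier K))" and v: "v \<in> verts E"
  shows "\<exists>M\<in>Obj (fd_modules K L :: ((_, _, 'u) rmodule, _) cat). carrier M \<noteq> {\<zero>\<^bsub>M\<^esub>}"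
proof -
  have "\<exists>N :: ('k, 'k, 'u) rmodule. N \<in> Obj (fd_modules K (field_algebra K)) \<and> carrier N \<noteq> {\<zero>\<^bsub>N\<^esub>}"
    by (rule nonzero_character_module[OF field_axioms field_algebra_is_algebra linear_maps_id _ _ _ \<iota>, of \<one>])
      (auto simp: field_algebra_def)
  then show ?thesis using corner.nonzero_fd_module[OF \<iota> v realizable] by blast
qed

end

section \<open>Disjoint cycles of equal length\<close>

text \<open>
  \<open>sh x k\<close> is the vertex reached from \<open>x\<close> after \<open>k\<close> steps (backwards if \<open>k < 0\<close>), \<open>n\<close> the
  common length of all cycles, and \<open>cls x\<close> names the cycle through \<open>x\<close>.
\<close>

locale cycle_lpa = lpa K E for K :: "('k, 'x) ring_scheme" (structure) and E :: "('v, 'e) pre_digraph" +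
  fixes edge :: "'v \<Rightarrow> 'e" and sh :: "'v \<Rightarrow> int \<Rightarrow> 'v" and n :: int
    and I :: "'i set" and cls :: "'v \<Rightarrow> 'i" and rep :: "'i \<Rightarrow> 'v"
  assumes arcs_edge: "arcs E = edge ` verts E"
    and tail_edge: "x \<in> verts E \<Longrightarrow> tail E (edge x) = x"
    and head_edge: "x \<in> verts E \<Longrightarrow> head E (edge x) = sh x 1"
    and sh_closed: "x \<in> verts E \<Longrightarrow> sh x k \<in> verts E"
    and sh_zero: "x \<in> verts E \<Longrightarrow> sh x 0 = x"
    and sh_sh: "x \<in> verts E \<Longrightarrow> sh (sh x k) l = sh x (k + l)"
    and n_pos: "n > 0" and period: "x \<in> verts E \<Longrightarrow> sh x k = x \<longleftrightarrow> n dvd k"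
    and cls_closed: "x \<in> verts E \<Longrightarrow> cls x \<in> I" and cls_sh: "x \<in> verts E \<Longrightarrow> cls (sh x k) = cls x"
    and cls_eqD: "\<lbrakk>x \<in> verts E; y \<in> verts E; cls x = cls y\<rbrakk> \<Longrightarrow> \<exists>k. y = sh x k"
    and rep_closed: "i \<in> I \<Longrightarrow> rep i \<in> verts E" and cls_rep: "i \<in> I \<Longrightarrow> cls (rep i) = i"
begin

abbreviation P where "P x \<equiv> gen (Vertex x)"

text \<open>Position of \<open>x\<close> on its cycle, counted from the chosen vertex. It is fixed
  only modulo \<open>n\<close> and need not lie below \<open>n\<close>. The case distinction pins it
  to 0 at the chosen vertex, where \<open>corner_algebra\<close> demands that
  \<open>U (rep i)\<close> be the idempotent.\<close>

definition idx :: "'v \<Rightarrow> int" where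
  "idx x = (if x = rep (cls x) then 0 else SOME k. x = sh (rep (cls x)) k)"

text \<open>Complete the path of length \<open>k\<close> from \<open>x\<close> to a loop at the
  chosen vertex: \<open>idx x\<close> steps to \<open>x\<close>, then \<open>k\<close> steps, then
  \<open>idx (sh x k)\<close> steps back. The loop length is a multiple of \<open>n\<close>, so the
  division is exact and counts the turns.\<close>

definition winding :: "'v \<Rightarrow> int \<Rightarrow> int" where
  "winding x k = (k + idx x - idx (sh x k)) div n"

lemma P_closed: "x \<in> verts E \<Longrightarrow> P x \<in> carrier L"
  by (simp add: gen_closed)

lemma edge_arc: "x \<in> verts E \<Longrightarrow> edge x \<in> arcs E"
  by (simp add: arcs_edge)

lemma edge_closed: "x \<in> verts E \<Longrightarrow> gen (Edge (edge x)) \<in> carrier L"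
  "x \<in> verts E \<Longrightarrow> gen (Ghost (edge x)) \<in> carrier L"
  by (simp_all add: gen_closed edge_arc)

lemma tail_inj: "inj_on (tail E) (arcs E)"
  by (auto simp: arcs_edge tail_edge intro!: inj_onI)

lemma sh_idx: "x \<in> verts E \<Longrightarrow> sh (rep (cls x)) (idx x) = x"
proof -
  assume x: "x \<in> verts E"
  note r = rep_closed[OF cls_closed[OF x]] cls_rep[OF cls_closed[OF x]]
  show ?thesis
  proof (cases "x = rep (cls x)")
    case True
    then show ?thesis using sh_zero[OF r(1)] by (simp add: idx_def)
  next
    case False
    have "x = sh (rep (cls x)) (SOME k. x = sh (rep (cls x)) k)"
      by (rule someI_ex) (rule cls_eqD[OF r(1) x r(2)])
    then show ?thesis using False by (simp add: idx_def)
  qed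
qed

lemma idx_rep: "i \<in> I \<Longrightarrow> idx (rep i) = 0"
  by (simp add: idx_def cls_rep)

lemma sh_eqD:
  assumes x: "x \<in> verts E" and eq: "sh x a = sh x b"
  shows "n dvd a - b"
proof -
  have "sh (sh x b) (a - b) = sh x b" using sh_sh[OF x, of b "a - b"] eq by simp
  then show ?thesis using period[OF sh_closed[OF x]] by simp
qed

lemma sh_mult: "x \<in> verts E \<Longrightarrow> sh x (n * j) = x"
  by (simp add: period)

text \<open>Counted from the chosen vertex, \<open>idx x + k\<close> and \<open>idx (sh x k)\<close>
  steps lead to the same place, so they differ by a multiple of the period.\<close>

lemma n_winding:
  assumes x: "x \<in> verts E"
  shows "n * winding x k = k + idx x - idx (sh x k)"
proof -
  let ?r = "rep (cls x)"
  note r = rep_closed[OF cls_closed[OF x]]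
  have "sh ?r (idx x + k) = sh x k" using sh_sh[OF r, of "idx x" k] sh_idx[OF x] by simp
  also have "\<dots> = sh ?r (idx (sh x k))" using sh_idx[OF sh_closed[OF x]] cls_sh[OF x] by simp
  finally have "n dvd idx x + k - idx (sh x k)" by (rule sh_eqD[OF r])
  then show ?thesis by (simp add: winding_def algebra_simps)
qed

lemma winding_unique: "\<lbrakk>x \<in> verts E; n * j = k + idx x - idx (sh x k)\<rbrakk> \<Longrightarrow> winding x k = j"
  using n_winding[of x k] n_pos by (metis less_irrefl mult_cancel_left)

lemma winding_zero: "x \<in> verts E \<Longrightarrow> winding x 0 = 0"
  by (rule winding_unique) (simp_all add: sh_zero)

text \<open>The intermediate positions cancel, so \<open>winding\<close> is an additive cocycle.
  This lets the powers of x assigned to paths multiply correctly when paths are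
  concatenated.\<close>

lemma winding_add: "x \<in> verts E \<Longrightarrow> winding x (k + l) = winding x k + winding (sh x k) l"
  by (rule winding_unique) (simp_all add: distrib_left n_winding sh_closed sh_sh)

lemma winding_rep: "i \<in> I \<Longrightarrow> winding (rep i) (n * j) = j"
  by (rule winding_unique) (simp_all add: rep_closed sh_mult idx_rep)

text \<open>Steps count only modulo \<open>n\<close>, so \<open>n\<close> of them exhaust the
  cycle.\<close>

lemma finite_cls:
  assumes i: "i \<in> I"
  shows "finite {v \<in> verts E. cls v = i}"
proof (rule finite_subset)
  note r = rep_closed[OF i]
  show "{v \<in> verts E. cls v = i} \<subseteq> sh (rep i) ` {0..<n}"
  proof
    fix v assume v: "v \<in> {v \<in> verts E. cls v = i}"
    then obtain k where k: "v = sh (rep i) k" using cls_eqD[OF r, of v] cls_rep[OF i] by auto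
    have "sh (sh (rep i) (k mod n)) (n * (k div n)) = sh (rep i) k" by (simp add: sh_sh[OF r])
    then have "v = sh (rep i) (k mod n)" using k sh_mult[OF sh_closed[OF r]] by simp
    then show "v \<in> sh (rep i) ` {0..<n}" using n_pos by auto
  qed
qed simp

lemma ghost_edge: "x \<in> verts E \<Longrightarrow> gen (Ghost (edge x)) \<otimes>\<^bsub>L\<^esub> gen (Edge (edge x)) = P (sh x 1)"
  by (simp add: CK1_mult edge_arc head_edge)

text \<open>A single edge leaves \<open>x\<close>, so the sum in the second Cuntz-Krieger relation
  consists of this one product. Together with \<open>ghost_edge\<close> it makes every edge
  invertible between its end vertices.\<close>

lemma edge_ghost:
  assumes x: "x \<in> verts E"
  shows "gen (Edge (edge x)) \<otimes>\<^bsub>L\<^esub> gen (Ghost (edge x)) = P x"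
proof -
  have "out_arcs E x = {edge x}" using x by (auto simp: arcs_edge tail_edge)
  then show ?thesis using CK2_sum[OF x] x by (simp add: L.mult_closed edge_closed)
qed

section \<open>Signed paths and their groupoid law\<close>

primrec fpath :: "nat \<Rightarrow> 'v \<Rightarrow> (('v, 'e) lpa_gen list \<Rightarrow> 'k) set" where
  "fpath 0 x = P x"
| "fpath (Suc k) x = gen (Edge (edge x)) \<otimes>\<^bsub>L\<^esub> fpath k (sh x 1)"

primrec bpath :: "nat \<Rightarrow> 'v \<Rightarrow> (('v, 'e) lpa_gen list \<Rightarrow> 'k) set" where
  "bpath 0 x = P x"
| "bpath (Suc k) x = gen (Ghost (edge (sh x (-1)))) \<otimes>\<^bsub>L\<^esub> bpath k (sh x (-1))"

text \<open>The unique reduced path of signed length \<open>k\<close> starting at \<open>x\<close>.\<close>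

definition path :: "'v \<Rightarrow> int \<Rightarrow> (('v, 'e) lpa_gen list \<Rightarrow> 'k) set" where
  "path x k = (if k \<ge> 0 then fpath (nat k) x else bpath (nat (- k)) x)"

lemma fpath_closed: "x \<in> verts E \<Longrightarrow> fpath k x \<in> carrier L"
  by (induction k arbitrary: x) (auto simp: P_closed intro!: L.mult_closed edge_closed sh_closed)

lemma bpath_closed: "x \<in> verts E \<Longrightarrow> bpath k x \<in> carrier L"
  by (induction k arbitrary: x) (auto simp: P_closed intro!: L.mult_closed edge_closed sh_closed)

lemma path_closed: "x \<in> verts E \<Longrightarrow> path x k \<in> carrier L"
  by (simp add: path_def fpath_closed bpath_closed)

lemma path_zero: "path x 0 = P x"
  by (simp add: path_def)

lemma P_edge: "x \<in> verts E \<Longrightarrow> P x \<otimes>\<^bsub>L\<^esub> gen (Edge (edge x)) = gen (Edge (edge x))"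
  using source_mult[OF edge_arc] by (simp add: tail_edge)

lemma P_ghost: "x \<in> verts E \<Longrightarrow> P (sh x 1) \<otimes>\<^bsub>L\<^esub> gen (Ghost (edge x)) = gen (Ghost (edge x))"
  using ghost_source_mult[OF edge_arc] by (simp add: head_edge)

lemma sh_back: "x \<in> verts E \<Longrightarrow> sh (sh x (-1)) 1 = x" "x \<in> verts E \<Longrightarrow> sh (sh x 1) (-1) = x"
  by (simp_all add: sh_sh sh_zero)

lemma P_fpath: "x \<in> verts E \<Longrightarrow> P x \<otimes>\<^bsub>L\<^esub> fpath k x = fpath k x"
  by (cases k) (simp_all add: vertex_mult L.mult_assoc[symmetric] P_closed edge_closed fpath_closed
      sh_closed P_edge)

lemma P_bpath: "x \<in> verts E \<Longrightarrow> P x \<otimes>\<^bsub>L\<^esub> bpath k x = bpath k x"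
  using P_ghost[OF sh_closed[of x "-1"]]
  by (cases k) (simp_all add: vertex_mult L.mult_assoc[symmetric] P_closed edge_closed bpath_closed
      sh_closed sh_back)

lemma P_path: "x \<in> verts E \<Longrightarrow> P x \<otimes>\<^bsub>L\<^esub> path x k = path x k"
  by (simp add: path_def P_fpath P_bpath)

text \<open>For \<open>k \<ge> 0\<close> this is the recursion of \<open>fpath\<close>. For negative
  \<open>k\<close> the path at \<open>sh x 1\<close> begins with the ghost of the very edge in front
  of it, and the two cancel to the vertex \<open>x\<close>.\<close>

lemma edge_path:
  assumes x: "x \<in> verts E"
  shows "gen (Edge (edge x)) \<otimes>\<^bsub>L\<^esub> path (sh x 1) k = path x (k + 1)"
proof (cases "k \<ge> 0")
  case True
  then have "nat (k + 1) = Suc (nat k)" by simp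
  then show ?thesis using True by (simp add: path_def)
next
  case False
  define j where "j = nat (- k - 1)"
  with False have j: "nat (- k) = Suc j" "k + 1 = - int j" by auto
  have "gen (Edge (edge x)) \<otimes>\<^bsub>L\<^esub> path (sh x 1) k
      = gen (Edge (edge x)) \<otimes>\<^bsub>L\<^esub> (gen (Ghost (edge x)) \<otimes>\<^bsub>L\<^esub> bpath j x)"
    using False j x by (simp add: path_def sh_back)
  also have "\<dots> = P x \<otimes>\<^bsub>L\<^esub> bpath j x"
    using x by (simp add: L.mult_assoc[symmetric] edge_closed bpath_closed edge_ghost)
  also have "\<dots> = path x (k + 1)" unfolding j(2) P_bpath[OF x] by (cases "j = 0") (simp_all add: path_def)
  finally show ?thesis .
qed

lemma ghost_path:
  assumes x: "x \<in> verts E"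
  shows "gen (Ghost (edge (sh x (-1)))) \<otimes>\<^bsub>L\<^esub> path (sh x (-1)) k = path x (k - 1)"
proof (cases "k > 0")
  case False
  then have "nat (- (k - 1)) = Suc (nat (- k))" by simp
  then show ?thesis using False by (cases "k = 0") (simp_all add: path_def)
next
  case True
  define j where "j = nat (k - 1)"
  with True have j: "nat k = Suc j" "k - 1 = int j" by auto
  have "gen (Ghost (edge (sh x (-1)))) \<otimes>\<^bsub>L\<^esub> path (sh x (-1)) k
      = gen (Ghost (edge (sh x (-1)))) \<otimes>\<^bsub>L\<^esub> (gen (Edge (edge (sh x (-1)))) \<otimes>\<^bsub>L\<^esub> fpath j x)"
    using True j x by (simp add: path_def sh_back)
  also have "\<dots> = P x \<otimes>\<^bsub>L\<^esub> fpath j x"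
    using x by (simp add: L.mult_assoc[symmetric] edge_closed fpath_closed ghost_edge sh_closed sh_back)
  also have "\<dots> = path x (k - 1)" using j(2) x by (simp add: path_def P_fpath)
  finally show ?thesis .
qed

text \<open>Prefixing an edge or a ghost edge moves the starting vertex, so the induction hypothesis
  has to be available at all vertices.\<close>

lemma path_induct [consumes 1, case_names zero up down]:
  fixes k :: int
  assumes "x \<in> verts E" and "\<And>x. x \<in> verts E \<Longrightarrow> Q x 0"
    and "\<And>x k. \<lbrakk>x \<in> verts E; \<And>y. y \<in> verts E \<Longrightarrow> Q y k\<rbrakk> \<Longrightarrow> Q x (k + 1)"
    and "\<And>x k. \<lbrakk>x \<in> verts E; \<And>y. y \<in> verts E \<Longrightarrow> Q y k\<rbrakk> \<Longrightarrow> Q x (k - 1)"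
  shows "Q x k"
proof -
  have "\<forall>x\<in>verts E. Q x k"
    by (induction k rule: int_induct[where k = 0]) (use assms(2-4) in blast)+
  then show ?thesis using assms(1) by blast
qed

text \<open>As edges are invertible, signed paths multiply as in the action groupoid of the integers
  on the vertices. The proof peels edges or ghost edges off the first factor.\<close>

lemma path_mult:
  assumes "x \<in> verts E"
  shows "path x k \<otimes>\<^bsub>L\<^esub> path (sh x k) l = path x (k + l)"
  using assms
proof (induction x k rule: path_induct)
  case (zero x)
  then show ?case by (simp add: path_zero sh_zero P_path)
next
  case (up x k)
  note x = up.hyps
  have e: "path x (k + 1) = gen (Edge (edge x)) \<otimes>\<^bsub>L\<^esub> path (sh x 1) k" by (rule edge_path[OF x, symmetric])
  have s: "sh x (k + 1) = sh (sh x 1) k" using sh_sh[OF x, of 1 k] by (simp add: add.commute)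
  have "path x (k + 1) \<otimes>\<^bsub>L\<^esub> path (sh x (k + 1)) l
      = gen (Edge (edge x)) \<otimes>\<^bsub>L\<^esub> (path (sh x 1) k \<otimes>\<^bsub>L\<^esub> path (sh (sh x 1) k) l)"
    unfolding e s using x by (intro L.mult_assoc path_closed edge_closed sh_closed)
  also have "\<dots> = path x (k + l + 1)"
    unfolding up.IH[OF sh_closed[OF x]] by (rule edge_path[OF x])
  finally show ?case by (simp add: algebra_simps)
next
  case (down x k)
  note x = down.hyps
  let ?y = "sh x (-1)"
  have e: "path x (k - 1) = gen (Ghost (edge ?y)) \<otimes>\<^bsub>L\<^esub> path ?y k" by (rule ghost_path[OF x, symmetric])
  have s: "sh x (k - 1) = sh ?y k" using sh_sh[OF x, of "-1" k] by simp
  have "path x (k - 1) \<otimes>\<^bsub>L\<^esub> path (sh x (k - 1)) l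
      = gen (Ghost (edge ?y)) \<otimes>\<^bsub>L\<^esub> (path ?y k \<otimes>\<^bsub>L\<^esub> path (sh ?y k) l)"
    unfolding e s using x by (intro L.mult_assoc path_closed edge_closed sh_closed)
  also have "\<dots> = path x (k + l - 1)"
    unfolding down.IH[OF sh_closed[OF x]] by (rule ghost_path[OF x])
  finally show ?case by (simp add: algebra_simps)
qed

lemma path_P: "x \<in> verts E \<Longrightarrow> path x k \<otimes>\<^bsub>L\<^esub> P (sh x k) = path x k"
  using path_mult[of x k 0] by (simp add: path_zero)

lemma path_mult_eq: "\<lbrakk>x \<in> verts E; sh x k = y; k + l = j\<rbrakk> \<Longrightarrow> path x k \<otimes>\<^bsub>L\<^esub> path y l = path x j"
  using path_mult by blast

lemma path_orthogonal:
  assumes x: "x \<in> verts E" and y: "y \<in> verts E" and ne: "sh x k \<noteq> y"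
  shows "path x k \<otimes>\<^bsub>L\<^esub> path y l = \<zero>\<^bsub>L\<^esub>"
proof -
  have "path x k \<otimes>\<^bsub>L\<^esub> path y l = (path x k \<otimes>\<^bsub>L\<^esub> P (sh x k)) \<otimes>\<^bsub>L\<^esub> (P y \<otimes>\<^bsub>L\<^esub> path y l)"
    using path_P[OF x] P_path[OF y] by simp
  also have "\<dots> = path x k \<otimes>\<^bsub>L\<^esub> ((P (sh x k) \<otimes>\<^bsub>L\<^esub> P y) \<otimes>\<^bsub>L\<^esub> path y l)"
    using x y by (simp add: L.mult_assoc path_closed P_closed sh_closed L.mult_closed)
  finally show ?thesis
    using x y ne by (simp add: vertex_mult sh_closed L.mult_zero_left L.mult_zero_right path_closed)
qed

abbreviation B where "B \<equiv> laurent_algebra K"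

sublocale B: fs_algebra K UNIV B "(+)"
  by (rule fs_algebra_laurent[OF field_axioms])

text \<open>The monomial x^j goes to the loop that runs \<open>j\<close> times around the cycle from
  its chosen vertex.\<close>

definition \<theta> :: "'i \<Rightarrow> (int \<Rightarrow> 'k) \<Rightarrow> (('v, 'e) lpa_gen list \<Rightarrow> 'k) set" where
  "\<theta> i = lin_ext K L (\<lambda>j. path (rep i) (n * j))"

lemma \<theta>_linear: "i \<in> I \<Longrightarrow> \<theta> i \<in> linear_maps K B L"
  unfolding \<theta>_def by (rule B.lin_ext_linear[OF L.is_module]) (simp add: path_closed rep_closed)

lemma \<theta>_delta: "i \<in> I \<Longrightarrow> \<theta> i (delta K j) = path (rep i) (n * j)"
  unfolding \<theta>_def by (rule B.lin_ext_delta[OF L.is_module]) (simp add: path_closed rep_closed)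

lemma \<theta>_mult: "\<lbrakk>i \<in> I; b \<in> carrier B; b' \<in> carrier B\<rbrakk> \<Longrightarrow> \<theta> i (b \<otimes>\<^bsub>B\<^esub> b') = \<theta> i b \<otimes>\<^bsub>L\<^esub> \<theta> i b'"
  unfolding \<theta>_def
  by (rule B.lin_ext_mult[OF L.nonunital_algebra_axioms])
    (simp_all add: path_closed rep_closed path_mult_eq sh_mult distrib_left)

lemma delta_unit:
  assumes b: "b \<in> carrier B"
  shows "b \<otimes>\<^bsub>B\<^esub> delta K 0 = b" "delta K 0 \<otimes>\<^bsub>B\<^esub> b = b"
  by (rule B.fs_linear_eq[OF b _ linear_maps_id B.fs_is_module];
      simp add: B.mult_left B.mult_right B.delta_closed B.delta_mult)+

text \<open>The path is rerouted through the chosen vertex: back from \<open>x\<close>, around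
  \<open>winding x k\<close> times, and forward to the end point. Such a detour does not change the
  element, since lengths simply add. Paths are thereby products of the form that
  \<open>spanning\<close> asks for.\<close>

lemma path_eq_sandwich:
  assumes x: "x \<in> verts E"
  shows "path x (- idx x) \<otimes>\<^bsub>L\<^esub>
    (path (rep (cls x)) (n * winding x k) \<otimes>\<^bsub>L\<^esub> path (rep (cls x)) (idx (sh x k))) = path x k"
proof -
  let ?r = "rep (cls x)"
  note r = rep_closed[OF cls_closed[OF x]]
  have "path ?r (n * winding x k) \<otimes>\<^bsub>L\<^esub> path ?r (idx (sh x k)) = path ?r (idx x + k)"
    by (rule path_mult_eq[OF r sh_mult[OF r]]) (simp add: n_winding x)
  moreover have "sh x (- idx x) = ?r" using sh_sh[OF r, of "idx x" "- idx x"] sh_idx[OF x] sh_zero[OF r] by simp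
  ultimately show ?thesis using path_mult_eq[OF x, of "- idx x" ?r "idx x + k"] by simp
qed

lemma sh_minus_idx: "x \<in> verts E \<Longrightarrow> sh x (- idx x) = rep (cls x)"
  using sh_sh[OF rep_closed[OF cls_closed], of x "idx x" "- idx x"] sh_idx[of x]
    sh_zero[OF rep_closed[OF cls_closed], of x] by simp

text \<open>\<open>U v\<close> is the path from the chosen vertex to \<open>v\<close>, and
  \<open>W v\<close> is its inverse. All axioms except spanning are instances of the groupoid law
  and of the properties of \<open>\<theta>\<close>.\<close>

sublocale corner: corner_algebra K L "verts E" "\<lambda>v. gen (Vertex v)" B "delta K 0" I cls rep
  "\<lambda>v. path (rep (cls v)) (idx v)" "\<lambda>v. path v (- idx v)" \<theta>
proof (intro corner_algebra.intro corner_algebra_axioms.intro L_idempotent_algebra B.fs_is_algebra)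
  fix X assume X: "X \<subseteq> carrier L" "\<zero>\<^bsub>L\<^esub> \<in> X" "\<And>x y. \<lbrakk>x \<in> X; y \<in> X\<rbrakk> \<Longrightarrow> x \<oplus>\<^bsub>L\<^esub> y \<in> X"
    and WU: "\<And>v w b. \<lbrakk>v \<in> verts E; w \<in> verts E; cls v = cls w; b \<in> carrier B\<rbrakk>
      \<Longrightarrow> path v (- idx v) \<otimes>\<^bsub>L\<^esub> (\<theta> (cls v) b \<otimes>\<^bsub>L\<^esub> path (rep (cls w)) (idx w)) \<in> X"
  \<comment> \<open>The scalar multiples of signed paths contain the generators, which have length
    0, 1 and -1, and are closed under products up to zero.\<close>
  let ?T = "{k \<odot>\<^bsub>L\<^esub> path x j | k x j. k \<in> carrier K \<and> x \<in> verts E}"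
  have incl: "path x j \<in> ?T" if x: "x \<in> verts E" for x j
  proof -
    have "path x j = \<one> \<odot>\<^bsub>L\<^esub> path x j" using path_closed[OF x] by simp
    then show ?thesis using x by blast
  qed
  show "carrier L \<subseteq> X"
  proof (rule additively_spanning[of ?T])
    show "?T \<subseteq> carrier L" using path_closed by auto
    show "k \<odot>\<^bsub>L\<^esub> t \<in> ?T" if k: "k \<in> carrier K" and t: "t \<in> ?T" for k t
    proof -
      obtain l x j where t: "t = l \<odot>\<^bsub>L\<^esub> path x j" "l \<in> carrier K" "x \<in> verts E" using t by blast
      have "k \<odot>\<^bsub>L\<^esub> t = (k \<otimes> l) \<odot>\<^bsub>L\<^esub> path x j" using k t path_closed by (simp add: L.smult_assoc1)
      then show ?thesis using k t by blast
    qed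
    show "s \<otimes>\<^bsub>L\<^esub> t \<in> insert \<zero>\<^bsub>L\<^esub> ?T" if s: "s \<in> ?T" and t: "t \<in> ?T" for s t
    proof -
      obtain l y j where t: "t = l \<odot>\<^bsub>L\<^esub> path y j" "l \<in> carrier K" "y \<in> verts E" using t by blast
      obtain k x i where s: "s = k \<odot>\<^bsub>L\<^esub> path x i" "k \<in> carrier K" "x \<in> verts E" using s by blast
      have st: "s \<otimes>\<^bsub>L\<^esub> t = (k \<otimes> l) \<odot>\<^bsub>L\<^esub> (path x i \<otimes>\<^bsub>L\<^esub> path y j)"
        using s t path_closed
        by (simp add: L.mult_smult_left L.mult_smult_right L.mult_closed L.smult_assoc1[symmetric] m_comm)
      show ?thesis
      proof (cases "sh x i = y")
        case True
        have kl: "k \<otimes> l \<in> carrier K" using s t by simp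
        have "s \<otimes>\<^bsub>L\<^esub> t = (k \<otimes> l) \<odot>\<^bsub>L\<^esub> path x (i + j)"
          using st path_mult_eq[OF s(3) True] by simp
        then show ?thesis using kl s(3) by blast
      next
        case False
        then show ?thesis using st path_orthogonal[OF s(3) t(3)] s t by simp
      qed
    qed
    show "gen g \<in> ?T" if g: "g \<in> lpa_gens E" for g
    proof -
      from g consider x where "g = Vertex x" "x \<in> verts E" | x where "g = Edge (edge x)" "x \<in> verts E"
        | x where "g = Ghost (edge x)" "x \<in> verts E" by (auto simp: lpa_gens_def arcs_edge)
      then show ?thesis
      proof cases
        case 1
        then show ?thesis using incl[of x 0] by (simp add: path_zero)
      next
        case 2
        have "gen (Edge (edge x)) \<otimes>\<^bsub>L\<^esub> path (sh x 1) 0 = gen (Edge (edge x))"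
          using range_mult[OF edge_arc[OF 2(2)]] 2(2) by (simp add: path_zero head_edge)
        then show ?thesis using incl[of x 1] edge_path[of x 0] 2 by simp
      next
        case 3
        have "gen (Ghost (edge x)) \<otimes>\<^bsub>L\<^esub> path x 0 = gen (Ghost (edge x))"
          using ghost_range_mult[OF edge_arc[OF 3(2)]] 3(2) by (simp add: path_zero tail_edge)
        then show ?thesis
          using incl[of "sh x 1" "-1"] ghost_path[of "sh x 1" 0] 3 sh_closed by (simp add: sh_back)
      qed
    qed
    show "?T \<subseteq> X"
    proof
      fix t assume "t \<in> ?T"
      then obtain k x j where t: "t = k \<odot>\<^bsub>L\<^esub> path x j" "k \<in> carrier K" "x \<in> verts E" by blast
      let ?r = "rep (cls x)"
      note i = cls_closed[OF t(3)]
      note r = rep_closed[OF i]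
      \<comment> \<open>The monomial whose exponent \<open>path_eq_sandwich\<close> dictates;
        \<open>\<theta>\<close> sends it to the middle loop of the rerouted path.\<close>
      let ?b = "k \<odot>\<^bsub>B\<^esub> delta K (winding x j)"
      have b: "?b \<in> carrier B" by (rule B.fs_smult_closed[OF t(2) B.delta_closed]) simp
      have "\<theta> (cls x) ?b = k \<odot>\<^bsub>L\<^esub> path ?r (n * winding x j)"
        using linear_maps_smult[OF \<theta>_linear[OF i] t(2) B.delta_closed] by (simp add: \<theta>_delta[OF i])
      then have "path x (- idx x) \<otimes>\<^bsub>L\<^esub> (\<theta> (cls x) ?b \<otimes>\<^bsub>L\<^esub> path ?r (idx (sh x j)))
          = k \<odot>\<^bsub>L\<^esub> (path x (- idx x) \<otimes>\<^bsub>L\<^esub> (path ?r (n * winding x j) \<otimes>\<^bsub>L\<^esub> path ?r (idx (sh x j))))"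
        using t r by (simp add: L.mult_smult_left L.mult_smult_right path_closed L.mult_closed)
      also have "\<dots> = t" using path_eq_sandwich[OF t(3)] t(1) by simp
      finally show "t \<in> X"
        using WU[OF t(3) sh_closed[OF t(3)] _ b, of j] cls_sh[OF t(3)] by simp
    qed
  qed (use X in auto)
next
  fix v assume v: "v \<in> verts E"
  note r = rep_closed[OF cls_closed[OF v]]
  show "path (rep (cls v)) (idx v) \<otimes>\<^bsub>L\<^esub> gen (Vertex v) = path (rep (cls v)) (idx v)"
    using path_P[OF r, of "idx v"] sh_idx[OF v] by simp
  show "path v (- idx v) \<otimes>\<^bsub>L\<^esub> gen (Vertex (rep (cls v))) = path v (- idx v)"
    using path_P[OF v, of "- idx v"] sh_minus_idx[OF v] by simp
  show "path (rep (cls v)) (idx v) \<otimes>\<^bsub>L\<^esub> path v (- idx v) = gen (Vertex (rep (cls v)))"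
    using path_mult_eq[OF r sh_idx[OF v], of "- idx v" 0] by (simp add: path_zero)
  show "path v (- idx v) \<otimes>\<^bsub>L\<^esub> path (rep (cls v)) (idx v) = gen (Vertex v)"
    using path_mult_eq[OF v sh_minus_idx[OF v], of "idx v" 0] by (simp add: path_zero)
qed (simp_all add: cls_closed rep_closed cls_rep finite_cls path_closed P_path idx_rep path_zero
    \<theta>_linear \<theta>_delta \<theta>_mult delta_unit B.delta_closed)

text \<open>\<open>N (cls v)\<close> is placed at every vertex \<open>v\<close>, and each edge acts
  as a power of x. The exponents must add up to 1 around a cycle, so that the loop at the chosen
  vertex acts as x.\<close>

lemma realizable:
  fixes N :: "'i \<Rightarrow> ('k, int \<Rightarrow> 'k, 'u) rmodule"
  assumes N: "\<And>i. i \<in> I \<Longrightarrow> N i \<in> Obj (fd_modules K B)"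
  shows "\<exists>M. corner.realizes M N"
proof -
  let ?N = "\<lambda>v. N (cls v)"
  let ?V = "verts E"
  define T where "T i j x = act (N i) x (delta K j)" for i j x
  have Nm: "right_module K B (N i)" if "i \<in> I" for i by (rule fd_modules_Obj(1)[OF N[OF that]])
  have Nv: "Module.module K (?N v)" if "v \<in> ?V" for v
    by (rule right_module.modules(2)[OF Nm[OF cls_closed[OF that]]])
  have dB: "delta K j \<in> carrier B" for j :: int by (rule B.delta_closed) simp
  have T: "T i j \<in> linear_maps K (N i) (N i)" if "i \<in> I" for i j
    unfolding T_def by (rule right_module.act_linear_left[OF Nm[OF that] dB])
  have T0: "T i 0 x = x" if "i \<in> I" "x \<in> carrier (N i)" for i x
    unfolding T_def by (rule corner.unit_acts[OF fd_modules_Obj(2)[OF N[OF that(1)]] that(2)])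
  have TT: "T i k (T i j x) = T i (j + k) x" if "i \<in> I" "x \<in> carrier (N i)" for i j k x
    unfolding T_def using right_module.act_mult[OF Nm[OF that(1)] that(2) dB dB] by (simp add: B.delta_mult)
  \<comment> \<open>The exponent of an edge is its winding. If positions are counted from 0 to n -
    1, only the edge that closes the cycle gets a nonzero exponent; other choices of
    \<open>idx\<close> redistribute the exponents without changing their sum.\<close>
  let ?f = "\<lambda>e. T (cls (tail E e)) (winding (tail E e) 1)"
  let ?f' = "\<lambda>e. T (cls (tail E e)) (- winding (tail E e) 1)"
  have cls_head: "cls (head E e) = cls (tail E e)" if "e \<in> arcs E" for e
    using that by (auto simp: arcs_edge tail_edge head_edge cls_sh)
  obtain M :: "('k, (('v, 'e) lpa_gen list \<Rightarrow> 'k) set, 'v \<Rightarrow> 'u) rmodule"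
    where M: "right_module K L M" "carrier M = (\<Pi>\<^sub>E v\<in>?V. carrier (?N v))"
      "\<zero>\<^bsub>M\<^esub> = (\<lambda>v\<in>?V. \<zero>\<^bsub>?N v\<^esub>)"
      "add M = (\<lambda>m n. \<lambda>v\<in>?V. m v \<oplus>\<^bsub>?N v\<^esub> n v)" "smult M = (\<lambda>k m. \<lambda>v\<in>?V. k \<odot>\<^bsub>?N v\<^esub> m v)"
    and actP: "\<And>m v. \<lbrakk>m \<in> carrier M; v \<in> ?V\<rbrakk>
      \<Longrightarrow> act M m (gen (Vertex v)) = entry_map ?V ?N v v (\<lambda>n. n) m"
    and actE: "\<And>m e. \<lbrakk>m \<in> carrier M; e \<in> arcs E\<rbrakk>
      \<Longrightarrow> act M m (gen (Edge e)) = entry_map ?V ?N (tail E e) (head E e) (?f e) m"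
    and actG: "\<And>m e. \<lbrakk>m \<in> carrier M; e \<in> arcs E\<rbrakk>
      \<Longrightarrow> act M m (gen (Ghost e)) = entry_map ?V ?N (head E e) (tail E e) (?f' e) m"
  proof (rule product_representation[OF tail_inj, of ?N ?f ?f'])
    fix e assume e: "e \<in> arcs E"
    note i = cls_closed[OF tail_in_verts[OF e]]
    show "?f e \<in> linear_maps K (?N (tail E e)) (?N (head E e))"
      "?f' e \<in> linear_maps K (?N (head E e)) (?N (tail E e))"
      using T[OF i] cls_head[OF e] by simp_all
    show "?f' e (?f e x) = x" if "x \<in> carrier (?N (tail E e))" for x
      using TT[OF i that] T0[OF i that] by simp
    show "?f e (?f' e x) = x" if "x \<in> carrier (?N (head E e))" for x
      using TT[OF i] T0[OF i] cls_head[OF e] that by simp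
  qed (use Nv in auto)
  interpret M: right_module K L M by (rule M(1))
  have Mprod: "carrier M = carrier (prod_module ?V ?N)" by (simp add: M(2) prod_module_def)
  \<comment> \<open>A path acts as the power of x given by its winding, by induction on its length
    with \<open>winding_add\<close> at each step.\<close>
  have act_path: "\<forall>m\<in>carrier M. act M m (path x k) = entry_map ?V ?N x (sh x k) (T (cls x) (winding x k)) m"
    if x: "x \<in> ?V" for x k
    using x
  proof (induction x k rule: path_induct)
    case (zero x)
    show ?case
    proof
      fix m assume m: "m \<in> carrier M"
      have "act M m (path x 0) = entry_map ?V ?N x x (\<lambda>n. n) m"
        using actP[OF m zero] by (simp add: path_zero)
      also have "\<dots> = entry_map ?V ?N x x (T (cls x) 0) m"
        by (rule entry_map_cong) (use m Mprod zero T0[OF cls_closed[OF zero]] in auto)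
      finally show "act M m (path x 0) = entry_map ?V ?N x (sh x 0) (T (cls x) (winding x 0)) m"
        using zero by (simp add: sh_zero winding_zero)
    qed
  next
    case (up x k)
    note x = up.hyps
    note i = cls_closed[OF x]
    show ?case
    proof
      fix m assume m: "m \<in> carrier M"
      let ?y = "sh x 1"
      have y: "?y \<in> ?V" "cls ?y = cls x" using x by (simp_all add: sh_closed cls_sh)
      have "act M m (path x (k + 1)) = act M (act M m (gen (Edge (edge x)))) (path ?y k)"
        using M.act_mult[OF m edge_closed(1)[OF x] path_closed[OF y(1)]] edge_path[OF x] by simp
      also have "\<dots> = entry_map ?V ?N ?y (sh ?y k) (T (cls x) (winding ?y k)) (act M m (gen (Edge (edge x))))"
        using up.IH[OF y(1)] M.act_closed[OF m edge_closed(1)[OF x]] y(2) by simp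
      also have "act M m (gen (Edge (edge x))) = entry_map ?V ?N x ?y (T (cls x) (winding x 1)) m"
        using actE[OF m edge_arc[OF x]] x by (simp add: tail_edge head_edge)
      also have "entry_map ?V ?N ?y (sh ?y k) (T (cls x) (winding ?y k))
            (entry_map ?V ?N x ?y (T (cls x) (winding x 1)) m)
          = entry_map ?V ?N x (sh ?y k) (\<lambda>n. T (cls x) (winding ?y k) (T (cls x) (winding x 1) n)) m"
        by (subst entry_map_comp[OF is_cring Nv])
          (use x y T[OF i] in \<open>simp_all add: sh_closed cls_sh\<close>)
      also have "\<dots> = entry_map ?V ?N x (sh ?y k) (T (cls x) (winding x (1 + k))) m"
        by (rule entry_map_cong) (use m Mprod x TT[OF i] in \<open>simp_all add: winding_add\<close>)
      finally show "act M m (path x (k + 1))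
          = entry_map ?V ?N x (sh x (k + 1)) (T (cls x) (winding x (k + 1))) m"
        using x by (simp add: sh_sh add.commute)
    qed
  next
    case (down x k)
    note x = down.hyps
    note i = cls_closed[OF x]
    show ?case
    proof
      fix m assume m: "m \<in> carrier M"
      let ?y = "sh x (-1)"
      have y: "?y \<in> ?V" "cls ?y = cls x" using x by (simp_all add: sh_closed cls_sh)
      have yx: "sh ?y 1 = x" by (rule sh_back(1)[OF x])
      \<comment> \<open>Going one step forward and one step back has total winding 0. The exponent
        assigned to a ghost edge is therefore its winding as a path of length -1.\<close>
      have w: "- winding ?y 1 = winding x (-1)"
        using winding_add[OF y(1), of 1 "-1"] yx winding_zero[OF y(1)] by simp
      have "act M m (path x (k - 1)) = act M (act M m (gen (Ghost (edge ?y)))) (path ?y k)"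
        using M.act_mult[OF m edge_closed(2)[OF y(1)] path_closed[OF y(1)]] ghost_path[OF x] by simp
      also have "\<dots> = entry_map ?V ?N ?y (sh ?y k) (T (cls x) (winding ?y k)) (act M m (gen (Ghost (edge ?y))))"
        using down.IH[OF y(1)] M.act_closed[OF m edge_closed(2)[OF y(1)]] y(2) by simp
      also have "act M m (gen (Ghost (edge ?y))) = entry_map ?V ?N x ?y (T (cls x) (winding x (-1))) m"
        using actG[OF m edge_arc[OF y(1)]] y w yx by (simp add: tail_edge head_edge)
      also have "entry_map ?V ?N ?y (sh ?y k) (T (cls x) (winding ?y k))
            (entry_map ?V ?N x ?y (T (cls x) (winding x (-1))) m)
          = entry_map ?V ?N x (sh ?y k) (\<lambda>n. T (cls x) (winding ?y k) (T (cls x) (winding x (-1)) n)) m"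
        by (subst entry_map_comp[OF is_cring Nv])
          (use x y T[OF i] in \<open>simp_all add: sh_closed cls_sh\<close>)
      also have "\<dots> = entry_map ?V ?N x (sh ?y k) (T (cls x) (winding x (k - 1))) m"
        by (rule entry_map_cong)
          (use m Mprod x TT[OF i] winding_add[OF x, of "-1" k] in simp_all)
      finally show "act M m (path x (k - 1))
          = entry_map ?V ?N x (sh x (k - 1)) (T (cls x) (winding x (k - 1))) m"
        using x by (simp add: sh_sh)
    qed
  qed
  \<comment> \<open>Both sides are linear in \<open>b\<close>, so monomials suffice. The loop of
    length \<open>n * j\<close> at the chosen vertex has winding \<open>j\<close> and hence acts as
    x^j does.\<close>
  have act_\<theta>: "act M m (\<theta> i b) (rep i) = act (N i) (m (rep i)) b"
    if m: "m \<in> carrier M" and i: "i \<in> I" and b: "b \<in> carrier B" for m i b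
  proof -
    note r = rep_closed[OF i]
    have Mr: "x (rep i) \<in> carrier (N i)" if "x \<in> carrier M" for x
    proof -
      have "x (rep i) \<in> carrier (N (cls (rep i)))" using that r by (auto simp: M(2))
      then show ?thesis by (simp only: cls_rep[OF i])
    qed
    note mr = Mr[OF m]
    have eval: "(\<lambda>m. m (rep i)) \<in> linear_maps K M (N i)"
      using Mr r cls_rep[OF i] by (intro linear_mapsI) (simp_all add: M(4,5))
    show ?thesis
    proof (rule B.fs_linear_eq[OF b _ right_module.act_linear_right[OF Nm[OF i] mr]])
      show "(\<lambda>b. act M m (\<theta> i b) (rep i)) \<in> linear_maps K B (N i)"
        by (rule linear_maps_comp[OF linear_maps_comp[OF \<theta>_linear[OF i] M.act_linear_right[OF m]] eval])
      show "Module.module K (N i)" by (rule right_module.modules(2)[OF Nm[OF i]])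
      fix j :: int
      show "act M m (\<theta> i (delta K j)) (rep i) = act (N i) (m (rep i)) (delta K j)"
        using act_path[OF r, of "n * j"] m r i
        by (simp add: \<theta>_delta sh_mult winding_rep cls_rep entry_map_def T_def)
    qed
  qed
  have "corner.realizes M N"
    unfolding corner.realizes_def using M actP act_\<theta>
    by (auto simp: entry_map_def fun_eq_iff)
  then show ?thesis by blast
qed

lemma equivalence:
  fixes \<iota> :: "'k list \<Rightarrow> 'u"
  assumes \<iota>: "inj_on \<iota> (lists (carrier K))"
  shows "equivalent_cats (fd_modules K L :: ((_, _, 'u) rmodule, _) cat)
    (direct_sum_cat (fd_modules K (laurent_algebra K) :: ((_, _, 'u) rmodule, _) cat) I)"
  by (rule corner.corner_equivalence[OF \<iota> realizable])

lemma nonzero_module: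
  fixes \<iota> :: "'k list \<Rightarrow> 'u"
  assumes \<iota>: "inj_on \<iota> (lists (carrier K))" and i: "i \<in> I"
  shows "\<exists>M\<in>Obj (fd_modules K L :: ((_, _, 'u) rmodule, _) cat). carrier M \<noteq> {\<zero>\<^bsub>M\<^esub>}"
proof -
  interpret F: nonunital_algebra K "field_algebra K" by (rule field_algebra_is_algebra)
  \<comment> \<open>Evaluation at x = 1, the character that sends every monomial to one.\<close>
  let ?\<chi> = "lin_ext K (field_algebra K) (\<lambda>_ :: int. \<one>)"
  have one: "\<one> \<in> carrier (field_algebra K)" by (simp add: field_algebra_def)
  have "\<exists>N :: ('k, int \<Rightarrow> 'k, 'u) rmodule. N \<in> Obj (fd_modules K B) \<and> carrier N \<noteq> {\<zero>\<^bsub>N\<^esub>}"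
  proof (rule nonzero_character_module[OF field_axioms B.fs_is_algebra _ _ _ _ \<iota>, of ?\<chi> "delta K 0"])
    show "?\<chi> \<in> linear_maps K B (field_algebra K)" by (rule B.lin_ext_linear[OF F.is_module one])
    show "?\<chi> (a \<otimes>\<^bsub>B\<^esub> b) = ?\<chi> a \<otimes> ?\<chi> b" if "a \<in> carrier B" "b \<in> carrier B" for a b
      using B.lin_ext_mult[OF F.nonunital_algebra_axioms one _ that] by (simp add: field_algebra_def)
    show "?\<chi> (delta K 0) = \<one>"
      by (rule B.lin_ext_delta[OF F.is_module, of "\<lambda>_. \<one>"]) (rule one)
  qed (simp add: B.delta_closed)
  then show ?thesis using corner.nonzero_fd_module[OF \<iota> i realizable] by blast
qed

end

section \<open>The two conditions as graph shapes\<close>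

context hopf_field
begin

lemma edgeless:
  assumes "ram_zero G \<rr>"
  shows "edgeless_lpa K (hopf_graph G \<rr>)"
  by unfold_locales (use assms labels_empty_iff arcs_hopf in simp)

text \<open>The edges lead from x to x c with c central. If c has finite order, the graph is a
  disjoint union of cycles of length \<open>ord c\<close>, and the vertices of each cycle form one
  coset of the subgroup generated by c.\<close>

lemma cyclic:
  assumes deg: "ram_degree G \<rr> = 1" and sub: "submonoid (ram_semigroup G \<rr>) G"
  obtains edge sh n cls rep where
    "cycle_lpa K (hopf_graph G \<rr>) edge sh n (carrier (G Mod ram_semigroup G \<rr>)) cls rep"
proof -
  obtain c where lab: "labels = {({c}, c, 0)}" and c: "c \<in> carrier G" and cc: "{c} \<in> conj_classes G"
    and supp: "ram_supp G \<rr> = {{c}}" using label_class[OF deg] by metis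
  let ?S = "ram_semigroup G \<rr>"
  have S_nat: "s \<in> ?S \<Longrightarrow> \<exists>m :: nat. m > 0 \<and> s = c [^] m" for s
  proof (induction rule: ram_semigroup.induct)
    case (gen d)
    then show ?case using c supp by (intro exI[of _ 1]) simp
  next
    case (mult a b)
    then obtain k m :: nat where km: "k > 0" "a = c [^] k" "m > 0" "b = c [^] m" by blast
    then show ?case using c by (intro exI[of _ "k + m"]) (simp add: nat_pow_mult)
  qed
  \<comment> \<open>The semigroup consists of the positive powers of \<open>c\<close>. That it
    contains the identity says precisely that \<open>c\<close> has finite order.\<close>
  obtain m :: nat where m: "m > 0" "\<one> = c [^] m" using S_nat[OF submonoid.one_closed[OF sub]] by blast
  have ord: "ord c > 0" using ord_eq_0[OF c] m by (metis neq0_conv)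
  have S_int: "?S = range (\<lambda>k :: int. c [^] k)"
  proof (intro equalityI subsetI)
    fix s assume "s \<in> ?S"
    then obtain k :: nat where "s = c [^] k" using S_nat by blast
    then have "s = c [^] int k" by (simp add: int_pow_int)
    then show "s \<in> range (\<lambda>k :: int. c [^] k)" by blast
  next
    fix s assume "s \<in> range (\<lambda>k :: int. c [^] k)"
    then obtain k :: int where k: "s = c [^] k" by blast
    \<comment> \<open>The remainder of \<open>k\<close> may be 0, while the semigroup is built from
      positive powers only. Adding \<open>ord c\<close> makes the exponent positive and leaves the
      power unchanged.\<close>
    let ?l = "nat (k mod int (ord c)) + ord c"
    have "int ?l = k mod int (ord c) + int (ord c)" using ord by simp
    then have "int ?l - k = int (ord c) * (1 - k div int (ord c))"
      using mult_div_mod_eq[of "int (ord c)" k] by (simp add: algebra_simps)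
    then have "int (ord c) dvd int ?l - k" by simp
    then have "s = c [^] int ?l" using int_pow_eq[OF c, of k "int ?l"] k by simp
    also have "\<dots> = c [^] ?l" by (simp only: int_pow_int)
    also have "\<dots> \<in> ?S" by (rule nat_pow_in_semigroup) (use c supp ord in auto)
    finally show "s \<in> ?S" .
  qed
  \<comment> \<open>The elements of \<open>G Mod ?S\<close> are cosets with \<open>x\<close> on the
    right, but edges multiply by \<open>c\<close> on the right of \<open>x\<close>. Centrality of
    \<open>c\<close> reconciles the two sides.\<close>
  have comm: "s \<otimes> x = x \<otimes> s" if s: "s \<in> ?S" and x: "x \<in> carrier G" for s x
  proof -
    obtain k :: nat where "s = c [^] k" using S_nat[OF s] by blast
    moreover have "c [^] k \<otimes> x = x \<otimes> c [^] k" for k :: nat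
    proof (induction k)
      case (Suc k)
      have "c [^] Suc k \<otimes> x = c [^] k \<otimes> (c \<otimes> x)" using c x by (simp add: m_assoc)
      also have "\<dots> = c [^] k \<otimes> (x \<otimes> c)" using singleton_class_central[OF cc x] by simp
      also have "\<dots> = (c [^] k \<otimes> x) \<otimes> c" using c x by (simp add: m_assoc)
      also have "\<dots> = x \<otimes> c [^] Suc k" unfolding Suc using c x by (simp add: m_assoc)
      finally show ?case .
    qed (use x in simp)
    ultimately show ?thesis by simp
  qed
  define cls where "cls x = ?S #> x" for x
  define rep where "rep i = (SOME x. x \<in> carrier G \<and> cls x = i)" for i
  define sh where "sh x k = x \<otimes> c [^] k" for x and k :: int
  define edge where "edge x = (x, {c}, c, 0 :: nat)" for x :: 'g
  \<comment> \<open>The coset of \<open>x\<close> is the set of vertices reached from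
    \<open>x\<close> in either direction, so that cosets name cycles.\<close>
  have cls_eq: "cls x = range (sh x)" if x: "x \<in> carrier G" for x
  proof -
    have "cls x = (\<lambda>s. x \<otimes> s) ` ?S"
      using comm[OF _ x] by (force simp: cls_def r_coset_def)
    also have "\<dots> = range (sh x)" unfolding S_int by (simp add: sh_def image_image)
    finally show ?thesis .
  qed
  have sh: "sh x k \<in> carrier G" "sh x 0 = x" "sh (sh x k) l = sh x (k + l)" if "x \<in> carrier G" for x k l
    using that c by (simp_all add: sh_def m_assoc int_pow_mult)
  have cls_sh: "cls (sh x k) = cls x" if x: "x \<in> carrier G" for x k
  proof -
    have "range (sh (sh x k)) = range (sh x)"
    proof (intro equalityI subsetI)
      fix y assume "y \<in> range (sh x)"
      then obtain l where "y = sh x l" by blast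
      then have "y = sh (sh x k) (l - k)" using sh(3)[OF x] by simp
      then show "y \<in> range (sh (sh x k))" by blast
    qed (use sh(3)[OF x] in auto)
    then show ?thesis using cls_eq x sh(1)[OF x] by simp
  qed
  have I: "carrier (G Mod ?S) = cls ` carrier G"
    by (auto simp: FactGroup_def RCOSETS_def cls_def)
  have rep: "rep i \<in> carrier G \<and> cls (rep i) = i" if "i \<in> carrier (G Mod ?S)" for i
    unfolding rep_def by (rule someI_ex) (use that I in auto)
  have "cycle_lpa K (hopf_graph G \<rr>) edge sh (int (ord c)) (carrier (G Mod ?S)) cls rep"
  proof unfold_locales
    show "arcs (hopf_graph G \<rr>) = edge ` verts (hopf_graph G \<rr>)"
      by (auto simp: arcs_hopf lab verts_hopf edge_def)
    show "0 < int (ord c)" using ord by simp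
    fix x assume "x \<in> verts (hopf_graph G \<rr>)"
    then have x: "x \<in> carrier G" by (simp add: verts_hopf)
    show "tail (hopf_graph G \<rr>) (edge x) = x" "head (hopf_graph G \<rr>) (edge x) = sh x 1"
      using c by (simp_all add: edge_def tail_hopf head_hopf shift_def sh_def)
    fix k l :: int
    show "sh x k \<in> verts (hopf_graph G \<rr>)" "sh x 0 = x" "sh (sh x k) l = sh x (k + l)"
      using sh[OF x] by (simp_all add: verts_hopf)
    \<comment> \<open>Cancelling \<open>x\<close> shows that the return time is the same at every
      vertex, which gives all cycles the common length \<open>ord c\<close>.\<close>
    have "sh x k = x \<longleftrightarrow> c [^] k = \<one>" using x c by (simp add: sh_def)
    then show "(sh x k = x) = (int (ord c) dvd k)" using int_pow_eq_id[OF c] by simp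
    show "cls x \<in> carrier (G Mod ?S)" using I x by simp
    show "cls (sh x k) = cls x" by (rule cls_sh[OF x])
    fix y assume "y \<in> verts (hopf_graph G \<rr>)" "cls x = cls y"
    then have "y \<in> carrier G" "range (sh x) = range (sh y)" using cls_eq x by (simp_all add: verts_hopf)
    then have "y \<in> range (sh x)" using sh(2)[of y] by (metis rangeI)
    then show "\<exists>k. y = sh x k" by blast
  next
    fix i assume "i \<in> carrier (G Mod ?S)"
    then show "rep i \<in> verts (hopf_graph G \<rr>)" "cls (rep i) = i" using rep by (simp_all add: verts_hopf)
  qed
  then show ?thesis by (rule that)
qed

end

theorem theorem3p9:
  fixes G :: "('g, 'x) monoid_scheme" and \<rr> :: "'g set \<Rightarrow> nat" and K :: "('k, 'y) ring_scheme"
  assumes "group G" and "finite_support G \<rr>" and "field K"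
    \<comment> \<open>the universe \<open>'u\<close> has room for a copy of every \<open>K\<^sup>n\<close>\<close>
    and universe: "\<exists>\<iota> :: 'k list \<Rightarrow> 'u. inj_on \<iota> (lists (carrier K))"
  defines "L \<equiv> leavitt_path_algebra K (hopf_graph G \<rr>)"
  defines "fd_L \<equiv> fd_modules K L :: (_, 'u \<Rightarrow> 'u) cat"
    and "fd_K \<equiv> fd_modules K (field_algebra K) :: (_, 'u \<Rightarrow> 'u) cat"
    and "fd_laurent \<equiv> fd_modules K (laurent_algebra K) :: (_, 'u \<Rightarrow> 'u) cat"
  defines "cond1 \<equiv> ram_zero G \<rr>"
    and "cond2 \<equiv> ram_degree G \<rr> = 1 \<and> submonoid (ram_semigroup G \<rr>) G"
  shows "((\<exists>M\<in>Obj fd_L. carrier M \<noteq> {\<zero>\<^bsub>M\<^esub>}) \<longleftrightarrow> cond1 \<or> cond2) \<and>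
    (cond1 \<or> cond2 \<longrightarrow>
      (if cond1 then equivalent_cats fd_L (direct_sum_cat fd_K (carrier G))
       else equivalent_cats fd_L
              (direct_sum_cat fd_laurent (carrier (G Mod ram_semigroup G \<rr>)))))"
proof -
  interpret hopf_field G \<rr> K
    using assms(1-3) by (intro hopf_field.intro hopf.intro hopf_axioms.intro)
  obtain \<iota> :: "'k list \<Rightarrow> 'u" where \<iota>: "inj_on \<iota> (lists (carrier K))" using universe by blast
  have necessary: "cond1 \<or> cond2" if "\<exists>M\<in>Obj fd_L. carrier M \<noteq> {\<zero>\<^bsub>M\<^esub>}"
    using that nonzero_module_imp_trivial_or_cyclic
    unfolding fd_L_def L_def cond1_def cond2_def by blast
  have case1: "(\<exists>M\<in>Obj fd_L. carrier M \<noteq> {\<zero>\<^bsub>M\<^esub>}) \<and> equivalent_cats fd_L (direct_sum_cat fd_K (carrier G))"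
    if cond1
  proof -
    interpret edgeless_lpa K "hopf_graph G \<rr>" using that by (intro edgeless) (simp add: cond1_def)
    \<comment> \<open>The identity of the group serves as the vertex at which a nonzero module is
      placed.\<close>
    show ?thesis
      using equivalence[OF \<iota>] nonzero_module[OF \<iota>, of "\<one>\<^bsub>G\<^esub>"]
      unfolding fd_L_def L_def fd_K_def verts_hopf by simp
  qed
  have case2: "(\<exists>M\<in>Obj fd_L. carrier M \<noteq> {\<zero>\<^bsub>M\<^esub>}) \<and>
      equivalent_cats fd_L (direct_sum_cat fd_laurent (carrier (G Mod ram_semigroup G \<rr>)))"
    if cond2
  proof -
    have deg: "ram_degree G \<rr> = 1" and sub: "submonoid (ram_semigroup G \<rr>) G"
      using that by (simp_all add: cond2_def)
    obtain edge sh n cls rep where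
      "cycle_lpa K (hopf_graph G \<rr>) edge sh n (carrier (G Mod ram_semigroup G \<rr>)) cls rep"
      by (rule cyclic[OF deg sub])
    then interpret cyc: cycle_lpa K "hopf_graph G \<rr>" edge sh n "carrier (G Mod ram_semigroup G \<rr>)" cls rep .
    \<comment> \<open>The component of the identity is the one that carries the nonzero
      module.\<close>
    have "cls \<one>\<^bsub>G\<^esub> \<in> carrier (G Mod ram_semigroup G \<rr>)" by (rule cyc.cls_closed) (simp add: verts_hopf)
    then show ?thesis
      using cyc.equivalence[OF \<iota>] cyc.nonzero_module[OF \<iota>]
      unfolding fd_L_def L_def fd_laurent_def by simp
  qed
  show ?thesis
    using necessary case1 case2 by auto
qed



end
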